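(* Suppose the marked times $((\xi_1,\tau_1),\ldots,(\xi_m,\tau_m))$ satisfy the density hypothesis with respect to $\mathcal{F}_\infty$: there exist a Borel probability measure $\nu$ on $E\times[0,\infty]$ and a nonnegative $(\mathcal{E}\otimes\mathcal{B}[0,\infty])^{\otimes m}\otimes\mathcal{F}_\infty$-measurable function $\gamma^*$ on $(E\times[0,\infty])^m\times\Omega$ with $$\mathbb{Q}[((\xi_1,\tau_1),\ldots,(\xi_m,\tau_m))\in A\mid\mathcal{F}_\infty]=\int_A\gamma^*((x_1,t_1),\ldots,(x_m,t_m))\,\nu^{\otimes m}(d(x_1,t_1),\ldots,d(x_m,t_m))$$ for all $A\in(\mathcal{E}\otimes\mathcal{B}[0,\infty])^{\otimes m}$. Then the $\mathbb{G}^{*m}$-optional splitting formula holds at times $\tau_1,\ldots,\tau_m$ with respect to $\mathbb{F}$.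
   Context: Let $(\Omega,\mathcal{A},\mathbb{Q})$ be a probability space with a right-continuous filtration $\mathbb{F}=(\mathcal{F}_t)_{t\ge0}$ such that $\mathcal{F}_0$ contains $\mathcal{N}^{\mathcal{F}_\infty}$, where for a $\sigma$-algebra $\mathcal{T}\subset\mathcal{A}$, $\mathcal{N}^{\mathcal{T}}$ denotes the $\sigma$-algebra generated by all subsets of $\mathcal{T}$-measurable $\mathbb{Q}$-null sets. Let $(E,\mathcal{E})$ be a separable complete metric space with its Borel $\sigma$-algebra, $\Delta\in E$, $E^\circ=E\setminus\{\Delta\}$. Let $\tau_1,\ldots,\tau_m$ be $[0,\infty]$-valued random variables and $\xi_1,\ldots,\xi_m$ be $E^\circ$-valued random variables. Define $H_i(t)=\Delta$ if $t<\tau_i$ and $H_i(t)=\xi_i$ if $\tau_i\le t$ ($t\ge0$). Let $\mathcal{H}^{m}_t=\sigma(H_i(s):1\le i\le m,0\le s\le t)$, $\mathcal{N}^{*m}=\mathcal{N}^{\mathcal{H}^m_\infty\vee\mathcal{F}_\infty}$, and $\mathcal{G}^{*m}_t=\mathcal{N}^{*m}\vee\bigcap_{s>t}(\mathcal{F}_s\vee\mathcal{H}^m_s)$, defining $\mathbb{G}^{*m}$. $\mathfrak{D}(E)$ is the space of càdlàg $E$-valued functions on $\mathbb{R}_+$ with the Skorokhod topology and Borel $\sigma$-algebra $\mathcal{D}$. $\sigma_{m,1}\le\cdots\le\sigma_{m,m}$ denotes the increasing reordering of $\tau_1,\ldots,\tau_m$, with $\sigma_{m,0}=0$, $\sigma_{m,m+1}=\infty$;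 $H_i^{R}$ denotes $H_i$ stopped at $R$. The $\mathbb{G}^{*m}$-optional splitting formula holds at times $\tau_1,\ldots,\tau_m$ with respect to $\mathbb{F}$ if for every $\mathbb{G}^{*m}$-optional $Y$ there exist $\mathcal{D}^{m}\otimes\mathcal{O}(\mathbb{F})$-measurable functions $Y^{(0)},\ldots,Y^{(m)}$ on $\mathfrak{D}(E)^m\times(\mathbb{R}_+\times\Omega)$ with $Y=\sum_{i=0}^mY^{(i)}(H_1^{\sigma_{m,i}},\ldots,H_m^{\sigma_{m,i}})\mathbf{1}_{[\sigma_{m,i},\sigma_{m,i+1})}$ up to indistinguishability outside a null set of $\mathcal{N}^{*m}$, where $Z(\Upsilon)(t,\omega)=Z(\Upsilon(\omega),t,\omega)$. *)

theory Defs
  imports "HOL-Probability.Probability"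
begin

section \<open>Sigma-algebra operations on subsets of a space\<close>

text \<open>Join of two families of sets, as a sigma-algebra on Om.\<close>
definition join_sa :: "'a set \<Rightarrow> 'a set set \<Rightarrow> 'a set set \<Rightarrow> 'a set set" where
  "join_sa Om S T = sigma_sets Om (S \<union> T)"

text \<open>N^T: sigma-algebra generated by all subsets of T-measurable Q-null sets.\<close>
definition null_sa :: "'a measure \<Rightarrow> 'a set set \<Rightarrow> 'a set set" where
  "null_sa Q T = sigma_sets (space Q)
     {N. \<exists>B. B \<in> T \<and> B \<in> sets Q \<and> emeasure Q B = 0 \<and> N \<subseteq> B}"

section \<open>Filtrations indexed by real time t \<ge> 0\<close>

definition F_infty :: "'a measure \<Rightarrow> (real \<Rightarrow> 'a set set) \<Rightarrow> 'a set set" where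
  "F_infty Q F = sigma_sets (space Q) (\<Union>t\<in>{0..}. F t)"

definition is_filtration :: "'a measure \<Rightarrow> (real \<Rightarrow> 'a set set) \<Rightarrow> bool" where
  "is_filtration Q F \<longleftrightarrow>
     (\<forall>t\<ge>0. sigma_algebra (space Q) (F t) \<and> F t \<subseteq> sets Q) \<and>
     (\<forall>s t. 0 \<le> s \<longrightarrow> s \<le> t \<longrightarrow> F s \<subseteq> F t)"

definition right_continuous_filtration :: "(real \<Rightarrow> 'a set set) \<Rightarrow> bool" where
  "right_continuous_filtration F \<longleftrightarrow> (\<forall>t\<ge>0. F t = (\<Inter>s\<in>{t<..}. F s))"

text \<open>Stopping times with values in [0,\<infinity>] (ennreal) w.r.t. a filtration G on space Om.\<close>
definition stopping_time_wrt :: "'a set \<Rightarrow> (real \<Rightarrow> 'a set set) \<Rightarrow> ('a \<Rightarrow> ennreal) \<Rightarrow> bool" where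
  "stopping_time_wrt Om G T \<longleftrightarrow> (\<forall>t\<ge>0. {\<omega>\<in>Om. T \<omega> \<le> ennreal t} \<in> G t)"

text \<open>Optional sigma-algebra on R_+ x Om: generated by stochastic intervals [[T,\<infinity>[[.\<close>
definition optional_sa :: "'a set \<Rightarrow> (real \<Rightarrow> 'a set set) \<Rightarrow> (real \<times> 'a) measure" where
  "optional_sa Om G = sigma ({0..} \<times> Om)
     {{(t,\<omega>) \<in> {0..} \<times> Om. T \<omega> \<le> ennreal t} | T. stopping_time_wrt Om G T}"

section \<open>Skorokhod space D(E)\<close>

text \<open>Paths are functions real \<Rightarrow> 'e; the convention x t = x 0 for t \<le> 0 makes the
  representation of a path on R_+ canonical.\<close>
definition cadlag_space :: "(real \<Rightarrow> 'e::metric_space) set" where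
  "cadlag_space = {x. (\<forall>t\<le>0. x t = x 0) \<and>
      (\<forall>t\<ge>0. continuous (at_right t) x) \<and>
      (\<forall>t>0. \<exists>l. (x \<longlongrightarrow> l) (at_left t))}"

text \<open>Time changes (Ethier--Kurtz): strictly increasing, continuous, onto [0,\<infinity>), with
  finite gamma.\<close>
definition sk_gamma :: "(real \<Rightarrow> real) \<Rightarrow> ennreal" where
  "sk_gamma l = (SUP (s,t)\<in>{(s,t). 0 \<le> t \<and> t < s}. ennreal \<bar>ln ((l s - l t) / (s - t))\<bar>)"

definition sk_timechanges :: "(real \<Rightarrow> real) set" where
  "sk_timechanges = {l. strict_mono_on {0..} l \<and> continuous_on {0..} l \<and>
      l ` {0..} = {0..} \<and> sk_gamma l < \<infinity>}"

definition sk_d :: "(real \<Rightarrow> 'e::metric_space) \<Rightarrow> (real \<Rightarrow> 'e) \<Rightarrow> (real \<Rightarrow> real) \<Rightarrow> real \<Rightarrow> ennreal" where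
  "sk_d x y l u = (SUP t\<in>{0..}. ennreal (min 1 (dist (x (min t u)) (y (min (l t) u)))))"

text \<open>Skorokhod (J1) metric on D([0,\<infinity>),E), Ethier--Kurtz (3.5.2).\<close>
definition sk_dist :: "(real \<Rightarrow> 'e::metric_space) \<Rightarrow> (real \<Rightarrow> 'e) \<Rightarrow> ennreal" where
  "sk_dist x y = (INF l\<in>sk_timechanges.
      max (sk_gamma l)
          (\<integral>\<^sup>+ u. ennreal (exp (- u)) * indicator {0..} u * sk_d x y l u \<partial>lborel))"

definition sk_open :: "(real \<Rightarrow> 'e::metric_space) set \<Rightarrow> bool" where
  "sk_open U \<longleftrightarrow> U \<subseteq> cadlag_space \<and>
     (\<forall>x\<in>U. \<exists>e>0. \<forall>y\<in>cadlag_space. sk_dist x y < e \<longrightarrow> y \<in> U)"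

text \<open>Borel sigma-algebra of the Skorokhod topology.\<close>
definition skorokhod_borel :: "(real \<Rightarrow> 'e::metric_space) measure" where
  "skorokhod_borel = sigma cadlag_space {U. sk_open U}"

section \<open>Marked times, the processes H_i and the filtrations\<close>

text \<open>H_i evaluated at an extended time s \<in> [0,\<infinity>].\<close>
definition H_at :: "'e \<Rightarrow> (nat \<Rightarrow> 'a \<Rightarrow> ennreal) \<Rightarrow> (nat \<Rightarrow> 'a \<Rightarrow> 'e) \<Rightarrow> nat \<Rightarrow> ennreal \<Rightarrow> 'a \<Rightarrow> 'e" where
  "H_at \<Delta> \<tau> \<xi> i s \<omega> = (if s < \<tau> i \<omega> then \<Delta> else \<xi> i \<omega>)"

text \<open>H_i(t) for real t (t<0 is treated as 0 via ennreal).\<close>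
definition H_proc :: "'e \<Rightarrow> (nat \<Rightarrow> 'a \<Rightarrow> ennreal) \<Rightarrow> (nat \<Rightarrow> 'a \<Rightarrow> 'e) \<Rightarrow> nat \<Rightarrow> real \<Rightarrow> 'a \<Rightarrow> 'e" where
  "H_proc \<Delta> \<tau> \<xi> i t \<omega> = H_at \<Delta> \<tau> \<xi> i (ennreal t) \<omega>"

text \<open>Path of H_i stopped at R, as an element of D(E).\<close>
definition H_stopped :: "'e \<Rightarrow> (nat \<Rightarrow> 'a \<Rightarrow> ennreal) \<Rightarrow> (nat \<Rightarrow> 'a \<Rightarrow> 'e) \<Rightarrow> nat \<Rightarrow> ennreal \<Rightarrow> 'a \<Rightarrow> real \<Rightarrow> 'e" where
  "H_stopped \<Delta> \<tau> \<xi> i R \<omega> = (\<lambda>t. H_at \<Delta> \<tau> \<xi> i (min (ennreal t) R) \<omega>)"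

text \<open>H^m_t = sigma(H_i(s) : 1 \<le> i \<le> m, 0 \<le> s \<le> t).\<close>
definition H_sa :: "'a set \<Rightarrow> 'e::topological_space \<Rightarrow> (nat \<Rightarrow> 'a \<Rightarrow> ennreal) \<Rightarrow> (nat \<Rightarrow> 'a \<Rightarrow> 'e) \<Rightarrow> nat \<Rightarrow> real \<Rightarrow> 'a set set" where
  "H_sa Om \<Delta> \<tau> \<xi> m t = sigma_sets Om
     {{\<omega>\<in>Om. H_proc \<Delta> \<tau> \<xi> i s \<omega> \<in> B} | i s B. i \<in> {1..m} \<and> 0 \<le> s \<and> s \<le> t \<and> B \<in> sets borel}"

text \<open>H^m_\<infinity>.\<close>
definition H_sa_infty :: "'a set \<Rightarrow> 'e::topological_space \<Rightarrow> (nat \<Rightarrow> 'a \<Rightarrow> ennreal) \<Rightarrow> (nat \<Rightarrow> 'a \<Rightarrow> 'e) \<Rightarrow> nat \<Rightarrow> 'a set set" where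
  "H_sa_infty Om \<Delta> \<tau> \<xi> m = sigma_sets Om (\<Union>t\<in>{0..}. H_sa Om \<Delta> \<tau> \<xi> m t)"

text \<open>N^{*m}.\<close>
definition Nstar :: "'a measure \<Rightarrow> (real \<Rightarrow> 'a set set) \<Rightarrow> 'e::topological_space \<Rightarrow> (nat \<Rightarrow> 'a \<Rightarrow> ennreal) \<Rightarrow> (nat \<Rightarrow> 'a \<Rightarrow> 'e) \<Rightarrow> nat \<Rightarrow> 'a set set" where
  "Nstar Q F \<Delta> \<tau> \<xi> m = null_sa Q (join_sa (space Q) (H_sa_infty (space Q) \<Delta> \<tau> \<xi> m) (F_infty Q F))"

text \<open>G^{*m}_t = N^{*m} \<or> \<Inter>_{s>t} (F_s \<or> H^m_s).\<close>
definition Gstar :: "'a measure \<Rightarrow> (real \<Rightarrow> 'a set set) \<Rightarrow> 'e::topological_space \<Rightarrow> (nat \<Rightarrow> 'a \<Rightarrow> ennreal) \<Rightarrow> (nat \<Rightarrow> 'a \<Rightarrow> 'e) \<Rightarrow> nat \<Rightarrow> real \<Rightarrow> 'a set set" where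
  "Gstar Q F \<Delta> \<tau> \<xi> m t = join_sa (space Q) (Nstar Q F \<Delta> \<tau> \<xi> m)
     (\<Inter>s\<in>{t<..}. join_sa (space Q) (F s) (H_sa (space Q) \<Delta> \<tau> \<xi> m s))"

text \<open>Order statistics sigma_{m,i}: sigma_{m,0} = 0, sigma_{m,m+1} = \<infinity>, and for 1 \<le> i \<le> m
  the i-th smallest of tau_1,...,tau_m (with multiplicity).\<close>
definition order_stat :: "(nat \<Rightarrow> 'a \<Rightarrow> ennreal) \<Rightarrow> nat \<Rightarrow> nat \<Rightarrow> 'a \<Rightarrow> ennreal" where
  "order_stat \<tau> m i \<omega> =
     (if i = 0 then 0
      else if i \<le> m then sort (map (\<lambda>j. \<tau> j \<omega>) [1..<m+1]) ! (i - 1)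
      else \<infinity>)"

section \<open>The optional splitting formula\<close>

definition optional_splitting_formula ::
  "'a measure \<Rightarrow> (real \<Rightarrow> 'a set set) \<Rightarrow> 'e::metric_space \<Rightarrow> (nat \<Rightarrow> 'a \<Rightarrow> ennreal) \<Rightarrow> (nat \<Rightarrow> 'a \<Rightarrow> 'e) \<Rightarrow> nat \<Rightarrow> bool" where
  "optional_splitting_formula Q F \<Delta> \<tau> \<xi> m \<longleftrightarrow>
     (\<forall>Y :: real \<times> 'a \<Rightarrow> real.
        Y \<in> borel_measurable (optional_sa (space Q) (Gstar Q F \<Delta> \<tau> \<xi> m)) \<longrightarrow>
        (\<exists>Ys :: nat \<Rightarrow> (nat \<Rightarrow> real \<Rightarrow> 'e) \<times> (real \<times> 'a) \<Rightarrow> real.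
           (\<forall>i\<in>{0..m}. Ys i \<in> borel_measurable
               ((\<Pi>\<^sub>M j\<in>{1..m}. skorokhod_borel) \<Otimes>\<^sub>M optional_sa (space Q) F)) \<and>
           (\<exists>N. N \<in> Nstar Q F \<Delta> \<tau> \<xi> m \<and> (\<exists>B\<in>sets Q. N \<subseteq> B \<and> emeasure Q B = 0) \<and>
              (\<forall>\<omega>\<in>space Q - N. \<forall>t\<ge>0.
                 Y (t, \<omega>) =
                   (\<Sum>i=0..m. Ys i (\<lambda>j\<in>{1..m}. H_stopped \<Delta> \<tau> \<xi> j (order_stat \<tau> m i \<omega>) \<omega>, (t, \<omega>))
                      * indicator {(s, \<omega>'). order_stat \<tau> m i \<omega>' \<le> ennreal s \<and>
                                             ennreal s < order_stat \<tau> m (Suc i) \<omega>'} (t, \<omega>))))))"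

end

theory Submission
  imports Defs
begin

text \<open>
  By a monotone class argument it is enough to split the stochastic intervals \<open>T \<le> t\<close> of stopping times \<open>T\<close> of
  the enlarged filtration. Between two consecutive order statistics such a \<open>T\<close> is a passage time
  \<open>f (p, \<omega>)\<close>, where \<open>p\<close> is the vector of stopped paths and \<open>{f \<le> t}\<close> is measurable for \<open>p\<close> and \<open>F s\<close>, for every
  \<open>s > t\<close>. The density hypothesis makes the joint law of \<open>(p, \<omega>)\<close> absolutely continuous with respect to
  a product measure. Under a product measure, \<open>{f \<le> t}\<close> agrees for all \<open>t\<close> simultaneously, up to a null
  set, with a set that is measurable for the product of the path space and the optional sigma-algebra;
  this is obtained by averaging over the cells of finite partitions of the path space.
\<close>

section \<open>Skorokhod space and step paths\<close>

text \<open>The exceptional event must serve all \<open>t\<close> at once, so versions chosen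
  separately for each \<open>t\<close> do not suffice; passing through whole passage times, compared
  with rational levels only, keeps the null sets countable in number. Between two consecutive order
  statistics the stopped paths do not move, so there the path argument can be frozen, and what
  remains at stake is measurability jointly in the path and in \<open>(t, \<omega>)\<close>. The
  density serves only to carry null sets: the reference law of the paths for the index
  \<open>i\<close> is the image of the m-fold product of \<open>\<nu>\<close> under the map from
  marks and times to stopped paths, and a set that is null for the product of this law with
  \<open>Q\<close> on \<open>F_infty\<close> is met by the true pair of stopped paths and
  \<open>\<omega>\<close> only on a \<open>Q\<close>-null event. Every such event is kept in the
  sigma-algebra \<open>J\<close> generated by \<open>F_infty\<close> and all the processes
  \<open>H_i\<close>, since \<open>Nstar\<close> is built from the null sets of
  \<open>J\<close>.\<close>

lemma cadlag_spaceD_right: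
  "x \<in> cadlag_space \<Longrightarrow> 0 \<le> t \<Longrightarrow> (x \<longlongrightarrow> x t) (at_right t)"
  by (auto simp: cadlag_space_def continuous_within)

lemma sk_timechange_0:
  assumes "l \<in> sk_timechanges" shows "l 0 = 0"
proof -
  have im: "l ` {0..} = {0..}" and sm: "strict_mono_on {0..} l"
    using assms by (auto simp: sk_timechanges_def)
  have "0 \<in> l ` {0..}" using im by simp
  then obtain r where r: "0 \<le> r" "l r = 0" by auto
  have "0 \<le> l 0" using im by (metis atLeast_iff imageI order_refl)
  moreover have "l 0 \<le> l r"
    using r sm by (metis atLeast_iff order_refl strict_mono_on_leD)
  ultimately show ?thesis using r by simp
qed

text \<open>Since \<open>l 0 = 0\<close>, the pair \<open>(u, 0)\<close> in the supremum defining
  \<open>sk_gamma\<close> controls the logarithm of \<open>l u / u\<close>. A small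
  \<open>sk_gamma\<close> thus moves a time only by a factor close to 1.\<close>

lemma sk_timechange_bounds:
  assumes l: "l \<in> sk_timechanges" and g: "sk_gamma l < ennreal e" and u: "0 < u" and e: "0 < e"
  shows "u * exp (- e) < l u" "l u < u * exp e"
proof -
  have l0: "l 0 = 0" by (rule sk_timechange_0[OF l])
  have "strict_mono_on {0..} l" using l by (simp add: sk_timechanges_def)
  then have "l 0 < l u" using u by (auto simp: strict_mono_on_def)
  then have lu: "0 < l u" using l0 by simp
  have "ennreal \<bar>ln ((l u - l 0) / (u - 0))\<bar> \<le> sk_gamma l"
    unfolding sk_gamma_def
    by (rule SUP_upper2[of "(u, 0)"]) (use u in auto)
  then have "ennreal \<bar>ln (l u / u)\<bar> < ennreal e" using g l0 by auto
  then have "\<bar>ln (l u / u)\<bar> < e" using e by (simp add: ennreal_less_iff)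
  then have "ln (l u / u) < e" "- e < ln (l u / u)" by auto
  moreover have "0 < l u / u" using lu u by simp
  ultimately have "l u / u < exp e" "exp (-e) < l u / u"
    by (metis exp_less_cancel_iff exp_ln)+
  then show "u * exp (- e) < l u" "l u < u * exp e"
    using u by (auto simp: field_simps)
qed

text \<open>Evaluation at a fixed time is not continuous in the Skorokhod topology, but hitting an
  open set during an open time interval survives a small time change: if \<open>x u0\<close> is in
  \<open>V\<close> and \<open>y\<close> is close to \<open>x\<close>, then \<open>y (l u0)\<close>
  is in \<open>V\<close> and \<open>l u0\<close> is still between \<open>a\<close> and
  \<open>b\<close>.\<close>

lemma sk_open_hits:
  fixes V :: "'e::metric_space set"
  assumes V: "open V" and a: "0 \<le> a"
  shows "sk_open {x \<in> cadlag_space. \<exists>u. a < u \<and> u < b \<and> x u \<in> V}" (is "sk_open ?O")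
  unfolding sk_open_def
proof (intro conjI ballI)
  show "?O \<subseteq> cadlag_space" by auto
  fix x assume "x \<in> ?O"
  then obtain u0 where u0: "a < u0" "u0 < b" "x u0 \<in> V" by auto
  have u0p: "0 < u0" using a u0 by simp
  obtain r where r: "0 < r" "\<And>y. dist (x u0) y < r \<Longrightarrow> y \<in> V"
    using V u0(3) by (auto simp: open_contains_ball subset_eq)
  \<comment> \<open>\<open>sk_d\<close> caps distances at 1, so only thresholds up to 1 can be read
    off from it.\<close>
  define \<rho> where "\<rho> = min r 1"
  have \<rho>: "0 < \<rho>" "\<rho> \<le> 1" "\<And>y. dist (x u0) y < \<rho> \<Longrightarrow> y \<in> V" using r by (auto simp: \<rho>_def)
  have "eventually (\<lambda>e. a < u0 * exp (- e)) (at_right 0)"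
  proof (rule order_tendstoD)
    show "((\<lambda>e. u0 * exp (- e)) \<longlongrightarrow> u0 * exp (- 0)) (at_right 0)" by (intro tendsto_intros)
    show "a < u0 * exp (- 0)" using u0 by simp
  qed
  moreover have "eventually (\<lambda>e. u0 * exp e < b) (at_right 0)"
  proof (rule order_tendstoD)
    show "((\<lambda>e. u0 * exp e) \<longlongrightarrow> u0 * exp 0) (at_right 0)" by (intro tendsto_intros)
    show "u0 * exp 0 < b" using u0 by simp
  qed
  \<comment> \<open>If \<open>sk_d\<close> were at least \<open>\<rho>\<close> on all of
    \<open>{b..b+1}\<close>, the integral in \<open>sk_dist\<close> would be at least this bound:
    the interval has length 1 and the weight there is at least \<open>exp (- (b + 1))\<close>.
    Levels \<open>u\<close> from \<open>b\<close> on truncate neither \<open>u0\<close> nor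
    \<open>l u0\<close>.\<close>
  moreover have "eventually (\<lambda>e. e < \<rho> * exp (- (b + 1))) (at_right (0::real))"
    by (rule order_tendstoD[OF tendsto_ident_at]) (use \<rho> in simp)
  moreover have "eventually (\<lambda>e. 0 < e) (at_right (0::real))" by (rule eventually_at_right_less)
  ultimately have "eventually (\<lambda>e. a < u0 * exp (- e) \<and> u0 * exp e < b \<and> e < \<rho> * exp (- (b + 1)) \<and> 0 < e) (at_right 0)"
    by eventually_elim auto
  then obtain e where e: "a < u0 * exp (- e)" "u0 * exp e < b" "e < \<rho> * exp (- (b + 1))" "0 < e"
    using eventually_happens[of _ "at_right (0::real)"] by auto
  show "\<exists>e>0. \<forall>y\<in>cadlag_space. sk_dist x y < e \<longrightarrow> y \<in> ?O"
  proof (intro exI[of _ "ennreal e"] conjI ballI impI)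
    show "0 < ennreal e" using e by simp
    fix y :: "real \<Rightarrow> 'e" assume y: "y \<in> cadlag_space" and d: "sk_dist x y < ennreal e"
    obtain l where l: "l \<in> sk_timechanges" and g: "sk_gamma l < ennreal e" and
      i: "(\<integral>\<^sup>+ u. ennreal (exp (- u)) * indicator {0..} u * sk_d x y l u \<partial>lborel) < ennreal e"
      using d by (auto simp: sk_dist_def INF_less_iff)
    have lu: "a < l u0" "l u0 < b"
      using sk_timechange_bounds[OF l g u0p e(4)] e by auto
    have "\<exists>u\<in>{b..b+1}. sk_d x y l u < ennreal \<rho>"
    proof (rule ccontr)
      assume "\<not> ?thesis"
      then have c: "\<And>u. u \<in> {b..b+1} \<Longrightarrow> ennreal \<rho> \<le> sk_d x y l u" by (auto simp: not_less)
      have "ennreal (\<rho> * exp (- (b + 1))) = (\<integral>\<^sup>+ u. ennreal (exp (- (b+1)) * \<rho>) * indicator {b..b+1} u \<partial>lborel)"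
        by (subst nn_integral_cmult_indicator) (simp_all add: ac_simps)
      also have "\<dots> \<le> (\<integral>\<^sup>+ u. ennreal (exp (- u)) * indicator {0..} u * sk_d x y l u \<partial>lborel)"
      proof (rule nn_integral_mono)
        fix u :: real
        show "ennreal (exp (- (b+1)) * \<rho>) * indicator {b..b+1} u \<le> ennreal (exp (- u)) * indicator {0..} u * sk_d x y l u"
        proof (cases "u \<in> {b..b+1}")
          case True
          have "ennreal (exp (- (b+1)) * \<rho>) = ennreal (exp (- (b+1))) * ennreal \<rho>"
            using \<rho> by (simp add: ennreal_mult)
          also have "\<dots> \<le> ennreal (exp (- u)) * sk_d x y l u"
            by (intro mult_mono c) (use True in \<open>auto intro!: ennreal_leI\<close>)
          finally show ?thesis using True u0 u0p by (auto simp: indicator_def)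
        qed auto
      qed
      also have "\<dots> < ennreal e" by (rule i)
      finally show False using e by (simp add: ennreal_less_iff)
    qed
    then obtain u where u: "b \<le> u" "sk_d x y l u < ennreal \<rho>" by auto
    have "ennreal (min 1 (dist (x (min u0 u)) (y (min (l u0) u)))) \<le> sk_d x y l u"
      unfolding sk_d_def by (rule SUP_upper) (use u0p in auto)
    then have "ennreal (min 1 (dist (x (min u0 u)) (y (min (l u0) u)))) < ennreal \<rho>" using u by auto
    moreover have "min u0 u = u0" "min (l u0) u = l u0" using u u0 lu by auto
    ultimately have "dist (x u0) (y (l u0)) < \<rho>" using \<rho> by (auto simp: ennreal_less_iff)
    then have "y (l u0) \<in> V" by (rule \<rho>)
    then show "y \<in> ?O" using y lu by auto
  qed
qed

lemma space_skorokhod_borel [simp]: "space skorokhod_borel = cadlag_space"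
  unfolding skorokhod_borel_def by (rule space_measure_of) (auto simp: sk_open_def)

lemma sk_open_sets [intro]: "sk_open U \<Longrightarrow> U \<in> sets skorokhod_borel"
  unfolding skorokhod_borel_def by (subst sets_measure_of) (auto simp: sk_open_def)

text \<open>By right-continuity, \<open>x s\<close> lies in an open \<open>V\<close> exactly if the
  path stays, shortly after \<open>s\<close>, in one of countably many closed sets exhausting
  \<open>V\<close>. Staying in a closed set is the complement of a hitting event of
  \<open>sk_open_hits\<close>.\<close>

lemma measurable_skorokhod_eval:
  fixes s :: real
  assumes s: "0 \<le> s"
  shows "(\<lambda>x. x s) \<in> borel_measurable (skorokhod_borel :: (real \<Rightarrow> 'e::metric_space) measure)"
proof (rule borel_measurableI)
  fix V :: "'e set" assume V: "open V"
  show "(\<lambda>x. x s) -` V \<inter> space skorokhod_borel \<in> sets skorokhod_borel"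
  \<comment> \<open>\<open>infdist\<close> to the empty set is 0, so the sets \<open>C n\<close>
    would not exhaust \<open>V = UNIV\<close>.\<close>
  proof (cases "V = UNIV")
    case True then show ?thesis by (metis Int_commute Int_UNIV_right sets.top vimage_UNIV)
  next
    case False
    then have ne: "- V \<noteq> {}" by auto
    define C where "C n = {y. 1 / real (Suc n) \<le> infdist y (- V)}" for n
    have "- C n = {y. infdist y (- V) < 1 / real (Suc n)}" for n
      by (auto simp: C_def)
    moreover have "open {y. infdist y (- V) < 1 / real (Suc n)}" for n
      by (intro open_Collect_less continuous_intros)
    ultimately have oC: "open (- C n)" for n by simp
    have CV: "C n \<subseteq> V" for n
    proof
      fix y assume y: "y \<in> C n"
      show "y \<in> V"
      proof (rule ccontr)
        assume "y \<notin> V"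
        then have "infdist y (- V) = 0" by (intro infdist_zero) auto
        then show False using y by (simp add: C_def)
      qed
    qed
    define A where "A n k = {x \<in> cadlag_space. \<forall>u. s < u \<and> u < s + 1 / real (Suc k) \<longrightarrow> x u \<in> C n}" for n k
    have Aeq: "A n k = space skorokhod_borel - {x \<in> cadlag_space. \<exists>u. s < u \<and> u < s + 1 / real (Suc k) \<and> x u \<in> - C n}" for n k
      by (auto simp: A_def)
    have A: "A n k \<in> sets skorokhod_borel" for n k
      unfolding Aeq by (intro sets.compl_sets sk_open_sets sk_open_hits oC s)
    have "(\<lambda>x. x s) -` V \<inter> space skorokhod_borel = (\<Union>n k. A n k)"
    proof (intro equalityI subsetI)
      fix x :: "real \<Rightarrow> 'e" assume "x \<in> (\<lambda>x. x s) -` V \<inter> space skorokhod_borel"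
      then have x: "x s \<in> V" "x \<in> cadlag_space" by auto
      have "0 < infdist (x s) (- V)"
        using x ne V by (metis ComplD infdist_pos_not_in_closed closed_Compl)
      then obtain n where n: "1 / real (Suc n) < infdist (x s) (- V)"
        by (metis inverse_eq_divide reals_Archimedean)
      have "((\<lambda>u. infdist (x u) (- V)) \<longlongrightarrow> infdist (x s) (- V)) (at_right s)"
        by (intro tendsto_infdist cadlag_spaceD_right x s)
      then have "eventually (\<lambda>u. 1 / real (Suc n) < infdist (x u) (- V)) (at_right s)"
        by (rule order_tendstoD) (rule n)
      then obtain b where b: "s < b" "\<And>u. s < u \<Longrightarrow> u < b \<Longrightarrow> 1 / real (Suc n) < infdist (x u) (- V)"
        by (auto simp: eventually_at_right_field)
      obtain k where "1 / real (Suc k) < b - s" using b(1) reals_Archimedean[of "b - s"] by (auto simp: inverse_eq_divide)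
      then have "x \<in> A n k" using x b(2) by (auto simp: A_def C_def intro!: less_imp_le)
      then show "x \<in> (\<Union>n k. A n k)" by auto
    next
      fix x :: "real \<Rightarrow> 'e" assume "x \<in> (\<Union>n k. A n k)"
      then obtain n k where nk: "x \<in> A n k" by auto
      then have xc: "x \<in> cadlag_space" by (simp add: A_def)
      have "eventually (\<lambda>u. x u \<in> C n) (at_right s)"
        unfolding eventually_at_right_field
        by (rule exI[of _ "s + 1 / real (Suc k)"]) (use nk in \<open>auto simp: A_def\<close>)
      moreover have "closed (C n)" using oC by (simp add: closed_def)
      ultimately have "x s \<in> C n"
        using cadlag_spaceD_right[OF xc s]
        by (intro Lim_in_closed_set[of "C n" x "at_right s" "x s"]) auto
      then show "x \<in> (\<lambda>x. x s) -` V \<inter> space skorokhod_borel" using CV xc by auto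
    qed
    then show ?thesis using A by auto
  qed
qed

text \<open>\<open>ennreal\<close> sends negative times to 0, so the path is constant to the left of
  0, as \<open>cadlag_space\<close> demands. The jump times \<open>0\<close> and
  \<open>\<infinity>\<close> give the constant paths \<open>x\<close> and
  \<open>\<Delta>\<close>.\<close>

definition step_path :: "'e \<Rightarrow> 'e \<Rightarrow> ennreal \<Rightarrow> real \<Rightarrow> 'e" where
  "step_path \<Delta> x s = (\<lambda>t. if ennreal t < s then \<Delta> else x)"

lemma step_path_cadlag: "step_path \<Delta> x s \<in> cadlag_space"
proof -
  have 1: "continuous (at_right t) (step_path \<Delta> x s)" if "0 \<le> t" for t
  proof (cases "ennreal t < s")
    case True
    have "((\<lambda>u. ennreal u) \<longlongrightarrow> ennreal t) (at_right t)" by (intro tendsto_intros)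
    then have "eventually (\<lambda>u. ennreal u < s) (at_right t)" by (rule order_tendstoD) (rule True)
    then have "eventually (\<lambda>u. step_path \<Delta> x s u = step_path \<Delta> x s t) (at_right t)"
      by eventually_elim (use True in \<open>auto simp: step_path_def\<close>)
    then show ?thesis unfolding continuous_within by (rule tendsto_eventually)
  next
    case False
    have "eventually (\<lambda>u. t < u) (at_right t)" by (rule eventually_at_right_less)
    then have "eventually (\<lambda>u. step_path \<Delta> x s u = step_path \<Delta> x s t) (at_right t)"
    proof eventually_elim
      case (elim u)
      then have "\<not> ennreal u < s" using False by (metis ennreal_leI less_imp_le order_le_less_trans not_less)
      then show ?case using False by (simp add: step_path_def)
    qed
    then show ?thesis unfolding continuous_within by (rule tendsto_eventually)
  qed
  have 2: "\<exists>l. (step_path \<Delta> x s \<longlongrightarrow> l) (at_left t)" if "0 < t" for t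
  proof (cases "s < ennreal t")
    case True
    have "((\<lambda>u. ennreal u) \<longlongrightarrow> ennreal t) (at_left t)" by (intro tendsto_intros)
    then have "eventually (\<lambda>u. s < ennreal u) (at_left t)" by (rule order_tendstoD) (rule True)
    then have "eventually (\<lambda>u. step_path \<Delta> x s u = x) (at_left t)"
      by eventually_elim (auto simp: step_path_def)
    then show ?thesis using tendsto_eventually by blast
  next
    case False
    have "eventually (\<lambda>u. u \<in> {0<..<t}) (at_left t)" by (rule eventually_at_leftI[OF _ that])
    then have "eventually (\<lambda>u. step_path \<Delta> x s u = \<Delta>) (at_left t)"
    proof eventually_elim
      case (elim u)
      then have "ennreal u < ennreal t" by (auto simp: ennreal_less_iff)
      then show ?case using False by (auto simp: step_path_def)
    qed
    then show ?thesis using tendsto_eventually by blast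
  qed
  show ?thesis unfolding cadlag_space_def using 1 2
    by (auto simp: step_path_def ennreal_neg)
qed

section \<open>Skorokhod distance of step paths and their measurability in mark and jump
  time\<close>

lemma linear_timechange:
  assumes c: "0 < c"
  shows "(\<lambda>t. c * t) \<in> sk_timechanges" "sk_gamma (\<lambda>t. c * t) \<le> ennreal \<bar>ln c\<bar>"
proof -
  show g: "sk_gamma (\<lambda>t. c * t) \<le> ennreal \<bar>ln c\<bar>"
    unfolding sk_gamma_def
    by (rule SUP_least) (auto simp: right_diff_distrib[symmetric])
  have "(\<lambda>t. c * t) ` {0..} = {0..}"
  proof (intro equalityI subsetI)
    fix y :: real assume "y \<in> {0..}"
    then show "y \<in> (\<lambda>t. c * t) ` {0..}" using c by (intro image_eqI[of _ _ "y / c"]) auto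
  qed (use c in auto)
  moreover have "strict_mono_on {0..} (\<lambda>t. c * t)" using c by (auto simp: strict_mono_on_def)
  moreover have "sk_gamma (\<lambda>t. c * t) < \<infinity>" using g by (auto intro: le_less_trans)
  ultimately show "(\<lambda>t. c * t) \<in> sk_timechanges"
    by (auto simp: sk_timechanges_def intro!: continuous_intros)
qed

text \<open>The weight \<open>exp (- u)\<close> has total mass 1 on \<open>{0..}\<close> and is at
  most 1 there, so the constant contributes \<open>d\<close> and the interval at most its
  length.\<close>

lemma nn_integral_exp_bound:
  "(\<integral>\<^sup>+ u. ennreal (exp (- u)) * indicator {0..} u * (ennreal d + indicator {a..b} u) \<partial>lborel)
     \<le> ennreal d + emeasure lborel {a..b}"
proof -
  have "(\<integral>\<^sup>+ u. ennreal (exp (- u)) * indicator {0..} u * (ennreal d + indicator {a..b} u) \<partial>lborel)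
    \<le> (\<integral>\<^sup>+ u. ennreal d * (ennreal (exp (- u)) * indicator {0..} u) + indicator {a..b} u \<partial>lborel)"
    by (rule nn_integral_mono) (auto simp: indicator_def distrib_left mult.commute ennreal_le_1)
  also have "\<dots> = ennreal d * (\<integral>\<^sup>+ u. ennreal (exp (- u)) * indicator {0..} u \<partial>lborel) + emeasure lborel {a..b}"
    by (subst nn_integral_add) (auto simp: nn_integral_cmult)
  also have "(\<integral>\<^sup>+ u. ennreal (exp (- u)) * indicator {0..} u \<partial>lborel) = 1"
    using nn_intergal_power_times_exp_Ici[of 0] by simp
  finally show ?thesis by simp
qed

text \<open>The linear time change with slope \<open>s' / s\<close> carries one jump time to the
  other. What remains is the distance of the marks, and a capped distance of at most 1 for the
  truncation levels \<open>u\<close> between \<open>s\<close> and \<open>s'\<close>, where only one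
  of the paths has room to jump.\<close>

lemma sk_dist_step_path:
  assumes s: "0 < s" "0 < s'"
  shows "sk_dist (step_path \<Delta> x (ennreal s)) (step_path \<Delta> x' (ennreal s'))
     \<le> max (ennreal \<bar>ln (s' / s)\<bar>) (ennreal (dist x x') + ennreal \<bar>s' - s\<bar>)"
proof -
  let ?l = "\<lambda>t. (s' / s) * t"
  let ?x = "step_path \<Delta> x (ennreal s)" and ?y = "step_path \<Delta> x' (ennreal s')"
  have c: "0 < s' / s" using s by simp
  have d: "sk_d ?x ?y ?l u \<le> ennreal (dist x x') + indicator {min s s'..max s s'} u" for u
    unfolding sk_d_def
  proof (rule SUP_least)
    fix t :: real assume t: "t \<in> {0..}"
    show "ennreal (min 1 (dist (?x (min t u)) (?y (min (?l t) u)))) \<le> ennreal (dist x x') + indicator {min s s'..max s s'} u"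
    proof (cases "u \<in> {min s s'..max s s'}")
      case True
      then show ?thesis
        by (auto intro!: order_trans[OF _ add_increasing[of _ 1 1]] simp: ennreal_le_1 min.coboundedI1)
    next
      case False
      have less: "t < s \<longleftrightarrow> ?l t < s'" using s by (simp add: field_simps)
      from False consider "u < s" "u < s'" | "s < u" "s' < u" by (auto simp: min_def max_def split: if_splits)
      then have "dist (?x (min t u)) (?y (min (?l t) u)) \<le> dist x x'"
      proof cases
        case 1
        then have "?x (min t u) = \<Delta>" "?y (min (?l t) u) = \<Delta>"
          using s by (auto simp: step_path_def ennreal_lessI min_less_iff_disj)
        then show ?thesis by simp
      next
        case 2
        have "?x (min t u) = (if t < s then \<Delta> else x)" "?y (min (?l t) u) = (if ?l t < s' then \<Delta> else x')"
          using 2 s t by (auto simp: step_path_def ennreal_less_iff min_less_iff_disj)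
        then show ?thesis using less by auto
      qed
      then have "ennreal (min 1 (dist (?x (min t u)) (?y (min (?l t) u)))) \<le> ennreal (dist x x')"
        by (intro ennreal_leI) auto
      then show ?thesis by (auto intro: order_trans add_increasing2)
    qed
  qed
  have "(\<integral>\<^sup>+ u. ennreal (exp (- u)) * indicator {0..} u * sk_d ?x ?y ?l u \<partial>lborel)
    \<le> (\<integral>\<^sup>+ u. ennreal (exp (- u)) * indicator {0..} u * (ennreal (dist x x') + indicator {min s s'..max s s'} u) \<partial>lborel)"
    by (intro nn_integral_mono mult_left_mono d) auto
  also have "\<dots> \<le> ennreal (dist x x') + emeasure lborel {min s s'..max s s'}" by (rule nn_integral_exp_bound)
  also have "emeasure lborel {min s s'..max s s'} = ennreal \<bar>s' - s\<bar>"
    by (auto simp: min_def max_def)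
  finally have i: "(\<integral>\<^sup>+ u. ennreal (exp (- u)) * indicator {0..} u * sk_d ?x ?y ?l u \<partial>lborel)
     \<le> ennreal (dist x x') + ennreal \<bar>s' - s\<bar>" .
  show ?thesis unfolding sk_dist_def
    by (rule INF_lower2[OF linear_timechange(1)[OF c]]) (intro max.mono linear_timechange(2)[OF c] i)
qed

lemma sk_dist_const:
  "sk_dist (step_path \<Delta> x 0) (step_path \<Delta> x' 0) \<le> ennreal (dist x x')"
proof -
  let ?x = "step_path \<Delta> x 0" and ?y = "step_path \<Delta> x' 0"
  let ?l = "\<lambda>t. 1 * t :: real"
  \<comment> \<open>The interval \<open>{1..0}\<close> is empty; it only brings the integrand into
    the form of \<open>nn_integral_exp_bound\<close>.\<close>
  have "sk_d ?x ?y ?l u \<le> ennreal (dist x x') + indicator {1..0} u" for u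
    unfolding sk_d_def by (rule SUP_least) (auto simp: step_path_def intro!: ennreal_leI)
  then have "(\<integral>\<^sup>+ u. ennreal (exp (- u)) * indicator {0..} u * sk_d ?x ?y ?l u \<partial>lborel)
    \<le> (\<integral>\<^sup>+ u. ennreal (exp (- u)) * indicator {0..} u * (ennreal (dist x x') + indicator {1..0} u) \<partial>lborel)"
    by (intro nn_integral_mono mult_left_mono) auto
  also have "\<dots> \<le> ennreal (dist x x') + emeasure lborel {1..0::real}" by (rule nn_integral_exp_bound)
  finally have i: "(\<integral>\<^sup>+ u. ennreal (exp (- u)) * indicator {0..} u * sk_d ?x ?y ?l u \<partial>lborel) \<le> ennreal (dist x x')"
    by simp
  have "sk_gamma ?l \<le> ennreal (dist x x')" using linear_timechange(2)[of 1] by simp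
  with i show ?thesis unfolding sk_dist_def
    by (intro INF_lower2[OF linear_timechange(1)[of 1]]) auto
qed

text \<open>The map is continuous in \<open>(x, s)\<close> for finite positive \<open>s\<close> and
  in \<open>x\<close> for \<open>s = 0\<close>, but not across \<open>s = 0\<close>, as no time
  change moves the time 0. Hence the preimage of an open set is split according to \<open>s\<close>;
  at \<open>s = \<infinity>\<close> the mark does not enter, so that part is everything or
  nothing.\<close>

lemma measurable_step_path:
  fixes \<Delta> :: "'e::polish_space"
  shows "(\<lambda>(x, s). step_path \<Delta> x s) \<in> borel \<Otimes>\<^sub>M borel \<rightarrow>\<^sub>M skorokhod_borel"
  unfolding skorokhod_borel_def
proof (rule measurable_measure_of)
  show "{U. sk_open U} \<subseteq> Pow (cadlag_space :: (real \<Rightarrow> 'e) set)" by (auto simp: sk_open_def)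
  show "(\<lambda>(x, s). step_path \<Delta> x s) \<in> space (borel \<Otimes>\<^sub>M borel) \<rightarrow> cadlag_space"
    by (auto simp: step_path_cadlag)
  fix U :: "(real \<Rightarrow> 'e) set" assume "U \<in> {U. sk_open U}"
  then have U: "sk_open U" by simp
  let ?O = "{z :: 'e \<times> real. 0 < snd z \<and> step_path \<Delta> (fst z) (ennreal (snd z)) \<in> U}"
  let ?Z = "{x. step_path \<Delta> x 0 \<in> U}"
  have O: "open ?O"
  proof (subst open_subopen, intro ballI)
    fix z assume z: "z \<in> ?O"
    define x s where "x = fst z" and "s = snd z"
    have s: "0 < s" and xU: "step_path \<Delta> x (ennreal s) \<in> U" using z by (auto simp: x_def s_def)
    obtain e where e: "e > 0" "\<And>y. y \<in> cadlag_space \<Longrightarrow> sk_dist (step_path \<Delta> x (ennreal s)) y < e \<Longrightarrow> y \<in> U"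
      using U xU unfolding sk_open_def by blast
    have t: "((\<lambda>z'. max (ennreal \<bar>ln (snd z' / s)\<bar>) (ennreal (dist x (fst z')) + ennreal \<bar>snd z' - s\<bar>))
        \<longlongrightarrow> max (ennreal \<bar>ln (snd z / s)\<bar>) (ennreal (dist x (fst z)) + ennreal \<bar>snd z - s\<bar>)) (nhds z)"
      using s by (intro tendsto_max tendsto_intros filterlim_ident) (auto simp: s_def)
    have "eventually (\<lambda>z'. max (ennreal \<bar>ln (snd z' / s)\<bar>) (ennreal (dist x (fst z')) + ennreal \<bar>snd z' - s\<bar>) < e) (nhds z)"
      by (rule order_tendstoD(2)[OF t]) (use e s in \<open>auto simp: x_def s_def\<close>)
    moreover have "eventually (\<lambda>z'. 0 < snd z') (nhds z)"
      by (rule order_tendstoD(1)[of snd "snd z"]) (use s in \<open>auto simp: s_def intro!: tendsto_intros filterlim_ident\<close>)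
    ultimately have "eventually (\<lambda>z'. z' \<in> ?O) (nhds z)"
    proof eventually_elim
      case (elim z')
      have "sk_dist (step_path \<Delta> x (ennreal s)) (step_path \<Delta> (fst z') (ennreal (snd z'))) < e"
        using sk_dist_step_path[OF s elim(2), of \<Delta> x "fst z'"] elim(1) by (rule le_less_trans)
      then show ?case using elim(2) e(2)[OF step_path_cadlag] by auto
    qed
    then show "\<exists>T. open T \<and> z \<in> T \<and> T \<subseteq> ?O" unfolding eventually_nhds by blast
  qed
  have Z: "open ?Z"
    unfolding open_dist
  proof (intro ballI)
    fix x assume "x \<in> ?Z"
    then have xU: "step_path \<Delta> x 0 \<in> U" by simp
    obtain e where e: "e > 0" "\<And>y. y \<in> cadlag_space \<Longrightarrow> sk_dist (step_path \<Delta> x 0) y < e \<Longrightarrow> y \<in> U"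
      using U xU unfolding sk_open_def by blast
    \<comment> \<open>The radius \<open>e\<close> may be infinite; a finite one below it is needed
      for a ball in the space of marks.\<close>
    obtain r' where r': "0 < r'" "r' < e" using dense[OF e(1)] by auto
    define r where "r = enn2real r'"
    have "r' < top" using r'(2) by (rule less_le_trans) simp
    then have r: "0 < r" "ennreal r < e"
      using r' unfolding r_def by (simp_all add: enn2real_positive_iff)
    show "\<exists>e>0. \<forall>y. dist y x < e \<longrightarrow> y \<in> ?Z"
    proof (intro exI[of _ r] conjI allI impI)
      fix y assume "dist y x < r"
      then have "ennreal (dist x y) \<le> ennreal r" by (intro ennreal_leI) (simp add: dist_commute)
      then have "sk_dist (step_path \<Delta> x 0) (step_path \<Delta> y 0) < e"
        using sk_dist_const[of \<Delta> x y] r(2) by (meson order_le_less_trans order_trans)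
      then show "y \<in> ?Z" using e(2)[OF step_path_cadlag] by auto
    qed (rule r)
  qed
  have "(\<lambda>(x, s). step_path \<Delta> x s) -` U \<inter> space (borel \<Otimes>\<^sub>M borel) =
     (?Z \<times> {0}) \<union> (if step_path \<Delta> \<Delta> \<infinity> \<in> U then UNIV \<times> {\<infinity>} else {}) \<union>
     ((\<lambda>(x, s). (x, enn2real s)) -` ?O \<inter> (UNIV \<times> {s. s \<noteq> \<infinity>}) \<inter> space (borel \<Otimes>\<^sub>M borel))"
  proof -
    have inf: "step_path \<Delta> x \<infinity> = step_path \<Delta> \<Delta> \<infinity>" for x by (auto simp: step_path_def)
    have eq: "step_path \<Delta> x s \<in> U \<longleftrightarrow> (s = 0 \<and> step_path \<Delta> x 0 \<in> U) \<or> (s = \<infinity> \<and> step_path \<Delta> \<Delta> \<infinity> \<in> U)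
       \<or> (s \<noteq> \<infinity> \<and> 0 < enn2real s \<and> step_path \<Delta> x (ennreal (enn2real s)) \<in> U)" for x s
      using inf[of x] by (cases "s = 0"; cases "s = \<infinity>") (auto simp: enn2real_positive_iff less_top)
    show ?thesis
    proof (rule set_eqI)
      fix z :: "'e \<times> ennreal"
      obtain x s where z: "z = (x, s)" by (cases z)
      show "z \<in> (\<lambda>(x, s). step_path \<Delta> x s) -` U \<inter> space (borel \<Otimes>\<^sub>M borel) \<longleftrightarrow>
        z \<in> (?Z \<times> {0}) \<union> (if step_path \<Delta> \<Delta> \<infinity> \<in> U then UNIV \<times> {\<infinity>} else {}) \<union>
          ((\<lambda>(x, s). (x, enn2real s)) -` ?O \<inter> (UNIV \<times> {s. s \<noteq> \<infinity>}) \<inter> space (borel \<Otimes>\<^sub>M borel))"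
        using eq[of x s] unfolding z by (simp add: space_pair_measure) blast
    qed
  qed
  moreover have "?Z \<times> {0::ennreal} \<in> sets (borel \<Otimes>\<^sub>M borel)" using Z by (intro pair_measureI) auto
  moreover have "(if step_path \<Delta> \<Delta> \<infinity> \<in> U then UNIV \<times> {\<infinity>} else {} :: ('e \<times> ennreal) set) \<in> sets (borel \<Otimes>\<^sub>M borel)"
    by (auto intro!: pair_measureI)
  moreover have "(\<lambda>(x, s). (x, enn2real s)) -` ?O \<inter> (UNIV \<times> {s. s \<noteq> \<infinity>}) \<inter> space (borel \<Otimes>\<^sub>M borel) \<in> sets ((borel :: 'e measure) \<Otimes>\<^sub>M (borel :: ennreal measure))"
  proof -
    have 1: "(\<lambda>(x, s). (x, enn2real s)) \<in> ((borel :: 'e measure) \<Otimes>\<^sub>M borel) \<rightarrow>\<^sub>M (borel \<Otimes>\<^sub>M borel)" by measurable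
    have "?O \<in> sets (borel \<Otimes>\<^sub>M borel)" unfolding borel_prod by (rule borel_open[OF O])
    from measurable_sets[OF 1 this]
    have 2: "(\<lambda>(x, s). (x, enn2real s)) -` ?O \<inter> space (borel \<Otimes>\<^sub>M borel) \<in> sets (borel \<Otimes>\<^sub>M borel)" .
    have 3: "(UNIV :: 'e set) \<times> {s::ennreal. s \<noteq> \<infinity>} \<in> sets (borel \<Otimes>\<^sub>M borel)" by (intro pair_measureI) auto
    show ?thesis using sets.Int[OF 2 3] by (simp add: Int_ac)
  qed
  ultimately show "(\<lambda>(x, s). step_path \<Delta> x s) -` U \<inter> space (borel \<Otimes>\<^sub>M borel) \<in> sets (borel \<Otimes>\<^sub>M borel)"
    by auto
qed

section \<open>Order statistics and stopped paths\<close>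

lemma sorted_nth_le_iff:
  fixes xs :: "'b::linorder list"
  assumes "sorted xs" "k < length xs"
  shows "xs ! k \<le> a \<longleftrightarrow> k < length (filter (\<lambda>x. x \<le> a) xs)"
  using assms
proof (induction xs arbitrary: k)
  case (Cons x xs)
  show ?case
  proof (cases "x \<le> a")
    case True
    then show ?thesis using Cons by (cases k) auto
  next
    case False
    then have "filter (\<lambda>x. x \<le> a) xs = []" using Cons.prems by (auto simp: filter_empty_conv)
    moreover have "x \<le> (x # xs) ! k" using Cons.prems by (cases k) auto
    ultimately show ?thesis using False by auto
  qed
qed simp

lemma length_filter_sort: "length (filter P (sort xs)) = length (filter P xs)"
  by (metis mset_filter mset_sort size_mset)

text \<open>Replaces sorting by counting, so that measurability of an order statistic becomes that
  of a finite sum of indicators.\<close>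

lemma order_stat_le_iff:
  assumes "1 \<le> i" "i \<le> m"
  shows "order_stat \<tau> m i \<omega> \<le> a \<longleftrightarrow> i \<le> (\<Sum>j\<in>{1..m}. if \<tau> j \<omega> \<le> a then 1 else 0)"
proof -
  let ?xs = "map (\<lambda>j. \<tau> j \<omega>) [1..<m+1]"
  have "order_stat \<tau> m i \<omega> \<le> a \<longleftrightarrow> i - 1 < length (filter (\<lambda>x. x \<le> a) (sort ?xs))"
    using assms by (simp add: order_stat_def sorted_nth_le_iff)
  also have "length (filter (\<lambda>x. x \<le> a) (sort ?xs)) = length (filter (\<lambda>x. x \<le> a) ?xs)"
    by (rule length_filter_sort)
  also have "\<dots> = card {j \<in> {1..m}. \<tau> j \<omega> \<le> a}"
  proof -
    have "length (filter (\<lambda>x. x \<le> a) ?xs) = length (filter (\<lambda>j. \<tau> j \<omega> \<le> a) [1..<m+1])"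
      by (simp add: filter_map comp_def)
    also have "\<dots> = card (set (filter (\<lambda>j. \<tau> j \<omega> \<le> a) [1..<m+1]))"
      by (rule distinct_card[symmetric]) simp
    also have "set (filter (\<lambda>j. \<tau> j \<omega> \<le> a) [1..<m+1]) = {j \<in> {1..m}. \<tau> j \<omega> \<le> a}" by auto
    finally show ?thesis .
  qed
  also have "\<dots> = (\<Sum>j\<in>{1..m}. if \<tau> j \<omega> \<le> a then 1 else 0)"
    by (simp add: sum.If_cases Int_def)
  finally show ?thesis using assms by auto
qed

lemma measurable_order_stat:
  assumes "\<And>j. j \<in> {1..m} \<Longrightarrow> \<tau> j \<in> borel_measurable M"
  shows "order_stat \<tau> m i \<in> borel_measurable M"
proof (cases "1 \<le> i \<and> i \<le> m")
  case True
  show ?thesis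
  proof (rule borel_measurableI_le)
    fix a
    have "{\<omega> \<in> space M. order_stat \<tau> m i \<omega> \<le> a} =
      {\<omega> \<in> space M. i \<le> (\<Sum>j\<in>{1..m}. if \<tau> j \<omega> \<le> a then 1 else 0)}"
      using True by (auto simp: order_stat_le_iff)
    also have "\<dots> \<in> sets M"
    proof -
      have [measurable]: "(\<lambda>\<omega>. \<Sum>j\<in>{1..m}. if \<tau> j \<omega> \<le> a then 1 else 0 :: nat) \<in> M \<rightarrow>\<^sub>M count_space UNIV"
      proof (rule measurable_sum_nat)
        fix j assume "j \<in> {1..m}"
        then have [measurable]: "\<tau> j \<in> borel_measurable M" by (rule assms)
        show "(\<lambda>\<omega>. if \<tau> j \<omega> \<le> a then 1 else 0 :: nat) \<in> M \<rightarrow>\<^sub>M count_space UNIV" by measurable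
      qed
      show ?thesis by measurable
    qed
    finally show "{\<omega> \<in> space M. order_stat \<tau> m i \<omega> \<le> a} \<in> sets M" .
  qed
next
  case False
  then have "order_stat \<tau> m i = (\<lambda>\<omega>. if i = 0 then 0 else \<infinity>)" by (auto simp: order_stat_def)
  then show ?thesis by simp
qed

text \<open>The two functions may live on different spaces: this identifies the order statistics of
  the random times with those of the coordinates of a vector of marked times.\<close>

lemma order_stat_cong:
  assumes "\<And>j. j \<in> {1..m} \<Longrightarrow> \<tau> j \<omega> = \<tau>' j \<omega>'"
  shows "order_stat \<tau> m i \<omega> = order_stat \<tau>' m i \<omega>'"
proof -
  have "map (\<lambda>j. \<tau> j \<omega>) [1..<m+1] = map (\<lambda>j. \<tau>' j \<omega>') [1..<m+1]"
    using assms by (intro map_cong) auto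
  then show ?thesis unfolding order_stat_def by (simp only:)
qed

lemma order_stat_mono:
  assumes "i \<le> k" shows "order_stat \<tau> m i \<omega> \<le> order_stat \<tau> m k \<omega>"
proof -
  have "sort (map (\<lambda>j. \<tau> j \<omega>) [1..<m+1]) ! (i - 1) \<le> sort (map (\<lambda>j. \<tau> j \<omega>) [1..<m+1]) ! (k - 1)"
    if "1 \<le> i" "k \<le> m"
    using that assms by (intro sorted_nth_mono) auto
  then show ?thesis using assms by (auto simp: order_stat_def)
qed

lemma order_stat_attained:
  assumes "1 \<le> i" "i \<le> m" obtains j where "j \<in> {1..m}" "\<tau> j \<omega> = order_stat \<tau> m i \<omega>"
proof -
  let ?xs = "map (\<lambda>j. \<tau> j \<omega>) [1..<m+1]"
  have "sort ?xs ! (i - 1) \<in> set (sort ?xs)" using assms by (intro nth_mem) auto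
  also have "set (sort ?xs) = (\<lambda>j. \<tau> j \<omega>) ` {1..m}"
    by (auto simp del: upt_Suc)
  finally obtain j where "j \<in> {1..m}" "sort ?xs ! (i - 1) = \<tau> j \<omega>" by blast
  then show ?thesis using that assms by (auto simp: order_stat_def simp del: upt_Suc)
qed

text \<open>The time \<open>\<tau> j \<omega>\<close> occurs at some position of the sorted list,
  and every position is either at most \<open>i\<close> or at least \<open>Suc i\<close>.\<close>

lemma order_stat_gap:
  assumes j: "j \<in> {1..m}"
  shows "\<tau> j \<omega> \<le> order_stat \<tau> m i \<omega> \<or> order_stat \<tau> m (Suc i) \<omega> \<le> \<tau> j \<omega>"
proof -
  let ?xs = "sort (map (\<lambda>j. \<tau> j \<omega>) [1..<m+1])"
  have "\<tau> j \<omega> \<in> set ?xs" using j by (auto simp del: upt_Suc)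
  then obtain k where k: "k < length ?xs" "?xs ! k = \<tau> j \<omega>" by (metis in_set_conv_nth)
  then have os: "order_stat \<tau> m (Suc k) \<omega> = \<tau> j \<omega>" by (auto simp: order_stat_def simp del: upt_Suc)
  show ?thesis
  proof (cases "Suc k \<le> i")
    case True then show ?thesis using order_stat_mono[OF True, of \<tau> m \<omega>] os by simp
  next
    case False
    then have "Suc i \<le> Suc k" by simp
    then show ?thesis using order_stat_mono[of "Suc i" "Suc k" \<tau> m \<omega>] os by simp
  qed
qed

text \<open>The index is the largest one whose order statistic is at most \<open>a\<close>; it stops
  at \<open>m\<close> because the order statistic \<open>m + 1\<close> is infinite. Ties only
  produce empty intervals.\<close>

lemma order_stat_ex1:
  assumes a: "a < \<infinity>"
  shows "\<exists>!i. i \<le> m \<and> order_stat \<tau> m i \<omega> \<le> a \<and> a < order_stat \<tau> m (Suc i) \<omega>"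
proof -
  let ?i = "Max {i. i \<le> m \<and> order_stat \<tau> m i \<omega> \<le> a}"
  have fin: "finite {i. i \<le> m \<and> order_stat \<tau> m i \<omega> \<le> a}" by simp
  have "0 \<in> {i. i \<le> m \<and> order_stat \<tau> m i \<omega> \<le> a}" by (simp add: order_stat_def)
  then have i: "?i \<in> {i. i \<le> m \<and> order_stat \<tau> m i \<omega> \<le> a}" using fin by (intro Max_in) auto
  have "a < order_stat \<tau> m (Suc ?i) \<omega>"
  proof (rule ccontr)
    assume n: "\<not> ?thesis"
    then have "Suc ?i \<le> m" using a by (cases "Suc ?i \<le> m") (auto simp: order_stat_def)
    then have "Suc ?i \<in> {i. i \<le> m \<and> order_stat \<tau> m i \<omega> \<le> a}" using n by auto
    then have "Suc ?i \<le> ?i" using fin by (rule Max_ge[rotated])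
    then show False by simp
  qed
  with i have ex: "?i \<le> m \<and> order_stat \<tau> m ?i \<omega> \<le> a \<and> a < order_stat \<tau> m (Suc ?i) \<omega>" by auto
  show ?thesis
  proof (rule ex1I)
    show "?i \<le> m \<and> order_stat \<tau> m ?i \<omega> \<le> a \<and> a < order_stat \<tau> m (Suc ?i) \<omega>" by (rule ex)
    fix k assume k: "k \<le> m \<and> order_stat \<tau> m k \<omega> \<le> a \<and> a < order_stat \<tau> m (Suc k) \<omega>"
    have "\<not> Suc k \<le> ?i" using order_stat_mono[of "Suc k" ?i \<tau> m \<omega>] k ex by auto
    moreover have "\<not> Suc ?i \<le> k" using order_stat_mono[of "Suc ?i" k \<tau> m \<omega>] k ex by auto
    ultimately show "k = ?i" by simp
  qed
qed

text \<open>Stopping before the jump has the same effect as moving the jump to infinity. All stopped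
  processes are therefore step paths, and their measurability reduces to
  \<open>measurable_step_path\<close>.\<close>

lemma H_stopped_eq_step_path:
  "H_stopped \<Delta> \<tau> \<xi> j R \<omega> = step_path \<Delta> (\<xi> j \<omega>) (if \<tau> j \<omega> \<le> R then \<tau> j \<omega> else \<infinity>)"
proof (rule ext)
  fix t
  show "H_stopped \<Delta> \<tau> \<xi> j R \<omega> t = step_path \<Delta> (\<xi> j \<omega>) (if \<tau> j \<omega> \<le> R then \<tau> j \<omega> else \<infinity>) t"
    by (cases "\<tau> j \<omega> \<le> R") (auto simp: H_stopped_def H_at_def step_path_def min_less_iff_disj not_le)
qed

definition H_vec :: "'e \<Rightarrow> (nat \<Rightarrow> 'a \<Rightarrow> ennreal) \<Rightarrow> (nat \<Rightarrow> 'a \<Rightarrow> 'e) \<Rightarrow> nat \<Rightarrow> ennreal \<Rightarrow> 'a \<Rightarrow> nat \<Rightarrow> real \<Rightarrow> 'e" where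
  "H_vec \<Delta> \<tau> \<xi> m R \<omega> = (\<lambda>j\<in>{1..m}. H_stopped \<Delta> \<tau> \<xi> j R \<omega>)"

lemma measurable_H_vec:
  fixes \<Delta> :: "'e::polish_space"
  assumes \<tau>: "\<And>j. j \<in> {1..m} \<Longrightarrow> \<tau> j \<in> borel_measurable M"
    and \<xi>: "\<And>j. j \<in> {1..m} \<Longrightarrow> \<xi> j \<in> borel_measurable M"
    and R[measurable]: "R \<in> borel_measurable M"
  shows "(\<lambda>\<omega>. H_vec \<Delta> \<tau> \<xi> m (R \<omega>) \<omega>) \<in> M \<rightarrow>\<^sub>M (\<Pi>\<^sub>M j\<in>{1..m}. skorokhod_borel)"
  unfolding H_vec_def
proof (rule measurable_restrict)
  fix j assume j: "j \<in> {1..m}"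
  have [measurable]: "\<tau> j \<in> borel_measurable M" "\<xi> j \<in> borel_measurable M" using \<tau> \<xi> j by auto
  have "(\<lambda>\<omega>. (\<xi> j \<omega>, if \<tau> j \<omega> \<le> R \<omega> then \<tau> j \<omega> else \<infinity>)) \<in> M \<rightarrow>\<^sub>M borel \<Otimes>\<^sub>M borel" by measurable
  from measurable_compose[OF this measurable_step_path[of \<Delta>]]
  show "(\<lambda>\<omega>. H_stopped \<Delta> \<tau> \<xi> j (R \<omega>) \<omega>) \<in> M \<rightarrow>\<^sub>M skorokhod_borel"
    by (simp add: H_stopped_eq_step_path)
qed

text \<open>By \<open>order_stat_gap\<close> no jump falls strictly between two consecutive order
  statistics. This links the paths stopped at a fixed time, which generate the filtration, to the
  paths stopped at an order statistic, which enter the formula.\<close>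

lemma H_vec_order_stat:
  assumes "order_stat \<tau> m i \<omega> \<le> q" "q < order_stat \<tau> m (Suc i) \<omega>"
  shows "H_vec \<Delta> \<tau> \<xi> m q \<omega> = H_vec \<Delta> \<tau> \<xi> m (order_stat \<tau> m i \<omega>) \<omega>"
  unfolding H_vec_def
proof (rule restrict_ext)
  fix j assume "j \<in> {1..m}"
  then have "\<tau> j \<omega> \<le> q \<longleftrightarrow> \<tau> j \<omega> \<le> order_stat \<tau> m i \<omega>"
    using order_stat_gap[of j m \<tau> \<omega> i] assms by auto
  then show "H_stopped \<Delta> \<tau> \<xi> j q \<omega> = H_stopped \<Delta> \<tau> \<xi> j (order_stat \<tau> m i \<omega>) \<omega>"
    by (simp add: H_stopped_eq_step_path)
qed

text \<open>Membership of the path stopped at an order statistic in \<open>settled m q\<close> reveals whether that order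
  statistic has passed by time \<open>q\<close>, so the formula need not carry the time itself as an extra argument.\<close>
definition settled :: "nat \<Rightarrow> real \<Rightarrow> (nat \<Rightarrow> real \<Rightarrow> 'e::metric_space) set" where
  "settled m q = {p \<in> space (\<Pi>\<^sub>M j\<in>{1..m}. skorokhod_borel). \<forall>j\<in>{1..m}. \<forall>r\<in>\<rat> \<inter> {q..}. p j r = p j q}"

lemma measurable_PiM_eval:
  assumes "0 \<le> s" "j \<in> {1..m}"
  shows "(\<lambda>p. p j s) \<in> borel_measurable (\<Pi>\<^sub>M j\<in>{1..m}. (skorokhod_borel :: (real \<Rightarrow> 'e::metric_space) measure))"
  by (rule measurable_compose[OF measurable_component_singleton[OF assms(2)] measurable_skorokhod_eval[OF assms(1)]])

lemma sets_settled:
  assumes q: "0 \<le> q"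
  shows "(settled m q :: (nat \<Rightarrow> real \<Rightarrow> 'e::polish_space) set) \<in> sets (\<Pi>\<^sub>M j\<in>{1..m}. skorokhod_borel)"
proof -
  let ?D = "\<Pi>\<^sub>M j\<in>{1..m}. (skorokhod_borel :: (real \<Rightarrow> 'e) measure)"
  have "{p \<in> space ?D. p j r = p j q} \<in> sets ?D" if "j \<in> {1..m}" "r \<in> \<rat> \<inter> {q..}" for j r
  proof -
    have [measurable]: "(\<lambda>p. p j r) \<in> borel_measurable ?D" "(\<lambda>p. p j q) \<in> borel_measurable ?D"
      by (rule measurable_PiM_eval; use that q in simp)+
    have "{p \<in> space ?D. dist (p j r) (p j q) = 0} \<in> sets ?D" by measurable
    then show ?thesis by simp
  qed
  then show ?thesis unfolding settled_def
    by (intro sets.sets_Collect_countable_All' countable_Int1 countable_rat countable_finite finite_atLeastAtMost)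
qed

lemma H_vec_space: "H_vec \<Delta> \<tau> \<xi> m R \<omega> \<in> space (\<Pi>\<^sub>M j\<in>{1..m}. skorokhod_borel)"
  by (auto simp: H_vec_def space_PiM H_stopped_eq_step_path step_path_cadlag)

text \<open>The order statistic is attained by some \<open>\<tau> j\<close>, and the jump of the
  path \<open>j\<close> at that time is visible because the mark differs from
  \<open>\<Delta>\<close>; a rational time after it detects the change. If the order statistic were
  infinite, the paths could be settled although it has not passed.\<close>

lemma H_vec_settled_iff:
  assumes i: "i \<le> m" and fin: "order_stat \<tau> m i \<omega> < \<infinity>" and q: "0 \<le> q"
    and \<xi>: "\<And>j. j \<in> {1..m} \<Longrightarrow> \<xi> j \<omega> \<noteq> \<Delta>"
  shows "H_vec \<Delta> \<tau> \<xi> m (order_stat \<tau> m i \<omega>) \<omega> \<in> settled m q \<longleftrightarrow> order_stat \<tau> m i \<omega> \<le> ennreal q"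
proof
  assume le: "order_stat \<tau> m i \<omega> \<le> ennreal q"
  have const: "H_stopped \<Delta> \<tau> \<xi> j (order_stat \<tau> m i \<omega>) \<omega> r = H_stopped \<Delta> \<tau> \<xi> j (order_stat \<tau> m i \<omega>) \<omega> q"
    if "q \<le> r" for j r
  proof -
    have "ennreal q \<le> ennreal r" using that by (rule ennreal_leI)
    then show ?thesis using le by (simp add: H_stopped_def min_absorb2 order_trans[OF le])
  qed
  show "H_vec \<Delta> \<tau> \<xi> m (order_stat \<tau> m i \<omega>) \<omega> \<in> settled m q"
    unfolding settled_def
  proof (intro CollectI conjI H_vec_space ballI)
    fix j r assume "j \<in> {1..m}" "r \<in> \<rat> \<inter> {q..}"
    then show "H_vec \<Delta> \<tau> \<xi> m (order_stat \<tau> m i \<omega>) \<omega> j r = H_vec \<Delta> \<tau> \<xi> m (order_stat \<tau> m i \<omega>) \<omega> j q"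
      using const[of r j] unfolding H_vec_def by simp
  qed
next
  assume s: "H_vec \<Delta> \<tau> \<xi> m (order_stat \<tau> m i \<omega>) \<omega> \<in> settled m q"
  show "order_stat \<tau> m i \<omega> \<le> ennreal q"
  proof (rule ccontr)
    assume n: "\<not> ?thesis"
    then have "i \<noteq> 0" by (intro notI) (simp add: order_stat_def)
    then obtain j where j: "j \<in> {1..m}" "\<tau> j \<omega> = order_stat \<tau> m i \<omega>"
      using order_stat_attained[of i m \<tau> \<omega>] i by auto
    let ?x = "H_stopped \<Delta> \<tau> \<xi> j (order_stat \<tau> m i \<omega>) \<omega>"
    obtain r where r: "r \<in> \<rat>" "max q (enn2real (\<tau> j \<omega>)) < r"
      using Rats_dense_in_real[of "max q (enn2real (\<tau> j \<omega>))" "max q (enn2real (\<tau> j \<omega>)) + 1"] by auto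
    have "\<tau> j \<omega> = ennreal (enn2real (\<tau> j \<omega>))" using fin j by simp
    also have "\<dots> \<le> ennreal r" using r by (intro ennreal_leI) auto
    finally have "?x r = \<xi> j \<omega>" using j by (auto simp: H_stopped_eq_step_path step_path_def)
    moreover have "?x q = \<Delta>" using n j by (auto simp: H_stopped_eq_step_path step_path_def)
    moreover have "?x r = ?x q"
    proof -
      have "r \<in> \<rat> \<inter> {q..}" using r by simp
      then have "H_vec \<Delta> \<tau> \<xi> m (order_stat \<tau> m i \<omega>) \<omega> j r = H_vec \<Delta> \<tau> \<xi> m (order_stat \<tau> m i \<omega>) \<omega> j q"
        using s j(1) unfolding settled_def by blast
      then show ?thesis using j(1) by (simp add: H_vec_def)
    qed
    ultimately show False using \<xi>[OF j(1)] by simp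
  qed
qed

section \<open>Averages over finite partitions\<close>

definition finite_partition :: "'p measure \<Rightarrow> 'p set set \<Rightarrow> bool" where
  "finite_partition L \<K> \<longleftrightarrow> finite \<K> \<and> \<K> \<subseteq> sets L \<and> disjoint \<K> \<and> \<Union>\<K> = space L"

definition saturated_for :: "'p set set \<Rightarrow> 'p set \<Rightarrow> bool" where
  "saturated_for \<K> S \<longleftrightarrow> (\<forall>K\<in>\<K>. K \<inter> S = {} \<or> K \<subseteq> S)"

text \<open>The conditional probability of \<open>S\<close> under \<open>L\<close> given the finite
  sigma-algebra generated by the partition. On null cells the quotient \<open>0 / 0\<close> is
  0.\<close>

definition cell_avg :: "'p measure \<Rightarrow> 'p set set \<Rightarrow> 'p set \<Rightarrow> 'p \<Rightarrow> ennreal" where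
  "cell_avg L \<K> S p = (\<Sum>K\<in>\<K>. indicator K p * (emeasure L (K \<inter> S) / emeasure L K))"

lemma cell_avg_eq:
  assumes "finite_partition L \<K>" "K \<in> \<K>" "p \<in> K"
  shows "cell_avg L \<K> S p = emeasure L (K \<inter> S) / emeasure L K"
proof -
  have "p \<notin> K'" if "K' \<in> \<K> - {K}" for K'
    using assms that by (auto simp: finite_partition_def disjoint_def)
  then have "(\<Sum>K\<in>\<K> - {K}. indicator K p * (emeasure L (K \<inter> S) / emeasure L K)) = 0"
    by (intro sum.neutral) (auto simp: indicator_def)
  then show ?thesis
    using assms by (simp add: cell_avg_def finite_partition_def sum.remove[of _ K])
qed

lemma cell_avg_mono:
  assumes "finite_partition L \<K>" "S \<subseteq> S'" "S' \<in> sets L"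
  shows "cell_avg L \<K> S p \<le> cell_avg L \<K> S' p"
  unfolding cell_avg_def
  by (intro sum_mono mult_left_mono divide_right_mono_ennreal emeasure_mono)
     (use assms in \<open>auto simp: finite_partition_def\<close>)

lemma ennreal_divide_le_1: "(a::ennreal) \<le> b \<Longrightarrow> b \<noteq> \<infinity> \<Longrightarrow> a / b \<le> 1"
  by (cases "b = 0") (auto intro!: divide_le_posI_ennreal simp: zero_less_iff_neq_zero)

text \<open>A cell \<open>K\<close> contributes the product of the masses of \<open>K - S\<close>
  and \<open>K \<inter> S\<close> divided by the mass of \<open>K\<close>, which is at most either
  of the two. Since \<open>S'\<close> contains or misses \<open>K\<close>, one of the two pieces
  lies in the symmetric difference of \<open>S\<close> and \<open>S'\<close>.\<close>

lemma cell_avg_impurity: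
  assumes "prob_space L" and \<K>: "finite_partition L \<K>" and S: "S \<in> sets L" and S': "S' \<in> sets L"
    and sat: "saturated_for \<K> S'"
  shows "(\<integral>\<^sup>+p. indicator (space L - S) p * cell_avg L \<K> S p \<partial>L) \<le> emeasure L ((S - S') \<union> (S' - S))"
proof -
  interpret prob_space L by fact
  let ?D = "(S - S') \<union> (S' - S)"
  have fin: "finite \<K>" and sub: "\<And>K. K \<in> \<K> \<Longrightarrow> K \<in> sets L" and dis: "disjoint \<K>"
    using \<K> by (auto simp: finite_partition_def)
  note [measurable] = S S'
  have term_le: "emeasure L (K - S) * (emeasure L (K \<inter> S) / emeasure L K) \<le> emeasure L (K \<inter> ?D)" if K: "K \<in> \<K>" for K
  proof -
    have [measurable]: "K \<in> sets L" by (rule sub[OF K])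
    have r1: "emeasure L (K \<inter> S) / emeasure L K \<le> 1" "emeasure L (K - S) / emeasure L K \<le> 1"
      by (intro ennreal_divide_le_1 emeasure_mono; simp)+
    from sat K consider "K \<inter> S' = {}" | "K \<subseteq> S'" by (auto simp: saturated_for_def)
    then show ?thesis
    proof cases
      case 1
      have "emeasure L (K - S) * (emeasure L (K \<inter> S) / emeasure L K) = emeasure L (K \<inter> S) * (emeasure L (K - S) / emeasure L K)"
        by (simp add: ennreal_times_divide mult.commute)
      also have "\<dots> \<le> emeasure L (K \<inter> S) * 1" by (intro mult_left_mono r1) simp
      also have "\<dots> \<le> emeasure L (K \<inter> ?D)" using 1 by (auto intro!: emeasure_mono)
      finally show ?thesis .
    next
      case 2
      have "emeasure L (K - S) * (emeasure L (K \<inter> S) / emeasure L K) \<le> emeasure L (K - S) * 1"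
        by (intro mult_left_mono r1) simp
      also have "\<dots> \<le> emeasure L (K \<inter> ?D)" using 2 by (auto intro!: emeasure_mono)
      finally show ?thesis .
    qed
  qed
  have "(\<integral>\<^sup>+p. indicator (space L - S) p * cell_avg L \<K> S p \<partial>L)
     = (\<integral>\<^sup>+p. (\<Sum>K\<in>\<K>. (emeasure L (K \<inter> S) / emeasure L K) * indicator (K - S) p) \<partial>L)"
    unfolding cell_avg_def sum_distrib_left
    by (intro nn_integral_cong sum.cong) (auto simp: indicator_def)
  also have "\<dots> = (\<Sum>K\<in>\<K>. (emeasure L (K \<inter> S) / emeasure L K) * emeasure L (K - S))"
    using sub S by (subst nn_integral_sum) (auto simp: nn_integral_cmult_indicator)
  also have "\<dots> \<le> (\<Sum>K\<in>\<K>. emeasure L (K \<inter> ?D))"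
    using term_le by (intro sum_mono) (simp add: mult.commute)
  also have "\<dots> = emeasure L (\<Union>K\<in>\<K>. K \<inter> ?D)"
    by (rule sum_emeasure) (use sub dis fin S S' in \<open>auto simp: disjoint_family_on_def disjoint_def\<close>)
  also have "\<dots> \<le> emeasure L ?D" by (rule emeasure_mono) auto
  finally show ?thesis .
qed

text \<open>The distribution function of \<open>h\<close>, evaluated at \<open>h\<close>, is stochastically at least uniform.\<close>
lemma quantile_bound:
  fixes h :: "'p \<Rightarrow> ennreal" and c :: ennreal
  assumes K[measurable]: "K \<in> sets L" and h[measurable]: "h \<in> borel_measurable L"
  defines "S \<equiv> {p \<in> K. emeasure L {p'\<in>K. h p' \<le> h p} \<le> c}"
  shows "S \<in> sets L" "emeasure L S \<le> c"
proof -
  have sub: "K \<subseteq> space L" using K by (rule sets.sets_into_space)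
  have le: "{p' \<in> K. h p' \<le> a} \<in> sets L" for a
  proof -
    have "{p' \<in> space L. p' \<in> K \<and> h p' \<le> a} \<in> sets L" by measurable
    also have "{p' \<in> space L. p' \<in> K \<and> h p' \<le> a} = {p' \<in> K. h p' \<le> a}" using sub by auto
    finally show ?thesis .
  qed
  have down: "p' \<in> S" if "p \<in> S" "p' \<in> K" "h p' \<le> h p" for p p'
  proof -
    have "emeasure L {p''\<in>K. h p'' \<le> h p'} \<le> emeasure L {p''\<in>K. h p'' \<le> h p}"
      using that by (intro emeasure_mono le) auto
    then show ?thesis using that by (auto simp: S_def)
  qed
  have "S \<in> sets L \<and> emeasure L S \<le> c"
  proof (cases "S = {}")
    case False
    show ?thesis
    \<comment> \<open>\<open>S\<close> is a lower set for \<open>h\<close> within \<open>K\<close>: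
      a single sublevel set if the supremum of \<open>h\<close> on \<open>S\<close> is attained, and
      otherwise an increasing union of sublevel sets at values taken on \<open>S\<close>.\<close>
    proof (cases "Sup (h ` S) \<in> h ` S")
      case True
      then obtain p0 where p0: "p0 \<in> S" "h p0 = Sup (h ` S)" by auto
      have S_eq: "S = {p' \<in> K. h p' \<le> h p0}"
      proof (intro equalityI subsetI)
        fix p assume "p \<in> S" then show "p \<in> {p' \<in> K. h p' \<le> h p0}"
          using p0(2) by (auto simp: S_def intro: Sup_upper)
      next
        fix p assume "p \<in> {p' \<in> K. h p' \<le> h p0}" then show "p \<in> S" using down[OF p0(1)] by auto
      qed
      have "emeasure L {p' \<in> K. h p' \<le> h p0} \<le> c" using p0(1) by (simp add: S_def)
      then show ?thesis unfolding S_eq using le by blast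
    next
      case nat: False
      obtain a :: "nat \<Rightarrow> ennreal" where a: "incseq a" "range a \<subseteq> h ` S" "Sup (h ` S) = (SUP i. a i)"
        using ennreal_Sup_countable_SUP[of "h ` S"] False by auto
      have S_eq: "S = (\<Union>n. {p' \<in> K. h p' \<le> a n})"
      proof (intro equalityI subsetI)
        fix p assume p: "p \<in> S"
        then have "h p \<le> Sup (h ` S)" by (auto intro: Sup_upper)
        moreover have "h p \<noteq> Sup (h ` S)" using nat imageI[OF p, of h] by (intro notI) (simp only:)
        ultimately have "h p < (SUP i. a i)" using a(3) by auto
        then obtain n where "h p < a n" by (auto simp: less_SUP_iff)
        then show "p \<in> (\<Union>n. {p' \<in> K. h p' \<le> a n})" using p by (auto simp: S_def intro: less_imp_le)
      next
        fix p assume "p \<in> (\<Union>n. {p' \<in> K. h p' \<le> a n})"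
        then obtain n where n: "p \<in> K" "h p \<le> a n" by auto
        have "a n \<in> h ` S" using a(2) by auto
        then obtain p0 where "p0 \<in> S" "a n = h p0" by auto
        then show "p \<in> S" using down n by auto
      qed
      have "emeasure L S = (SUP n. emeasure L {p' \<in> K. h p' \<le> a n})"
        unfolding S_eq
        by (rule SUP_emeasure_incseq[symmetric])
           (use le a(1) in \<open>auto simp: incseq_def intro: order_trans\<close>)
      also have "\<dots> \<le> c"
      proof (rule SUP_least)
        fix n
        have "a n \<in> h ` S" using a(2) by auto
        then obtain p0 where "p0 \<in> S" "a n = h p0" by auto
        then show "emeasure L {p' \<in> K. h p' \<le> a n} \<le> c" by (simp add: S_def)
      qed
      finally have "emeasure L S \<le> c" .
      moreover have "S \<in> sets L" unfolding S_eq using le by auto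
      ultimately show ?thesis by simp
    qed
  qed simp
  then show "S \<in> sets L" "emeasure L S \<le> c" by auto
qed

text \<open>\<open>quantile_bound\<close> is applied in each cell at the level \<open>c\<close>
  times the mass of the cell, and these masses add up to 1. The bound is uniform over all
  partitions, which is what makes it usable in a limit.\<close>

lemma cell_avg_quantile:
  fixes h :: "'p \<Rightarrow> ennreal" and c :: ennreal
  assumes "prob_space L" and \<K>: "finite_partition L \<K>" and h[measurable]: "h \<in> borel_measurable L"
  shows "emeasure L {p \<in> space L. cell_avg L \<K> {p' \<in> space L. h p' \<le> h p} p \<le> c} \<le> c"
proof -
  interpret prob_space L by fact
  have fin: "finite \<K>" and sub: "\<And>K. K \<in> \<K> \<Longrightarrow> K \<in> sets L" and dis: "disjoint \<K>" and un: "\<Union>\<K> = space L"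
    using \<K> by (auto simp: finite_partition_def)
  let ?S = "\<lambda>K. {p \<in> K. emeasure L {p'\<in>K. h p' \<le> h p} \<le> c * emeasure L K}"
  note q = quantile_bound[OF sub h]
  have inS: "p \<in> ?S K" if K: "K \<in> \<K>" "p \<in> K" and le: "cell_avg L \<K> {p' \<in> space L. h p' \<le> h p} p \<le> c" for K p
  proof -
    have eq: "K \<inter> {p' \<in> space L. h p' \<le> h p} = {p'\<in>K. h p' \<le> h p}"
      using sub[OF K(1)] sets.sets_into_space by blast
    have d: "emeasure L {p'\<in>K. h p' \<le> h p} / emeasure L K \<le> c"
      using le by (simp add: cell_avg_eq[OF \<K> K] eq)
    have mono: "emeasure L {p'\<in>K. h p' \<le> h p} \<le> emeasure L K"
      using sub[OF K(1)] by (intro emeasure_mono) auto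
    have "emeasure L {p'\<in>K. h p' \<le> h p} \<le> c * emeasure L K"
    proof (cases "emeasure L K = 0")
      case True then show ?thesis using mono by simp
    next
      case False
      have "emeasure L {p'\<in>K. h p' \<le> h p} = (emeasure L {p'\<in>K. h p' \<le> h p} / emeasure L K) * emeasure L K"
        unfolding ennreal_divide_times using False by (subst ennreal_divide_self) (auto simp: less_top[symmetric])
      also have "\<dots> \<le> c * emeasure L K" by (rule mult_right_mono[OF d]) simp
      finally show ?thesis .
    qed
    then show ?thesis using K by simp
  qed
  have "{p \<in> space L. cell_avg L \<K> {p' \<in> space L. h p' \<le> h p} p \<le> c} \<subseteq> (\<Union>K\<in>\<K>. ?S K)"
  proof (intro subsetI)
    fix p assume p: "p \<in> {p \<in> space L. cell_avg L \<K> {p' \<in> space L. h p' \<le> h p} p \<le> c}"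
    then obtain K where K: "K \<in> \<K>" "p \<in> K" using un by auto
    have "p \<in> ?S K" by (rule inS[OF K]) (use p in simp)
    then show "p \<in> (\<Union>K\<in>\<K>. ?S K)" by (rule UN_I[OF K(1)])
  qed
  then have "emeasure L {p \<in> space L. cell_avg L \<K> {p' \<in> space L. h p' \<le> h p} p \<le> c} \<le> emeasure L (\<Union>K\<in>\<K>. ?S K)"
    using fin q(1) by (intro emeasure_mono) auto
  also have "\<dots> \<le> (\<Sum>K\<in>\<K>. emeasure L (?S K))"
    using fin q(1) by (intro emeasure_subadditive_finite) auto
  also have "\<dots> \<le> (\<Sum>K\<in>\<K>. c * emeasure L K)" using q(2) by (intro sum_mono) auto
  also have "\<dots> = c * emeasure L (\<Union>K\<in>\<K>. K)"
    unfolding sum_distrib_left[symmetric]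
    by (subst sum_emeasure) (use sub dis fin in \<open>auto simp: disjoint_family_on_def disjoint_def\<close>)
  also have "\<dots> = c" using un by (simp add: emeasure_space_1)
  finally show ?thesis .
qed

text \<open>Membership depends on \<open>p\<close> only through the pattern of sets in
  \<open>\<A>\<close> that contain \<open>p\<close>. This stands in for being a finite union of
  rectangles and is visibly stable under complements and unions.\<close>

definition family_saturated :: "'p set set \<Rightarrow> 'p set \<Rightarrow> ('p \<times> 'a) set \<Rightarrow> bool" where
  "family_saturated \<A> X C \<longleftrightarrow>
     (\<forall>p\<in>X. \<forall>p'\<in>X. (\<forall>A\<in>\<A>. p \<in> A \<longleftrightarrow> p' \<in> A) \<longrightarrow> (\<forall>\<omega>. (p, \<omega>) \<in> C \<longleftrightarrow> (p', \<omega>) \<in> C))"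

lemma family_saturatedD:
  assumes "family_saturated \<A> X C" "p \<in> X" "p' \<in> X" "\<And>A. A \<in> \<A> \<Longrightarrow> p \<in> A \<longleftrightarrow> p' \<in> A"
  shows "(p, \<omega>) \<in> C \<longleftrightarrow> (p', \<omega>) \<in> C"
  using assms unfolding family_saturated_def by blast

lemma family_saturated_mono: "family_saturated \<A> X C \<Longrightarrow> \<A> \<subseteq> \<B> \<Longrightarrow> family_saturated \<B> X C"
  unfolding family_saturated_def by blast

text \<open>Rectangles are approximated exactly, and the sets that can be approximated to any
  accuracy are closed under complements and countable unions. The finite family may depend on both
  \<open>C\<close> and \<open>e\<close>.\<close>

lemma rectangle_approximation:
  assumes "prob_space L" "prob_space N" and C: "C \<in> sets (L \<Otimes>\<^sub>M N)" and e: "0 < e"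
  shows "\<exists>\<A> C'. finite \<A> \<and> \<A> \<subseteq> sets L \<and> C' \<in> sets (L \<Otimes>\<^sub>M N) \<and> family_saturated \<A> (space L) C' \<and>
     measure (L \<Otimes>\<^sub>M N) ((C - C') \<union> (C' - C)) < e"
proof -
  interpret L: prob_space L by fact
  interpret N: prob_space N by fact
  interpret P: pair_prob_space L N ..
  let ?P = "L \<Otimes>\<^sub>M N"
  have "C \<in> sigma_sets (space L \<times> space N) {a \<times> b | a b. a \<in> sets L \<and> b \<in> sets N}"
    using C by (simp add: sets_pair_measure)
  then show ?thesis using e
  proof (induction arbitrary: e rule: sigma_sets.induct)
    case (Basic a)
    then obtain x y where a: "a = x \<times> y" "x \<in> sets L" "y \<in> sets N" by auto
    then show ?case using Basic
      by (intro exI[of _ "{x}"] exI[of _ a]) (auto simp: family_saturated_def)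
  next
    case Empty
    then show ?case by (intro exI[of _ "{}"] exI[of _ "{}"]) (auto simp: family_saturated_def)
  next
    case (Compl a)
    from Compl.IH[OF Compl.prems]
    obtain \<A> C' where C': "finite \<A>" "\<A> \<subseteq> sets L" "C' \<in> sets ?P" "family_saturated \<A> (space L) C'"
      "measure ?P ((a - C') \<union> (C' - a)) < e" by blast
    have a: "a \<in> sets ?P" using Compl by (simp add: sets_pair_measure)
    have eq: "(space L \<times> space N - a - (space ?P - C')) \<union> (space ?P - C' - (space L \<times> space N - a)) = (a - C') \<union> (C' - a)"
      using sets.sets_into_space[OF a] sets.sets_into_space[OF C'(3)] by (auto simp: space_pair_measure)
    have "family_saturated \<A> (space L) (space ?P - C')"
      unfolding family_saturated_def
    proof (intro ballI impI allI)
      fix p p' \<omega> assume p: "p \<in> space L" "p' \<in> space L" "\<forall>A\<in>\<A>. (p \<in> A) = (p' \<in> A)"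
      have "(p, \<omega>) \<in> C' \<longleftrightarrow> (p', \<omega>) \<in> C'"
        by (rule family_saturatedD[OF C'(4) p(1,2)]) (rule bspec[OF p(3)])
      then show "(p, \<omega>) \<in> space ?P - C' \<longleftrightarrow> (p', \<omega>) \<in> space ?P - C'"
        using p(1,2) by (simp add: space_pair_measure)
    qed
    moreover have "space ?P - C' \<in> sets ?P" using C'(3) by (rule sets.compl_sets)
    ultimately show ?case using C'(1,2,5) unfolding eq[symmetric] by blast
  next
    case (Union a)
    have a: "a i \<in> sets ?P" for i using Union by (simp add: sets_pair_measure)
    have "(\<lambda>n. measure ?P (\<Union>i<n. a i)) \<longlonglongrightarrow> measure ?P (\<Union>n. \<Union>i<n. a i)"
    proof (rule P.finite_Lim_measure_incseq)
      show "incseq (\<lambda>n. \<Union>i<n. a i)" by (intro monoI UN_mono) auto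
    qed (use a in auto)
    moreover have "(\<Union>n. \<Union>i<n. a i) = (\<Union>i. a i)" by auto
    ultimately have "(\<lambda>n. measure ?P (\<Union>i<n. a i)) \<longlonglongrightarrow> measure ?P (\<Union>i. a i)" by simp
    then have "eventually (\<lambda>n. measure ?P (\<Union>i. a i) - e / 2 < measure ?P (\<Union>i<n. a i)) sequentially"
      by (rule order_tendstoD) (use Union.prems in simp)
    then obtain n where n: "measure ?P (\<Union>i. a i) - e / 2 < measure ?P (\<Union>i<n. a i)"
      by (auto simp: eventually_sequentially)
    \<comment> \<open>One half of \<open>e\<close> pays for cutting the union off at
      \<open>n\<close>, the other is shared among the \<open>n\<close> remaining sets; the
      denominator uses \<open>n + 1\<close> to cover \<open>n = 0\<close>.\<close>
    let ?d = "e / (2 * (real n + 1))"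
    have d: "0 < ?d" using Union.prems by simp
    have "\<forall>i. \<exists>\<A> C'. finite \<A> \<and> \<A> \<subseteq> sets L \<and> C' \<in> sets ?P \<and> family_saturated \<A> (space L) C' \<and>
       measure ?P ((a i - C') \<union> (C' - a i)) < ?d"
      using Union.IH[OF d] by blast
    then obtain \<A> C' where C': "\<And>i. finite (\<A> i)" "\<And>i. \<A> i \<subseteq> sets L" "\<And>i. C' i \<in> sets ?P"
      "\<And>i. family_saturated (\<A> i) (space L) (C' i)" "\<And>i. measure ?P ((a i - C' i) \<union> (C' i - a i)) < ?d"
      by metis
    let ?C = "\<Union>i<n. C' i" and ?A = "\<Union>i<n. \<A> i"
    note [measurable] = a C'(3)
    have "measure ?P (((\<Union>i. a i) - ?C) \<union> (?C - (\<Union>i. a i)))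
      \<le> measure ?P (((\<Union>i. a i) - (\<Union>i<n. a i)) \<union> (\<Union>i<n. (a i - C' i) \<union> (C' i - a i)))"
      by (intro P.finite_measure_mono) (auto)
    also have "\<dots> \<le> measure ?P ((\<Union>i. a i) - (\<Union>i<n. a i)) + measure ?P (\<Union>i<n. (a i - C' i) \<union> (C' i - a i))"
      by (intro measure_Un_le) auto
    also have "measure ?P ((\<Union>i. a i) - (\<Union>i<n. a i)) = measure ?P (\<Union>i. a i) - measure ?P (\<Union>i<n. a i)"
      by (rule P.finite_measure_Diff) auto
    also have "measure ?P (\<Union>i<n. (a i - C' i) \<union> (C' i - a i)) \<le> (\<Sum>i<n. measure ?P ((a i - C' i) \<union> (C' i - a i)))"
      by (intro P.finite_measure_subadditive_finite) auto
    also have "\<dots> \<le> (\<Sum>i<n. ?d)" by (intro sum_mono less_imp_le C')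
    also have "\<dots> \<le> e / 2" using Union.prems by (simp add: field_simps)
    finally have "measure ?P (((\<Union>i. a i) - ?C) \<union> (?C - (\<Union>i. a i))) < e" using n by simp
    moreover have "family_saturated ?A (space L) ?C"
      unfolding family_saturated_def
    proof (intro ballI impI allI)
      fix p p' \<omega> assume p: "p \<in> space L" "p' \<in> space L" "\<forall>A\<in>?A. (p \<in> A) = (p' \<in> A)"
      have "(p, \<omega>) \<in> C' i \<longleftrightarrow> (p', \<omega>) \<in> C' i" if "i < n" for i
      proof -
        have "A \<in> \<A> i \<Longrightarrow> A \<in> ?A" for A using that by auto
        then show ?thesis by (intro family_saturatedD[OF C'(4) p(1,2)] bspec[OF p(3)])
      qed
      then show "(p, \<omega>) \<in> ?C \<longleftrightarrow> (p', \<omega>) \<in> ?C" by auto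
    qed
    moreover have "finite ?A" "?A \<subseteq> sets L" using C'(1,2) by auto
    moreover have "?C \<in> sets ?P" by measurable
    ultimately show ?case by blast
  qed
qed

lemma family_partition:
  assumes fin: "finite \<A>" and sub: "\<A> \<subseteq> sets L"
  shows "\<exists>\<K>. finite_partition L \<K> \<and>
    (\<forall>C \<omega>. family_saturated \<A> (space L) C \<longrightarrow> saturated_for \<K> {p \<in> space L. (p, \<omega>) \<in> C})"
proof -
  \<comment> \<open>These are the atoms of the algebra generated by \<open>\<A>\<close>, indexed by
    membership patterns. Several patterns may give the empty cell.\<close>
  define cell where "cell I = {p \<in> space L. \<forall>A\<in>\<A>. p \<in> A \<longleftrightarrow> A \<in> I}" for I
  let ?K = "cell ` Pow \<A>"
  have "cell I \<in> sets L" for I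
    unfolding cell_def by (rule sets.sets_Collect_countable_All'[OF _ countable_finite[OF fin]]) (use sub in auto)
  moreover have "disjoint ?K"
  proof (rule disjointI)
    fix a b assume "a \<in> ?K" "b \<in> ?K" "a \<noteq> b"
    then obtain I J where I: "I \<subseteq> \<A>" "J \<subseteq> \<A>" "a = cell I" "b = cell J" "I \<noteq> J" by auto
    then show "a \<inter> b = {}" by (auto simp: cell_def)
  qed
  moreover have "\<Union>?K = space L"
  proof (intro equalityI subsetI)
    fix p assume "p \<in> space L"
    then have "p \<in> cell {A\<in>\<A>. p \<in> A}" by (auto simp: cell_def)
    moreover have "cell {A\<in>\<A>. p \<in> A} \<in> ?K" by (rule imageI) auto
    ultimately show "p \<in> \<Union>?K" by (rule UnionI[rotated])
  qed (auto simp: cell_def)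
  ultimately have "finite_partition L ?K" using fin by (auto simp: finite_partition_def)
  moreover have "saturated_for ?K {p \<in> space L. (p, \<omega>) \<in> C}" if "family_saturated \<A> (space L) C" for C \<omega>
    unfolding saturated_for_def
  proof
    fix K assume "K \<in> ?K"
    then obtain I where I: "K = cell I" by auto
    have "(p, \<omega>) \<in> C \<longleftrightarrow> (p', \<omega>) \<in> C" if "p \<in> K" "p' \<in> K" for p p'
      by (rule family_saturatedD[OF \<open>family_saturated \<A> (space L) C\<close>]) (use that in \<open>auto simp: I cell_def\<close>)
    moreover have "K \<subseteq> space L" by (auto simp: I cell_def)
    ultimately show "K \<inter> {p \<in> space L. (p, \<omega>) \<in> C} = {} \<or> K \<subseteq> {p \<in> space L. (p, \<omega>) \<in> C}" by blast
  qed
  ultimately show ?thesis by blast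
qed

section \<open>Optional versions of parametrized stopping times\<close>

lemma optional_sa_gen:
  "{{(t,\<omega>) \<in> {0..} \<times> Om. T \<omega> \<le> ennreal t} | T. stopping_time_wrt Om G T} \<subseteq> Pow ({0..} \<times> Om)"
  by auto

lemma space_optional_sa: "space (optional_sa Om G) = {0..} \<times> Om"
  unfolding optional_sa_def by (rule space_measure_of[OF optional_sa_gen])

lemma sets_optional_sa: "sets (optional_sa Om G) =
   sigma_sets ({0..} \<times> Om) {{(t,\<omega>) \<in> {0..} \<times> Om. T \<omega> \<le> ennreal t} | T. stopping_time_wrt Om G T}"
  unfolding optional_sa_def by (rule sets_measure_of[OF optional_sa_gen])

lemma sets_pair_sigma_mono:
  assumes "F \<subseteq> sets N" "space N = X"
  shows "sets (L \<Otimes>\<^sub>M sigma X F) \<subseteq> sets (L \<Otimes>\<^sub>M N)"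
proof -
  have "sets (sigma X F) \<subseteq> sets N"
  proof -
    have "F \<subseteq> Pow X" using assms sets.space_closed by blast
    then have "sets (sigma X F) = sigma_sets X F" by simp
    then show ?thesis using assms by (metis sets.sigma_sets_subset)
  qed
  moreover have "space (sigma X F) = space N" using assms by (simp add: space_measure_of_conv)
  ultimately have "(\<lambda>x. x) \<in> N \<rightarrow>\<^sub>M sigma X F" by (auto intro!: measurableI dest: sets.sets_into_space)
  then have "(\<lambda>x. (fst x, snd x)) \<in> (L \<Otimes>\<^sub>M N) \<rightarrow>\<^sub>M (L \<Otimes>\<^sub>M sigma X F)" by measurable
  then have "(\<lambda>x. x) \<in> (L \<Otimes>\<^sub>M N) \<rightarrow>\<^sub>M (L \<Otimes>\<^sub>M sigma X F)" by simp
  moreover have "space (L \<Otimes>\<^sub>M sigma X F) = space (L \<Otimes>\<^sub>M N)" 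
    using assms by (simp add: space_pair_measure space_measure_of_conv)
  ultimately have m: "(\<lambda>x. x) \<in> (L \<Otimes>\<^sub>M N) \<rightarrow>\<^sub>M (L \<Otimes>\<^sub>M sigma X F)" and sp: "space (L \<Otimes>\<^sub>M sigma X F) = space (L \<Otimes>\<^sub>M N)" by simp_all
  show ?thesis
  proof
    fix A assume A: "A \<in> sets (L \<Otimes>\<^sub>M sigma X F)"
    have "(\<lambda>x. x) -` A \<inter> space (L \<Otimes>\<^sub>M N) = A" using sets.sets_into_space[OF A] unfolding sp by auto
    then show "A \<in> sets (L \<Otimes>\<^sub>M N)" using measurable_sets[OF m A] by simp
  qed
qed

text \<open>This says that the limes superior of \<open>u\<close> is positive, with countable
  quantifiers so that measurability in a parameter is immediate.\<close>

definition persists :: "(nat \<Rightarrow> ennreal) \<Rightarrow> bool" where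
  "persists u \<longleftrightarrow> (\<exists>j. \<forall>k. \<exists>n\<ge>k. ennreal (1 / real (Suc j)) < u n)"

lemma persists_mono: "persists u \<Longrightarrow> (\<And>n. u n \<le> v n) \<Longrightarrow> persists v"
  unfolding persists_def by (meson order_less_le_trans)

text \<open>The terms of a convergent series tend to 0. The shift \<open>k\<close> is there because
  the approximation of a given level set is controlled from some index on only.\<close>

lemma not_persists_summable:
  assumes "(\<Sum>n. u (n + k)) \<noteq> \<infinity>"
  shows "\<not> persists u"
proof -
  have fin: "u (n + k) \<noteq> \<infinity>" for n
  proof
    assume "u (n + k) = \<infinity>"
    moreover have "u (n + k) \<le> (\<Sum>n. u (n + k))"
      using sum_le_suminf[of "\<lambda>n. u (n + k)" "{n}"] by simp
    ultimately show False using assms by (simp add: top_unique)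
  qed
  define v where "v n = enn2real (u (n + k))" for n
  have uv: "u (n + k) = ennreal (v n)" for n using fin[of n] by (simp add: v_def less_top)
  have "(\<Sum>n. ennreal (v n)) \<noteq> \<infinity>" using assms unfolding uv .
  then have "summable v" by (intro summable_suminf_not_top) (auto simp: v_def)
  then have "v \<longlonglongrightarrow> 0" by (rule summable_LIMSEQ_zero)
  show ?thesis unfolding persists_def
  proof (intro notI, elim exE)
    fix j assume j: "\<forall>k. \<exists>n\<ge>k. ennreal (1 / real (Suc j)) < u n"
    have "eventually (\<lambda>n. v n < 1 / real (Suc j)) sequentially"
      by (rule order_tendstoD(2)[OF \<open>v \<longlonglongrightarrow> 0\<close>]) simp
    then obtain n0 where n0: "\<And>n. n \<ge> n0 \<Longrightarrow> v n < 1 / real (Suc j)" by (auto simp: eventually_sequentially)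
    obtain n where n: "n \<ge> n0 + k" "ennreal (1 / real (Suc j)) < u n" using j by blast
    have "u n = ennreal (v (n - k))" using uv[of "n - k"] n(1) by simp
    then have "ennreal (1 / real (Suc j)) < ennreal (v (n - k))" using n(2) by simp
    then have "1 / real (Suc j) < v (n - k)" by (simp add: ennreal_less_iff)
    moreover have "v (n - k) < 1 / real (Suc j)" using n(1) by (intro n0) simp
    ultimately show False by simp
  qed
qed

lemma sets_persists:
  assumes [measurable]: "\<And>n. u n \<in> borel_measurable M"
  shows "{x \<in> space M. persists (\<lambda>n. u n x)} \<in> sets M"
  unfolding persists_def by measurable

lemma optional_sectionwise_measure:
  fixes f :: "'p \<times> 'a \<Rightarrow> ennreal"
  assumes L: "prob_space L" and filt: "is_filtration N F" and rc: "right_continuous_filtration F"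
    and f: "\<And>t s. 0 \<le> t \<Longrightarrow> t < s \<Longrightarrow> {x \<in> space L \<times> space N. f x \<le> ennreal t} \<in> sets (L \<Otimes>\<^sub>M sigma (space N) (F s))"
    and K: "K \<in> sets L"
  shows "(\<lambda>(t, \<omega>). emeasure L (K \<inter> {p \<in> space L. f (p, \<omega>) \<le> ennreal t})) \<in> borel_measurable (optional_sa (space N) F)"
proof -
  interpret prob_space L by fact
  let ?\<phi> = "\<lambda>t \<omega>. emeasure L (K \<inter> {p \<in> space L. f (p, \<omega>) \<le> ennreal t})"
  have F_alg: "sigma_algebra (space N) (F t)" if "0 \<le> t" for t using filt that by (auto simp: is_filtration_def)
  have F_sets: "sets (sigma (space N) (F t)) = F t" "space (sigma (space N) (F t)) = space N" if "0 \<le> t" for t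
  proof -
    interpret sigma_algebra "space N" "F t" by (rule F_alg[OF that])
    show "sets (sigma (space N) (F t)) = F t" by (rule sets_measure_of_eq)
    show "space (sigma (space N) (F t)) = space N" by (rule space_measure_of_eq)
  qed
  have sec: "{p \<in> space L. f (p, \<omega>) \<le> ennreal t} \<in> sets L" if "0 \<le> t" "\<omega> \<in> space N" for t \<omega>
  proof -
    have "(\<lambda>p. (p, \<omega>)) -` {x \<in> space L \<times> space N. f x \<le> ennreal t} \<in> sets L"
      by (rule sets_Pair2[OF f[OF that(1), of "t + 1"]]) simp
    also have "(\<lambda>p. (p, \<omega>)) -` {x \<in> space L \<times> space N. f x \<le> ennreal t} = {p \<in> space L. f (p, \<omega>) \<le> ennreal t}"
      using that by auto
    finally show ?thesis .
  qed
  have adapted: "{\<omega> \<in> space N. c \<le> ?\<phi> t \<omega>} \<in> F t" if t: "0 \<le> t" for t c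
  proof -
    have "{\<omega> \<in> space N. c \<le> ?\<phi> t \<omega>} \<in> F s" if s: "t < s" for s
    proof -
      have s0: "0 \<le> s" using s t by simp
      let ?Fs = "sigma (space N) (F s)"
      let ?C = "{x \<in> space L \<times> space N. f x \<le> ennreal t}"
      have "?C \<in> sets (L \<Otimes>\<^sub>M ?Fs)" by (rule f[OF t s])
      moreover have "K \<times> space N \<in> sets (L \<Otimes>\<^sub>M ?Fs)"
        using K F_sets(2)[OF s0] by (metis pair_measureI sets.top)
      ultimately have C: "(K \<times> space N) \<inter> ?C \<in> sets (L \<Otimes>\<^sub>M ?Fs)" by blast
      have "(\<lambda>x. case x of (\<omega>, p) \<Rightarrow> (p, \<omega>)) \<in> (?Fs \<Otimes>\<^sub>M L) \<rightarrow>\<^sub>M (L \<Otimes>\<^sub>M ?Fs)" by measurable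
      from measurable_sets[OF this C]
      have "(\<lambda>x. case x of (\<omega>, p) \<Rightarrow> (p, \<omega>)) -` ((K \<times> space N) \<inter> ?C) \<inter> space (?Fs \<Otimes>\<^sub>M L) \<in> sets (?Fs \<Otimes>\<^sub>M L)" .
      from measurable_emeasure_Pair[OF this]
      have m: "(\<lambda>\<omega>. emeasure L (Pair \<omega> -` ((\<lambda>x. case x of (\<omega>, p) \<Rightarrow> (p, \<omega>)) -` ((K \<times> space N) \<inter> ?C) \<inter> space (?Fs \<Otimes>\<^sub>M L)))) \<in> borel_measurable ?Fs" .
      have "Pair \<omega> -` ((\<lambda>x. case x of (\<omega>, p) \<Rightarrow> (p, \<omega>)) -` ((K \<times> space N) \<inter> ?C) \<inter> space (?Fs \<Otimes>\<^sub>M L)) = K \<inter> {p \<in> space L. f (p, \<omega>) \<le> ennreal t}"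
        if "\<omega> \<in> space N" for \<omega>
        using that F_sets(2)[OF s0] by (auto simp: space_pair_measure)
      then have "?\<phi> t \<in> borel_measurable ?Fs"
        using m by (subst measurable_cong[where g="\<lambda>\<omega>. emeasure L (Pair \<omega> -` ((\<lambda>x. case x of (\<omega>, p) \<Rightarrow> (p, \<omega>)) -` ((K \<times> space N) \<inter> ?C) \<inter> space (?Fs \<Otimes>\<^sub>M L)))"])
          (simp_all add: F_sets(2)[OF s0])
      then have "{\<omega> \<in> space ?Fs. c \<le> ?\<phi> t \<omega>} \<in> sets ?Fs" by (rule borel_measurable_le[OF borel_measurable_const])
      then show ?thesis by (simp only: F_sets[OF s0])
    qed
    then show ?thesis using rc t unfolding right_continuous_filtration_def by blast
  qed
  have mono: "?\<phi> t \<omega> \<le> ?\<phi> t' \<omega>" if "0 \<le> t" "t \<le> t'" "\<omega> \<in> space N" for t t' \<omega>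
    using that K sec[of t' \<omega>] by (intro emeasure_mono) (auto intro: order_trans ennreal_leI)
  show ?thesis
  proof (rule borel_measurableI_ge)
    fix c
    \<comment> \<open>The first time the increasing process reaches the level \<open>c\<close>. By
      right-continuity the infimum is attained, so the set where the process is at least
      \<open>c\<close> is the stochastic interval starting at \<open>S\<close>.\<close>
    define S where "S \<omega> = Inf {ennreal t | t. 0 \<le> t \<and> c \<le> ?\<phi> t \<omega>}" for \<omega>
    have S_le: "S \<omega> \<le> ennreal t \<longleftrightarrow> c \<le> ?\<phi> t \<omega>" if t: "0 \<le> t" and \<omega>: "\<omega> \<in> space N" for t \<omega>
    proof
      assume "c \<le> ?\<phi> t \<omega>" then show "S \<omega> \<le> ennreal t" using t by (auto simp: S_def intro!: Inf_lower)
    next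
      assume le: "S \<omega> \<le> ennreal t"
      have ge: "c \<le> ?\<phi> (t + 1 / real (Suc n)) \<omega>" for n
      proof -
        have "S \<omega> < ennreal (t + 1 / real (Suc n))"
          by (rule order_le_less_trans[OF le]) (use t in \<open>simp add: ennreal_less_iff\<close>)
        then obtain t' where "0 \<le> t'" "c \<le> ?\<phi> t' \<omega>" "ennreal t' < ennreal (t + 1 / real (Suc n))"
          by (auto simp: S_def Inf_less_iff)
        then show ?thesis using mono[of t' "t + 1 / real (Suc n)" \<omega>] \<omega>
          by (intro order_trans[OF \<open>c \<le> ?\<phi> t' \<omega>\<close>]) (simp add: ennreal_less_iff)
      qed
      have Inter: "(\<Inter>n. K \<inter> {p \<in> space L. f (p, \<omega>) \<le> ennreal (t + 1 / real (Suc n))}) = K \<inter> {p \<in> space L. f (p, \<omega>) \<le> ennreal t}"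
      proof (intro equalityI subsetI)
        fix p assume p: "p \<in> (\<Inter>n. K \<inter> {p \<in> space L. f (p, \<omega>) \<le> ennreal (t + 1 / real (Suc n))})"
        have "(\<lambda>n. ennreal (t + 1 / real (Suc n))) \<longlonglongrightarrow> ennreal (t + 0)"
          by (intro tendsto_ennrealI tendsto_add tendsto_const LIMSEQ_Suc lim_1_over_n)
        then have "f (p, \<omega>) \<le> ennreal (t + 0)"
          by (rule LIMSEQ_le_const) (use p in auto)
        then show "p \<in> K \<inter> {p \<in> space L. f (p, \<omega>) \<le> ennreal t}" using p by auto
      next
        fix p assume p: "p \<in> K \<inter> {p \<in> space L. f (p, \<omega>) \<le> ennreal t}"
        have "f (p, \<omega>) \<le> ennreal (t + 1 / real (Suc n))" for n
          by (rule order_trans[of _ "ennreal t"]) (use p in \<open>auto intro!: ennreal_leI\<close>)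
        then show "p \<in> (\<Inter>n. K \<inter> {p \<in> space L. f (p, \<omega>) \<le> ennreal (t + 1 / real (Suc n))})"
          using p by auto
      qed
      \<comment> \<open>Right-continuity of the averaged process, by continuity from above of the
        finite measure \<open>L\<close>.\<close>
      have "(INF n. ?\<phi> (t + 1 / real (Suc n)) \<omega>) = emeasure L (\<Inter>n. K \<inter> {p \<in> space L. f (p, \<omega>) \<le> ennreal (t + 1 / real (Suc n))})"
      proof (rule INF_emeasure_decseq)
        show "range (\<lambda>n. K \<inter> {p \<in> space L. f (p, \<omega>) \<le> ennreal (t + 1 / real (Suc n))}) \<subseteq> sets L"
          by (intro image_subsetI sets.Int K sec[OF _ \<omega>]) (use t in simp)
        show "decseq (\<lambda>n. K \<inter> {p \<in> space L. f (p, \<omega>) \<le> ennreal (t + 1 / real (Suc n))})"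
        proof (rule antimonoI)
          fix x y :: nat assume "x \<le> y"
          then have "ennreal (t + 1 / real (Suc y)) \<le> ennreal (t + 1 / real (Suc x))"
            by (intro ennreal_leI add_left_mono divide_left_mono) auto
          then show "K \<inter> {p \<in> space L. f (p, \<omega>) \<le> ennreal (t + 1 / real (Suc y))} \<subseteq> K \<inter> {p \<in> space L. f (p, \<omega>) \<le> ennreal (t + 1 / real (Suc x))}"
            using order_trans by blast
        qed
      qed auto
      moreover have "c \<le> (INF n. ?\<phi> (t + 1 / real (Suc n)) \<omega>)" by (rule INF_greatest) (rule ge)
      ultimately show "c \<le> ?\<phi> t \<omega>" unfolding Inter by (simp only:)
    qed
    have stop: "stopping_time_wrt (space N) F S"
      unfolding stopping_time_wrt_def
    proof (intro allI impI)
      fix t :: real assume t: "0 \<le> t"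
      have "{\<omega> \<in> space N. S \<omega> \<le> ennreal t} = {\<omega> \<in> space N. c \<le> ?\<phi> t \<omega>}" using S_le[OF t] by auto
      then show "{\<omega> \<in> space N. S \<omega> \<le> ennreal t} \<in> F t" using adapted[OF t] by simp
    qed
    have "{(t,\<omega>) \<in> {0..} \<times> space N. S \<omega> \<le> ennreal t} \<in> sets (optional_sa (space N) F)"
      unfolding sets_optional_sa by (rule sigma_sets.Basic) (use stop in auto)
    also have "{(t,\<omega>) \<in> {0..} \<times> space N. S \<omega> \<le> ennreal t} =
      {x \<in> space (optional_sa (space N) F). c \<le> (case x of (t, \<omega>) \<Rightarrow> ?\<phi> t \<omega>)}"
      using S_le unfolding space_optional_sa by auto
    finally show "{x \<in> space (optional_sa (space N) F). c \<le> (case x of (t, \<omega>) \<Rightarrow> ?\<phi> t \<omega>)} \<in> sets (optional_sa (space N) F)" .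
  qed
qed

text \<open>
  Each \<open>f (p, \<cdot>)\<close> is a stopping time of the right-continuous filtration, but the sections need not glue to a
  product measurable set, because \<open>\<Inter>s>t. L \<otimes> F s\<close> may be larger than \<open>L \<otimes> F t\<close>. Averages of \<open>f (p, \<cdot>) \<le> t\<close>
  over a cell of a partition in \<open>p\<close> are increasing, right-continuous and adapted, hence optional. Along finer
  and finer partitions they tend to 0 for \<open>t < f\<close>, while at \<open>t = f\<close> the quantile bound keeps them from
  tending to 0 almost everywhere; their limit behaviour therefore recovers the set \<open>f \<le> t\<close>.\<close>
lemma parametrized_graph_optional:
  fixes f :: "'p \<times> 'a \<Rightarrow> ennreal"
  assumes pL: "prob_space L" and pN: "prob_space N"
    and filt: "is_filtration N F" and rc: "right_continuous_filtration F"
    and f: "\<And>t s. 0 \<le> t \<Longrightarrow> t < s \<Longrightarrow> {x \<in> space L \<times> space N. f x \<le> ennreal t} \<in> sets (L \<Otimes>\<^sub>M sigma (space N) (F s))"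
  shows "\<exists>C\<in>sets (L \<Otimes>\<^sub>M optional_sa (space N) F).
     AE x in L \<Otimes>\<^sub>M N. \<forall>t\<ge>0. (fst x, (t, snd x)) \<in> C \<longleftrightarrow> f x \<le> ennreal t"
proof -
  interpret L: prob_space L by fact
  interpret N: prob_space N by fact
  interpret P: pair_prob_space L N ..
  let ?P = "L \<Otimes>\<^sub>M N"
  have FN: "F t \<subseteq> sets N" if "0 \<le> t" for t using filt that by (auto simp: is_filtration_def)
  have spP: "space ?P = space L \<times> space N" by (rule space_pair_measure)
  have f_meas[measurable]: "f \<in> borel_measurable ?P"
  proof (rule borel_measurableI_le)
    fix a
    show "{x \<in> space ?P. f x \<le> a} \<in> sets ?P"
    proof (cases "a = \<infinity>")
      case True then show ?thesis by simp
    next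
      case False
      define r where "r = enn2real a"
      have a: "a = ennreal r" and r: "0 \<le> r" using False by (auto simp: r_def less_top)
      have "{x \<in> space L \<times> space N. f x \<le> ennreal r} \<in> sets (L \<Otimes>\<^sub>M sigma (space N) (F (r + 1)))"
        by (rule f[OF r]) simp
      then show ?thesis using sets_pair_sigma_mono[OF FN[of "r + 1"] refl, of L] r unfolding spP a by auto
    qed
  qed
  have sec: "{p \<in> space L. f (p, \<omega>) \<le> a} \<in> sets L" if [measurable]: "\<omega> \<in> space N" for \<omega> a
    by measurable
  define q where "q = from_nat_into (\<rat> \<inter> {0::real..})"
  have count: "countable (\<rat> \<inter> {0::real..})" by (intro countable_Int1 countable_rat)
  have "(0::real) \<in> \<rat> \<inter> {0..}" by simp
  then have q0: "q i \<ge> 0" for i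
    using from_nat_into[of "\<rat> \<inter> {0::real..}" i] unfolding q_def by auto
  have q_surj: "\<exists>i. q i = r" if "r \<in> \<rat>" "0 \<le> r" for r
    unfolding q_def by (rule from_nat_into_surj[OF count]) (use that in simp)
  define C where "C i = {x \<in> space ?P. f x \<le> ennreal (q i)}" for i
  have C[measurable]: "C i \<in> sets ?P" for i unfolding C_def by measurable
  \<comment> \<open>The partition number \<open>n\<close> serves the first \<open>n\<close> level
    sets at once, with error \<open>(1/2)^n\<close>. Each fixed level is then covered by all but
    finitely many partitions, with summable errors.\<close>
  have "\<forall>n. \<exists>\<K>. finite_partition L \<K> \<and> (\<forall>i<n. \<exists>C'\<in>sets ?P. (\<forall>\<omega>. saturated_for \<K> {p \<in> space L. (p, \<omega>) \<in> C'}) \<and>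
       measure ?P ((C i - C') \<union> (C' - C i)) < (1/2)^n)"
  proof
    fix n :: nat
    have "\<forall>i. \<exists>\<A> C'. finite \<A> \<and> \<A> \<subseteq> sets L \<and> C' \<in> sets ?P \<and> family_saturated \<A> (space L) C' \<and>
       measure ?P ((C i - C') \<union> (C' - C i)) < (1/2)^n"
      by (intro allI rectangle_approximation pL pN C) simp
    then obtain \<A> C' where C': "\<And>i. finite (\<A> i)" "\<And>i. \<A> i \<subseteq> sets L" "\<And>i. C' i \<in> sets ?P"
      "\<And>i. family_saturated (\<A> i) (space L) (C' i)" "\<And>i. measure ?P ((C i - C' i) \<union> (C' i - C i)) < (1/2)^n"
      by metis
    let ?A = "\<Union>i<n. \<A> i"
    have "finite ?A" "?A \<subseteq> sets L" using C'(1,2) by auto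
    from family_partition[OF this] obtain \<K> where \<K>: "finite_partition L \<K>"
      "\<And>(C :: ('p \<times> 'a) set) \<omega>. family_saturated ?A (space L) C \<Longrightarrow> saturated_for \<K> {p \<in> space L. (p, \<omega>) \<in> C}" by blast
    show "\<exists>\<K>. finite_partition L \<K> \<and> (\<forall>i<n. \<exists>C'\<in>sets ?P. (\<forall>\<omega>. saturated_for \<K> {p \<in> space L. (p, \<omega>) \<in> C'}) \<and>
       measure ?P ((C i - C') \<union> (C' - C i)) < (1/2)^n)"
    proof (intro exI[of _ \<K>] conjI \<K>(1) allI impI)
      fix i assume "i < n"
      then have "\<A> i \<subseteq> ?A" by auto
      then have "family_saturated ?A (space L) (C' i)" by (rule family_saturated_mono[OF C'(4)])
      then have "\<forall>\<omega>. saturated_for \<K> {p \<in> space L. (p, \<omega>) \<in> C' i}" using \<K>(2) by blast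
      then show "\<exists>C'\<in>sets ?P. (\<forall>\<omega>. saturated_for \<K> {p \<in> space L. (p, \<omega>) \<in> C'}) \<and>
         measure ?P ((C i - C') \<union> (C' - C i)) < (1/2)^n"
        using C'(3,5) by blast
    qed
  qed
  from choice[OF this] obtain \<K> where part: "\<forall>n. finite_partition L (\<K> n) \<and> (\<forall>i<n. \<exists>C'\<in>sets ?P.
       (\<forall>\<omega>. saturated_for (\<K> n) {p \<in> space L. (p, \<omega>) \<in> C'}) \<and> measure ?P ((C i - C') \<union> (C' - C i)) < (1/2)^n)" ..
  have \<K>: "finite_partition L (\<K> n)" for n using spec[OF part, of n] by (rule conjunct1)
  have approx: "\<exists>C'\<in>sets ?P. (\<forall>\<omega>. saturated_for (\<K> n) {p \<in> space L. (p, \<omega>) \<in> C'}) \<and>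
       measure ?P ((C i - C') \<union> (C' - C i)) < (1/2)^n" if "i < n" for n i
    using spec[OF part, of n, THEN conjunct2] that by (elim allE[of _ i] impE)
  have K_sets: "K \<in> sets L" if "K \<in> \<K> n" for K n using \<K>[of n] that by (auto simp: finite_partition_def)
  define g where "g n p a \<omega> = cell_avg L (\<K> n) {p' \<in> space L. f (p', \<omega>) \<le> a} p" for n p a \<omega>
  have g_mono: "g n p a \<omega> \<le> g n p b \<omega>" if "a \<le> b" "\<omega> \<in> space N" for n p a b \<omega>
    unfolding g_def by (rule cell_avg_mono[OF \<K> _ sec]) (use that order_trans in auto)
  \<comment> \<open>The level \<open>a\<close> may vary with the point, since the averages are
    evaluated both at rational levels and at the passage time \<open>f\<close> itself.\<close>
  have g_meas: "(\<lambda>x. g n (fst x) (a x) (snd x)) \<in> borel_measurable ?P" if [measurable]: "a \<in> borel_measurable ?P" for n a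
    unfolding g_def cell_avg_def
  proof (rule borel_measurable_sum)
    fix K assume "K \<in> \<K> n"
    then have K[measurable]: "K \<in> sets L" by (rule K_sets)
    have "(\<lambda>x. emeasure L (K \<inter> {p' \<in> space L. f (p', snd x) \<le> a x})) \<in> borel_measurable ?P"
    proof (subst measurable_cong)
      fix x assume x: "x \<in> space ?P"
      then have [measurable]: "snd x \<in> space N" by (auto simp: space_pair_measure)
      have "emeasure L (K \<inter> {p' \<in> space L. f (p', snd x) \<le> a x}) = (\<integral>\<^sup>+p'. indicator (K \<inter> {p' \<in> space L. f (p', snd x) \<le> a x}) p' \<partial>L)"
        by (rule nn_integral_indicator[symmetric]) measurable
      also have "\<dots> = (\<integral>\<^sup>+p'. (if p' \<in> K \<and> f (p', snd x) \<le> a x then 1 else 0) \<partial>L)"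
        by (rule nn_integral_cong) (simp add: indicator_def)
      finally show "emeasure L (K \<inter> {p' \<in> space L. f (p', snd x) \<le> a x}) = (\<integral>\<^sup>+p'. (if p' \<in> K \<and> f (p', snd x) \<le> a x then 1 else 0) \<partial>L)" .
    qed measurable
    then show "(\<lambda>x. indicator K (fst x) * (emeasure L (K \<inter> {p' \<in> space L. f (p', snd x) \<le> a x}) / emeasure L K)) \<in> borel_measurable ?P"
      by measurable
  qed
  \<comment> \<open>A Borel-Cantelli argument: by \<open>cell_avg_impurity\<close> the averages at a
    fixed rational level, integrated over the set where \<open>f\<close> exceeds it, are eventually
    at most \<open>(1/2)^n\<close>. Their sum is therefore finite almost everywhere, and the
    averages tend to 0.\<close>
  have below: "AE x in ?P. \<not> f x \<le> ennreal (q i) \<longrightarrow> \<not> persists (\<lambda>n. g n (fst x) (ennreal (q i)) (snd x))" for i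
  proof -
    define u where "u n x = indicator (space ?P - C i) x * g n (fst x) (ennreal (q i)) (snd x)" for n x
    have u_meas[measurable]: "u n \<in> borel_measurable ?P" for n
      unfolding u_def using g_meas[of "\<lambda>_. ennreal (q i)" n] by measurable
    have u_le: "(\<integral>\<^sup>+x. u n x \<partial>?P) \<le> ennreal ((1/2)^n)" if n: "i < n" for n
    proof -
      obtain C' where C'[measurable]: "C' \<in> sets ?P" and sat: "\<And>\<omega>. saturated_for (\<K> n) {p \<in> space L. (p, \<omega>) \<in> C'}"
        and m: "measure ?P ((C i - C') \<union> (C' - C i)) < (1/2)^n" using approx[OF n] by blast
      let ?D = "(C i - C') \<union> (C' - C i)"
      have "(\<integral>\<^sup>+x. u n x \<partial>?P) = (\<integral>\<^sup>+\<omega>. (\<integral>\<^sup>+p. u n (p, \<omega>) \<partial>L) \<partial>N)"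
        by (rule P.nn_integral_snd[symmetric]) measurable
      also have "\<dots> \<le> (\<integral>\<^sup>+\<omega>. emeasure L ((\<lambda>p. (p, \<omega>)) -` ?D) \<partial>N)"
      proof (rule nn_integral_mono)
        fix \<omega> assume \<omega>[measurable]: "\<omega> \<in> space N"
        let ?S = "{p \<in> space L. f (p, \<omega>) \<le> ennreal (q i)}" and ?S' = "{p \<in> space L. (p, \<omega>) \<in> C'}"
        have S': "?S' \<in> sets L" by measurable
        have "(\<integral>\<^sup>+p. u n (p, \<omega>) \<partial>L) = (\<integral>\<^sup>+p. indicator (space L - ?S) p * cell_avg L (\<K> n) ?S p \<partial>L)"
          by (rule nn_integral_cong) (use \<omega> in \<open>auto simp: u_def g_def C_def space_pair_measure indicator_def\<close>)
        also have "\<dots> \<le> emeasure L ((?S - ?S') \<union> (?S' - ?S))"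
          by (rule cell_avg_impurity[OF pL \<K> sec[OF \<omega>] S' sat])
        also have "(?S - ?S') \<union> (?S' - ?S) = (\<lambda>p. (p, \<omega>)) -` ?D"
          using \<omega> sets.sets_into_space[OF C'] by (auto simp: C_def space_pair_measure)
        finally show "(\<integral>\<^sup>+p. u n (p, \<omega>) \<partial>L) \<le> emeasure L ((\<lambda>p. (p, \<omega>)) -` ?D)" .
      qed
      also have "\<dots> = emeasure ?P ?D"
        by (rule P.emeasure_pair_measure_alt2[symmetric]) measurable
      also have "\<dots> = ennreal (measure ?P ?D)" by (rule P.emeasure_eq_measure)
      also have "\<dots> \<le> ennreal ((1/2)^n)" using m by (intro ennreal_leI) simp
      finally show ?thesis .
    qed
    have "(\<integral>\<^sup>+x. (\<Sum>n. u (n + Suc i) x) \<partial>?P) = (\<Sum>n. (\<integral>\<^sup>+x. u (n + Suc i) x \<partial>?P))"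
      by (rule nn_integral_suminf) measurable
    also have "\<dots> \<le> (\<Sum>n. ennreal ((1/2)^(n + Suc i)))"
      by (intro suminf_le u_le) auto
    also have "\<dots> = ennreal (\<Sum>n. (1/2)^(n + Suc i))"
      by (rule suminf_ennreal2) (auto intro: summable_ignore_initial_segment summable_geometric simp del: power_Suc add_Suc_right)
    also have "\<dots> < \<infinity>" by simp
    finally have "(\<integral>\<^sup>+x. (\<Sum>n. u (n + Suc i) x) \<partial>?P) \<noteq> \<infinity>" by simp
    then have "AE x in ?P. (\<Sum>n. u (n + Suc i) x) \<noteq> \<infinity>"
      by (intro nn_integral_PInf_AE) measurable
    then show ?thesis
    proof (rule AE_mp, intro AE_I2 impI)
      fix x assume x: "x \<in> space ?P" and fin: "(\<Sum>n. u (n + Suc i) x) \<noteq> \<infinity>" and nle: "\<not> f x \<le> ennreal (q i)"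
      have "u n x = g n (fst x) (ennreal (q i)) (snd x)" for n
        using x nle by (simp add: u_def C_def)
      then show "\<not> persists (\<lambda>n. g n (fst x) (ennreal (q i)) (snd x))"
        using not_persists_summable[of "\<lambda>n. u n x" "Suc i"] fin by simp
    qed
  qed
  have at: "AE x in ?P. persists (\<lambda>n. g n (fst x) (f x) (snd x))"
  proof -
    let ?B = "{x \<in> space ?P. \<not> persists (\<lambda>n. g n (fst x) (f x) (snd x))}"
    have gfm[measurable]: "(\<lambda>x. g n (fst x) (f x) (snd x)) \<in> borel_measurable ?P" for n by (rule g_meas) measurable
    have "{x \<in> space ?P. persists (\<lambda>n. g n (fst x) (f x) (snd x))} \<in> sets ?P"
      by (rule sets_persists) (rule gfm)
    moreover have "?B = space ?P - {x \<in> space ?P. persists (\<lambda>n. g n (fst x) (f x) (snd x))}" by auto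
    ultimately have B: "?B \<in> sets ?P" by (metis (no_types, lifting) sets.compl_sets)
    have "emeasure L ((\<lambda>p. (p, \<omega>)) -` ?B) = 0" if \<omega>[measurable]: "\<omega> \<in> space N" for \<omega>
    proof -
      \<comment> \<open>If the averages at the own passage time of \<open>p\<close> tend to 0, then
        \<open>p\<close> lies in \<open>W c n\<close> for all large \<open>n\<close>, whatever
        \<open>c > 0\<close>. Each \<open>W c n\<close> has measure at most \<open>c\<close>, so the
        bad section has measure at most \<open>c\<close> for every such \<open>c\<close>.\<close>
      define W where "W c n = {p \<in> space L. g n p (f (p, \<omega>)) \<omega> \<le> c}" for c n
      have W: "W c n \<in> sets L" for c n
      proof -
        have "(\<lambda>p. g n (fst (p, \<omega>)) (f (p, \<omega>)) (snd (p, \<omega>))) \<in> borel_measurable L" by measurable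
        then show ?thesis unfolding W_def by simp
      qed
      have W_le: "emeasure L (W c n) \<le> c" for c n
        unfolding W_def g_def by (rule cell_avg_quantile[OF pL \<K>]) measurable
      have le: "emeasure L ((\<lambda>p. (p, \<omega>)) -` ?B) \<le> ennreal (1 / real (Suc j))" for j
      proof -
        let ?c = "ennreal (1 / real (Suc j))"
        have "(\<lambda>p. (p, \<omega>)) -` ?B \<subseteq> (\<Union>k. \<Inter>n\<in>{k..}. W ?c n)"
        proof
          fix p assume "p \<in> (\<lambda>p. (p, \<omega>)) -` ?B"
          then have p: "p \<in> space L" "\<not> persists (\<lambda>n. g n p (f (p, \<omega>)) \<omega>)" by (auto simp: space_pair_measure)
          then obtain k where "\<And>n. n \<ge> k \<Longrightarrow> \<not> ?c < g n p (f (p, \<omega>)) \<omega>" unfolding persists_def by blast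
          then have "\<And>n. n \<ge> k \<Longrightarrow> p \<in> W ?c n" using p(1) by (simp add: W_def not_less)
          then show "p \<in> (\<Union>k. \<Inter>n\<in>{k..}. W ?c n)" by auto
        qed
        moreover have I: "(\<Inter>n\<in>{k..}. W ?c n) \<in> sets L" for k
          using W by (intro sets.countable_INT') auto
        ultimately have "emeasure L ((\<lambda>p. (p, \<omega>)) -` ?B) \<le> emeasure L (\<Union>k. \<Inter>n\<in>{k..}. W ?c n)"
          by (intro emeasure_mono) auto
        also have "\<dots> = (SUP k. emeasure L (\<Inter>n\<in>{k..}. W ?c n))"
          by (rule SUP_emeasure_incseq[symmetric]) (use I in \<open>auto simp: incseq_def\<close>)
        also have "\<dots> \<le> ?c"
        proof (rule SUP_least)
          fix k
          have "emeasure L (\<Inter>n\<in>{k..}. W ?c n) \<le> emeasure L (W ?c k)" using W by (intro emeasure_mono) auto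
          also have "\<dots> \<le> ?c" by (rule W_le)
          finally show "emeasure L (\<Inter>n\<in>{k..}. W ?c n) \<le> ?c" .
        qed
        finally show ?thesis .
      qed
      have "(\<lambda>j. ennreal (1 / real (Suc j))) \<longlonglongrightarrow> ennreal 0"
        by (intro tendsto_ennrealI LIMSEQ_Suc lim_1_over_n)
      then have "emeasure L ((\<lambda>p. (p, \<omega>)) -` ?B) \<le> ennreal 0"
        by (rule LIMSEQ_le_const) (use le in blast)
      then show ?thesis by simp
    qed
    then have "emeasure ?P ?B = (\<integral>\<^sup>+\<omega>. 0 \<partial>N)"
      unfolding P.emeasure_pair_measure_alt2[OF B] by (intro nn_integral_cong) auto
    then have "emeasure ?P ?B = 0" by simp
    then show ?thesis by (rule AE_I[OF _ _ B, rotated]) auto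
  qed
  let ?O = "L \<Otimes>\<^sub>M optional_sa (space N) F"
  \<comment> \<open>Only optional processes enter: for each \<open>n\<close> the average is a finite
    sum of indicators of cells in \<open>p\<close> times processes from
    \<open>optional_sectionwise_measure\<close>.\<close>
  define D where "D = {x \<in> space ?O. persists (\<lambda>n. g n (fst x) (ennreal (fst (snd x))) (snd (snd x)))}"
  have D: "D \<in> sets ?O"
    unfolding D_def
  proof (rule sets_persists)
    fix n
    show "(\<lambda>x. g n (fst x) (ennreal (fst (snd x))) (snd (snd x))) \<in> borel_measurable ?O"
      unfolding g_def cell_avg_def
    proof (rule borel_measurable_sum)
      fix K assume "K \<in> \<K> n"
      then have K[measurable]: "K \<in> sets L" by (rule K_sets)
      have [measurable]: "(\<lambda>(t, \<omega>). emeasure L (K \<inter> {p \<in> space L. f (p, \<omega>) \<le> ennreal t})) \<in> borel_measurable (optional_sa (space N) F)"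
        by (rule optional_sectionwise_measure[OF pL filt rc f K])
      have "(\<lambda>x. (\<lambda>(t, \<omega>). emeasure L (K \<inter> {p \<in> space L. f (p, \<omega>) \<le> ennreal t})) (snd x)) \<in> borel_measurable ?O"
        by measurable
      then have "(\<lambda>x. emeasure L (K \<inter> {p' \<in> space L. f (p', snd (snd x)) \<le> ennreal (fst (snd x))})) \<in> borel_measurable ?O"
        by (simp add: case_prod_beta)
      then show "(\<lambda>x. indicator K (fst x) * (emeasure L (K \<inter> {p' \<in> space L. f (p', snd (snd x)) \<le> ennreal (fst (snd x))}) / emeasure L K)) \<in> borel_measurable ?O"
        by measurable
    qed
  qed
  have "AE x in ?P. \<forall>i. \<not> f x \<le> ennreal (q i) \<longrightarrow> \<not> persists (\<lambda>n. g n (fst x) (ennreal (q i)) (snd x))"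
    unfolding AE_all_countable using below by blast
  with at AE_space have "AE x in ?P. \<forall>t\<ge>0. (fst x, (t, snd x)) \<in> D \<longleftrightarrow> f x \<le> ennreal t"
  proof eventually_elim
    case (elim x)
    note at_x = elim(1) and x = elim(2) and below_x = elim(3)
    have snd_x: "snd x \<in> space N" and fst_x: "fst x \<in> space L" using x by (auto simp: space_pair_measure)
    show ?case
    proof (intro allI impI)
      fix t :: real assume t: "0 \<le> t"
      have "(fst x, (t, snd x)) \<in> D \<longleftrightarrow> persists (\<lambda>n. g n (fst x) (ennreal t) (snd x))"
        using t snd_x fst_x by (simp add: D_def space_pair_measure space_optional_sa)
      also have "\<dots> \<longleftrightarrow> f x \<le> ennreal t"
      proof
        assume "f x \<le> ennreal t"
        then show "persists (\<lambda>n. g n (fst x) (ennreal t) (snd x))"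
          by (intro persists_mono[OF at_x] g_mono snd_x)
      next
        assume pers: "persists (\<lambda>n. g n (fst x) (ennreal t) (snd x))"
        show "f x \<le> ennreal t"
        proof (rule ccontr)
          assume "\<not> ?thesis"
          then have "ennreal t < f x" by simp
          \<comment> \<open>The almost sure information in \<open>below\<close> concerns rational
            levels only; as the averages increase with the level, \<open>t\<close> can be raised to
            a rational level still below \<open>f x\<close>.\<close>
          then obtain s where s: "ennreal t < s" "s < f x" using dense by blast
          have "s < top" using s(2) by (rule less_le_trans) simp
          then have "ennreal t < ennreal (enn2real s)" using s(1) by simp
          then have "t < enn2real s" using t by (simp add: ennreal_less_iff)
          then obtain r where r: "r \<in> \<rat>" "t < r" "r < enn2real s" using Rats_dense_in_real by blast
          obtain i where i: "q i = r" using q_surj[OF r(1)] t r(2) by auto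
          have "ennreal r \<le> ennreal (enn2real s)" using r by (intro ennreal_leI) simp
          also have "\<dots> < f x" using s(2) \<open>s < top\<close> by simp
          finally have "\<not> f x \<le> ennreal (q i)" by (simp add: i)
          then have "\<not> persists (\<lambda>n. g n (fst x) (ennreal (q i)) (snd x))" using below_x by blast
          moreover have "persists (\<lambda>n. g n (fst x) (ennreal (q i)) (snd x))"
            using r(2) by (intro persists_mono[OF pers] g_mono snd_x ennreal_leI) (simp add: i)
          ultimately show False by simp
        qed
      qed
      finally show "(fst x, (t, snd x)) \<in> D \<longleftrightarrow> f x \<le> ennreal t" .
    qed
  qed
  then show ?thesis using D by blast
qed

section \<open>Null sets and completions\<close>

text \<open>The law of the pair \<open>(Z, \<omega>)\<close> has density \<open>\<gamma>\<close>
  with respect to the product measure. On a rectangle with second side in \<open>S\<close> this is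
  the defining property of the conditional expectation followed by the density formula; rectangles
  determine the law. Null sets of the product are then null for the law.\<close>

lemma null_joint_law:
  fixes Q :: "'a measure" and V :: "'z measure" and \<gamma> :: "'z \<times> 'a \<Rightarrow> ennreal"
  assumes pQ: "prob_space Q" and pV: "prob_space V" and sub: "subalgebra Q S"
    and Z[measurable]: "Z \<in> Q \<rightarrow>\<^sub>M V"
    and \<gamma>: "\<gamma> \<in> borel_measurable (V \<Otimes>\<^sub>M S)"
    and dens: "\<And>A. A \<in> sets V \<Longrightarrow> AE \<omega> in Q. nn_cond_exp Q S (indicator {\<omega>'\<in>space Q. Z \<omega>' \<in> A}) \<omega>
             = (\<integral>\<^sup>+ x. \<gamma> (x, \<omega>) * indicator A x \<partial>V)"
    and \<Gamma>: "\<Gamma> \<in> sets (V \<Otimes>\<^sub>M restr_to_subalg Q S)" and null: "emeasure (V \<Otimes>\<^sub>M restr_to_subalg Q S) \<Gamma> = 0"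
  shows "emeasure Q {\<omega> \<in> space Q. (Z \<omega>, \<omega>) \<in> \<Gamma>} = 0"
proof -
  interpret Q: prob_space Q by fact
  interpret V: prob_space V by fact
  interpret fs: finite_measure_subalgebra Q S by standard (rule sub)
  let ?N = "restr_to_subalg Q S"
  have setsN: "sets ?N = sets S" by (rule sets_restr_to_subalg[OF sub])
  have spN: "space ?N = space Q" by (rule space_restr_to_subalg)
  have spS: "space S = space Q" and subS: "sets S \<subseteq> sets Q" using sub by (auto simp: subalgebra_def)
  interpret N: prob_space ?N by (rule prob_space_restr_to_subalg[OF sub pQ])
  interpret P: pair_prob_space V ?N ..
  let ?P = "V \<Otimes>\<^sub>M ?N"
  have setsP: "sets (V \<Otimes>\<^sub>M S) = sets ?P" by (rule sets_pair_measure_cong) (auto simp: setsN)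
  have \<gamma>P[measurable]: "\<gamma> \<in> borel_measurable ?P" using \<gamma> measurable_cong_sets[OF setsP refl] by blast
  have idm: "(\<lambda>\<omega>. \<omega>) \<in> Q \<rightarrow>\<^sub>M ?N"
    by (rule measurableI) (use spN setsN subS in \<open>auto simp: Int_absorb2 dest: sets.sets_into_space\<close>)
  have m[measurable]: "(\<lambda>\<omega>. (Z \<omega>, \<omega>)) \<in> Q \<rightarrow>\<^sub>M ?P" using idm by (intro measurable_Pair) auto
  have eq: "distr Q ?P (\<lambda>\<omega>. (Z \<omega>, \<omega>)) = density ?P \<gamma>"
  proof (rule measure_eqI_generator_eq[where E="{a \<times> b | a b. a \<in> sets V \<and> b \<in> sets ?N}" and \<Omega>="space V \<times> space ?N" and A="\<lambda>_. space V \<times> space ?N"])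
    show "Int_stable {a \<times> b | a b. a \<in> sets V \<and> b \<in> sets ?N}" by (rule Int_stable_pair_measure_generator)
    show "{a \<times> b | a b. a \<in> sets V \<and> b \<in> sets ?N} \<subseteq> Pow (space V \<times> space ?N)" by (rule pair_measure_closed)
    show "sets (distr Q ?P (\<lambda>\<omega>. (Z \<omega>, \<omega>))) = sigma_sets (space V \<times> space ?N) {a \<times> b | a b. a \<in> sets V \<and> b \<in> sets ?N}"
      "sets (density ?P \<gamma>) = sigma_sets (space V \<times> space ?N) {a \<times> b | a b. a \<in> sets V \<and> b \<in> sets ?N}"
      by (simp_all add: sets_pair_measure)
    show "range (\<lambda>_::nat. space V \<times> space ?N) \<subseteq> {a \<times> b | a b. a \<in> sets V \<and> b \<in> sets ?N}" by blast
    show "(\<Union>i::nat. space V \<times> space ?N) = space V \<times> space ?N" by simp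
    show "emeasure (distr Q ?P (\<lambda>\<omega>. (Z \<omega>, \<omega>))) (space V \<times> space ?N) \<noteq> \<infinity>" for i :: nat
      by (subst emeasure_distr[OF m]) auto
    fix X assume "X \<in> {a \<times> b | a b. a \<in> sets V \<and> b \<in> sets ?N}"
    then obtain a b where X: "X = a \<times> b" and a[measurable]: "a \<in> sets V" and b: "b \<in> sets ?N" by blast
    have bS: "b \<in> sets S" using b setsN by simp
    have bQ[measurable]: "b \<in> sets Q" using bS subS by blast
    have bsub: "b \<subseteq> space Q" using sets.sets_into_space[OF bQ] .
    let ?Za = "{\<omega>'\<in>space Q. Z \<omega>' \<in> a}"
    have XP[measurable]: "X \<in> sets ?P" unfolding X using a b by (rule pair_measureI)
    let ?k = "\<lambda>\<omega>. \<integral>\<^sup>+ x. \<gamma> (x, \<omega>) * indicator a x \<partial>V"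
    have k: "?k \<in> borel_measurable ?N" by measurable
    have kS: "?k \<in> borel_measurable S" using k measurable_cong_sets[OF setsN refl] by blast
    have iS: "(indicator b :: 'a \<Rightarrow> ennreal) \<in> borel_measurable S" using bS by simp
    have ikS: "(\<lambda>\<omega>. indicator b \<omega> * ?k \<omega>) \<in> borel_measurable S" by (rule borel_measurable_times_ennreal[OF iS kS])
    have "emeasure (distr Q ?P (\<lambda>\<omega>. (Z \<omega>, \<omega>))) X = emeasure Q (b \<inter> ?Za)"
      by (subst emeasure_distr[OF m XP]) (use bsub in \<open>auto simp: X intro!: arg_cong[where f="emeasure Q"]\<close>)
    also have "\<dots> = (\<integral>\<^sup>+\<omega>. indicator (b \<inter> ?Za) \<omega> \<partial>Q)" by (rule nn_integral_indicator[symmetric]) measurable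
    also have "\<dots> = (\<integral>\<^sup>+\<omega>. indicator b \<omega> * indicator ?Za \<omega> \<partial>Q)"
      by (rule nn_integral_cong) (simp add: indicator_inter_arith)
    also have "\<dots> = (\<integral>\<^sup>+\<omega>. indicator b \<omega> * nn_cond_exp Q S (indicator ?Za) \<omega> \<partial>Q)"
      by (rule fs.nn_cond_exp_intg[symmetric]) (use iS in measurable)
    also have "\<dots> = (\<integral>\<^sup>+\<omega>. indicator b \<omega> * ?k \<omega> \<partial>Q)"
      by (rule nn_integral_cong_AE) (use dens[OF a] in \<open>auto\<close>)
    also have "\<dots> = (\<integral>\<^sup>+\<omega>. indicator b \<omega> * ?k \<omega> \<partial>?N)"
      by (rule nn_integral_subalgebra2[OF sub ikS, symmetric])
    also have "\<dots> = (\<integral>\<^sup>+\<omega>. (\<integral>\<^sup>+x. \<gamma> (x, \<omega>) * indicator X (x, \<omega>) \<partial>V) \<partial>?N)"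
    proof (rule nn_integral_cong)
      fix \<omega> assume [measurable]: "\<omega> \<in> space ?N"
      have "indicator b \<omega> * ?k \<omega> = (\<integral>\<^sup>+x. indicator b \<omega> * (\<gamma> (x, \<omega>) * indicator a x) \<partial>V)"
        by (rule nn_integral_cmult[symmetric]) measurable
      also have "\<dots> = (\<integral>\<^sup>+x. \<gamma> (x, \<omega>) * indicator X (x, \<omega>) \<partial>V)"
      proof (rule nn_integral_cong)
        fix x
        show "indicator b \<omega> * (\<gamma> (x, \<omega>) * indicator a x) = \<gamma> (x, \<omega>) * indicator X (x, \<omega>)"
          unfolding X by (cases "\<omega> \<in> b"; cases "x \<in> a") simp_all
      qed
      finally show "indicator b \<omega> * ?k \<omega> = (\<integral>\<^sup>+x. \<gamma> (x, \<omega>) * indicator X (x, \<omega>) \<partial>V)" .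
    qed
    also have "\<dots> = (\<integral>\<^sup>+x. \<gamma> x * indicator X x \<partial>?P)"
      by (rule P.nn_integral_snd) measurable
    also have "\<dots> = emeasure (density ?P \<gamma>) X"
      by (rule emeasure_density[symmetric]) measurable
    finally show "emeasure (distr Q ?P (\<lambda>\<omega>. (Z \<omega>, \<omega>))) X = emeasure (density ?P \<gamma>) X" .
  qed
  have "emeasure Q {\<omega> \<in> space Q. (Z \<omega>, \<omega>) \<in> \<Gamma>} = emeasure (distr Q ?P (\<lambda>\<omega>. (Z \<omega>, \<omega>))) \<Gamma>"
    by (subst emeasure_distr[OF m \<Gamma>]) (auto intro!: arg_cong[where f="emeasure Q"])
  also have "\<dots> = (\<integral>\<^sup>+x. \<gamma> x * indicator \<Gamma> x \<partial>?P)"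
    unfolding eq by (rule emeasure_density[OF \<gamma>P \<Gamma>])
  also have "\<dots> = (\<integral>\<^sup>+x. 0 \<partial>?P)"
  proof (rule nn_integral_cong_AE)
    have "AE x in ?P. x \<notin> \<Gamma>" using \<Gamma> null by (intro AE_not_in) (auto simp: null_sets_def)
    then show "AE x in ?P. \<gamma> x * indicator \<Gamma> x = 0" by eventually_elim simp
  qed
  finally show ?thesis by simp
qed

text \<open>The sets that agree with a member of \<open>S\<close> off a null set from
  \<open>J\<close> form a sigma-algebra, and it contains both generating families. The exceptional
  set is taken in \<open>J\<close> itself, not merely as a subset of such a set.\<close>

lemma completion_representative:
  fixes Q :: "'a measure"
  assumes A: "A \<in> join_sa (space Q) (null_sa Q J) S"
    and S: "sigma_algebra (space Q) S" and J: "sigma_algebra (space Q) J" and JQ: "J \<subseteq> sets Q"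
  shows "\<exists>A'\<in>S. \<exists>B\<in>J. emeasure Q B = 0 \<and> (\<forall>\<omega>\<in>space Q - B. \<omega> \<in> A \<longleftrightarrow> \<omega> \<in> A')"
proof -
  interpret S: sigma_algebra "space Q" S by fact
  interpret J: sigma_algebra "space Q" J by fact
  define R where "R A \<longleftrightarrow> (\<exists>A'\<in>S. \<exists>B\<in>J. emeasure Q B = 0 \<and> (\<forall>\<omega>\<in>space Q - B. \<omega> \<in> A \<longleftrightarrow> \<omega> \<in> A'))" for A
  have R_S: "R a" if "a \<in> S" for a unfolding R_def using that by (intro bexI[of _ a] bexI[of _ "{}"]) auto
  have R_compl: "R (space Q - a)" if Ra: "R a" for a
  proof -
    obtain A' B where "A' \<in> S" "B \<in> J" "emeasure Q B = 0" "\<forall>\<omega>\<in>space Q - B. \<omega> \<in> a \<longleftrightarrow> \<omega> \<in> A'"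
      using Ra unfolding R_def by blast
    then show ?thesis unfolding R_def by (intro bexI[of _ "space Q - A'"] bexI[of _ B]) auto
  qed
  have R_Union: "R (\<Union>i. a i)" if "\<And>i::nat. R (a i)" for a
  proof -
    have "\<forall>i. \<exists>A'. \<exists>B. A' \<in> S \<and> B \<in> J \<and> emeasure Q B = 0 \<and> (\<forall>\<omega>\<in>space Q - B. \<omega> \<in> a i \<longleftrightarrow> \<omega> \<in> A')"
      using that unfolding R_def by blast
    from choice[OF this] obtain A' where "\<forall>i. \<exists>B. A' i \<in> S \<and> B \<in> J \<and> emeasure Q B = 0 \<and> (\<forall>\<omega>\<in>space Q - B. \<omega> \<in> a i \<longleftrightarrow> \<omega> \<in> A' i)" ..
    from choice[OF this] obtain B where B: "\<forall>i. A' i \<in> S \<and> B i \<in> J \<and> emeasure Q (B i) = 0 \<and> (\<forall>\<omega>\<in>space Q - B i. \<omega> \<in> a i \<longleftrightarrow> \<omega> \<in> A' i)" ..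
    have "(\<Union>i. A' i) \<in> S" using B by auto
    moreover have "(\<Union>i. B i) \<in> J" using B by auto
    moreover have "emeasure Q (\<Union>i. B i) = 0"
      by (rule emeasure_UN_eq_0) (use B JQ in auto)
    moreover have "\<forall>\<omega>\<in>space Q - (\<Union>i. B i). \<omega> \<in> (\<Union>i. a i) \<longleftrightarrow> \<omega> \<in> (\<Union>i. A' i)" using B by auto
    ultimately show ?thesis unfolding R_def by blast
  qed
  have R_null: "R a" if "a \<in> null_sa Q J" for a
    using that unfolding null_sa_def
  proof (induction rule: sigma_sets.induct)
    case (Basic a)
    then obtain B where "B \<in> J" "emeasure Q B = 0" "a \<subseteq> B" by blast
    then show ?case unfolding R_def by (intro bexI[of _ "{}"] bexI[of _ B]) auto
  next
    case Empty then show ?case by (rule R_S) simp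
  next
    case (Compl a) then show ?case by (intro R_compl)
  next
    case (Union a) then show ?case by (intro R_Union)
  qed
  have "R A"
    using A unfolding join_sa_def
  proof (induction rule: sigma_sets.induct)
    case (Basic a) then show ?case using R_null R_S by blast
  next
    case Empty then show ?case by (rule R_S) simp
  next
    case (Compl a) then show ?case by (intro R_compl)
  next
    case (Union a) then show ?case by (intro R_Union)
  qed
  then show ?thesis unfolding R_def .
qed

lemma sigma_algebra_sets: 
  assumes "sigma_algebra X F" shows "sets (sigma X F) = F" "space (sigma X F) = X"
  by (rule sigma_algebra.sets_measure_of_eq[OF assms], rule sigma_algebra.space_measure_of_eq[OF assms])

text \<open>A Doob-Dynkin statement: the sigma-algebra generated by the map from
  \<open>\<omega>\<close> to its stopped paths and \<open>\<omega>\<close> itself contains both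
  factors of the join, so every set of the join is a preimage under this map.\<close>

lemma join_filtration_representation:
  fixes \<Delta> :: "'e::polish_space"
  assumes F: "sigma_algebra Om Fq" and q: "0 \<le> q"
    and A: "A \<in> join_sa Om Fq (H_sa Om \<Delta> \<tau> \<xi> m q)"
  shows "\<exists>C\<in>sets ((\<Pi>\<^sub>M j\<in>{1..m}. skorokhod_borel) \<Otimes>\<^sub>M sigma Om Fq).
     A = {\<omega> \<in> Om. (H_vec \<Delta> \<tau> \<xi> m (ennreal q) \<omega>, \<omega>) \<in> C}"
proof -
  let ?D = "\<Pi>\<^sub>M j\<in>{1..m}. (skorokhod_borel :: (real \<Rightarrow> 'e) measure)"
  let ?N = "?D \<Otimes>\<^sub>M sigma Om Fq"
  let ?\<Phi> = "\<lambda>\<omega>. (H_vec \<Delta> \<tau> \<xi> m (ennreal q) \<omega>, \<omega>)"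
  let ?M = "vimage_algebra Om ?\<Phi> ?N"
  note Fs = sigma_algebra_sets[OF F]
  have \<Phi>: "?\<Phi> \<in> Om \<rightarrow> space ?N" using H_vec_space by (auto simp: space_pair_measure Fs)
  have sp: "space ?M = Om" by simp
  have \<Phi>m: "?\<Phi> \<in> ?M \<rightarrow>\<^sub>M ?N" by (rule measurable_vimage_algebra1[OF \<Phi>])
  have "Fq \<subseteq> sets ?M"
  proof
    fix a assume a: "a \<in> Fq"
    have "snd \<circ> ?\<Phi> \<in> ?M \<rightarrow>\<^sub>M sigma Om Fq" by (rule measurable_comp[OF \<Phi>m measurable_snd])
    from measurable_sets[OF this, of a] have "(snd \<circ> ?\<Phi>) -` a \<inter> Om \<in> sets ?M" using a Fs by simp
    moreover have "(snd \<circ> ?\<Phi>) -` a \<inter> Om = a"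
      using a sets.sets_into_space[of a "sigma Om Fq"] Fs by auto
    ultimately show "a \<in> sets ?M" by simp
  qed
  moreover have "H_sa Om \<Delta> \<tau> \<xi> m q \<subseteq> sets ?M"
    unfolding H_sa_def
  proof (rule sets.sigma_sets_subset[of _ ?M, unfolded sp], safe)
    fix i s and B :: "'e set" assume i: "i \<in> {1..m}" and s: "0 \<le> s" "s \<le> q" and B: "B \<in> sets borel"
    have "(\<lambda>\<omega>. (fst \<circ> ?\<Phi>) \<omega> i s) \<in> borel_measurable ?M"
      by (rule measurable_compose[OF measurable_comp[OF \<Phi>m measurable_fst] measurable_PiM_eval[OF s(1) i]])
    from measurable_sets[OF this B] have "(\<lambda>\<omega>. (fst \<circ> ?\<Phi>) \<omega> i s) -` B \<inter> Om \<in> sets ?M" by simp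
    also have "(\<lambda>\<omega>. (fst \<circ> ?\<Phi>) \<omega> i s) -` B \<inter> Om = {\<omega> \<in> Om. H_proc \<Delta> \<tau> \<xi> i s \<omega> \<in> B}"
    proof -
      \<comment> \<open>Stopping at \<open>q\<close> leaves the values at times \<open>s\<close> up
        to \<open>q\<close> unchanged.\<close>
      have "min (ennreal s) (ennreal q) = ennreal s" using s by (intro min_absorb1 ennreal_leI)
      then have "(fst \<circ> ?\<Phi>) \<omega> i s = H_proc \<Delta> \<tau> \<xi> i s \<omega>" for \<omega>
        using i by (simp add: H_vec_def H_stopped_def H_proc_def)
      then show ?thesis by auto
    qed
    finally show "{\<omega> \<in> Om. H_proc \<Delta> \<tau> \<xi> i s \<omega> \<in> B} \<in> sets ?M" .
  qed
  ultimately have "sigma_sets (space ?M) (Fq \<union> H_sa Om \<Delta> \<tau> \<xi> m q) \<subseteq> sets ?M"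
    by (intro sets.sigma_sets_subset) simp
  then have "A \<in> sets ?M" using A unfolding join_sa_def sp by blast
  then obtain C where "C \<in> sets ?N" "A = ?\<Phi> -` C \<inter> Om"
    unfolding sets_vimage_algebra2[OF \<Phi>] by blast
  then show ?thesis by (intro bexI[of _ C]) auto
qed

section \<open>Stopping times of the enlarged filtration\<close>

lemma ennreal_rat_between:
  assumes "ennreal a < b" "0 \<le> a"
  obtains r where "r \<in> \<rat>" "a < r" "ennreal r < b"
proof -
  obtain s where s: "ennreal a < s" "s < b" using dense[OF assms(1)] by blast
  have fin: "s < top" using s(2) by (rule less_le_trans) simp
  then have "ennreal a < ennreal (enn2real s)" using s(1) by simp
  then have "a < enn2real s" using assms(2) by (simp add: ennreal_less_iff)
  then obtain r where r: "r \<in> \<rat>" "a < r" "r < enn2real s" using Rats_dense_in_real by blast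
  have "ennreal r \<le> ennreal (enn2real s)" using r by (intro ennreal_leI) simp
  also have "\<dots> < b" using s(2) fin by simp
  finally show thesis using r that by blast
qed

lemma join_sa_upper: "S \<subseteq> join_sa X S T" "T \<subseteq> join_sa X S T"
  unfolding join_sa_def by (auto intro: sigma_sets.Basic)

section \<open>Measurability of the marked times and stopped paths with respect to
  \<open>J\<close>\<close>

locale marked_times =
  fixes Q :: "'a measure" and F :: "real \<Rightarrow> 'a set set" and \<Delta> :: "'e::polish_space" and m :: nat
    and \<tau> :: "nat \<Rightarrow> 'a \<Rightarrow> ennreal" and \<xi> :: "nat \<Rightarrow> 'a \<Rightarrow> 'e"
  assumes pQ: "prob_space Q" and filt: "is_filtration Q F" and rc: "right_continuous_filtration F"
    and \<tau>_meas: "\<And>i. i \<in> {1..m} \<Longrightarrow> \<tau> i \<in> borel_measurable Q"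
    and \<xi>_meas: "\<And>i. i \<in> {1..m} \<Longrightarrow> \<xi> i \<in> borel_measurable Q"
    and \<xi>_ne: "\<And>i \<omega>. i \<in> {1..m} \<Longrightarrow> \<omega> \<in> space Q \<Longrightarrow> \<xi> i \<omega> \<noteq> \<Delta>"
begin

abbreviation "DD \<equiv> \<Pi>\<^sub>M j\<in>{1..m}. (skorokhod_borel :: (real \<Rightarrow> 'e) measure)"
abbreviation "J \<equiv> join_sa (space Q) (H_sa_infty (space Q) \<Delta> \<tau> \<xi> m) (F_infty Q F)"
abbreviation "os i \<omega> \<equiv> order_stat \<tau> m i \<omega>"
abbreviation "Hs i \<omega> \<equiv> H_vec \<Delta> \<tau> \<xi> m (os i \<omega>) \<omega>"
text \<open>The density is given relative to \<open>F_infty\<close>, so null sets are transferred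
  from a product in which the sample space carries \<open>Q\<close> restricted to this
  sigma-algebra.\<close>

abbreviation "QF \<equiv> restr_to_subalg Q (sigma (space Q) (F_infty Q F))"

lemma F_alg: "0 \<le> t \<Longrightarrow> sigma_algebra (space Q) (F t)" using filt by (auto simp: is_filtration_def)
lemma F_sub: "0 \<le> t \<Longrightarrow> F t \<subseteq> sets Q" using filt by (auto simp: is_filtration_def)
lemma F_mono: "0 \<le> s \<Longrightarrow> s \<le> t \<Longrightarrow> F s \<subseteq> F t" using filt by (auto simp: is_filtration_def)
lemmas F_sets = sigma_algebra_sets[OF F_alg]

lemma F_infty_alg: "sigma_algebra (space Q) (F_infty Q F)" and F_infty_sub: "F_infty Q F \<subseteq> sets Q"
  and F_le_infty: "0 \<le> t \<Longrightarrow> F t \<subseteq> F_infty Q F"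
proof -
  have "(\<Union>t\<in>{0..}. F t) \<subseteq> sets Q" using F_sub by auto
  then show "F_infty Q F \<subseteq> sets Q" unfolding F_infty_def by (rule sets.sigma_sets_subset)
  have "(\<Union>t\<in>{0..}. F t) \<subseteq> Pow (space Q)" using F_sub sets.space_closed by blast
  then show "sigma_algebra (space Q) (F_infty Q F)" unfolding F_infty_def by (rule sigma_algebra_sigma_sets)
  show "0 \<le> t \<Longrightarrow> F t \<subseteq> F_infty Q F" unfolding F_infty_def by (auto intro: sigma_sets.Basic)
qed

lemma subalg: "subalgebra Q (sigma (space Q) (F_infty Q F))"
  using F_infty_sub by (simp add: subalgebra_def sigma_algebra_sets[OF F_infty_alg])

lemma space_QF: "space QF = space Q" by (rule space_restr_to_subalg)
lemma sets_QF: "sets QF = F_infty Q F"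
  by (simp add: sets_restr_to_subalg[OF subalg] sigma_algebra_sets[OF F_infty_alg])
lemma prob_QF: "prob_space QF" by (rule prob_space_restr_to_subalg[OF subalg pQ])

lemma filt_QF: "is_filtration QF F"
  unfolding is_filtration_def space_QF sets_QF using F_alg F_le_infty F_mono by simp

lemma H_proc_meas: "i \<in> {1..m} \<Longrightarrow> H_proc \<Delta> \<tau> \<xi> i s \<in> borel_measurable Q"
proof -
  assume i: "i \<in> {1..m}"
  have [measurable]: "\<tau> i \<in> borel_measurable Q" "\<xi> i \<in> borel_measurable Q" using \<tau>_meas \<xi>_meas i by auto
  show ?thesis unfolding H_proc_def H_at_def by measurable
qed

lemma H_gen_sub: "{{\<omega>\<in>space Q. H_proc \<Delta> \<tau> \<xi> i s \<omega> \<in> B} | i s B. i \<in> {1..m} \<and> 0 \<le> s \<and> s \<le> t \<and> B \<in> sets borel} \<subseteq> sets Q"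
proof safe
  fix i s and B :: "'e set" assume i: "i \<in> {1..m}" and B: "B \<in> sets borel"
  show "{\<omega>\<in>space Q. H_proc \<Delta> \<tau> \<xi> i s \<omega> \<in> B} \<in> sets Q"
    using measurable_sets[OF H_proc_meas[OF i] B, of s] by (simp add: vimage_def Int_def conj_commute)
qed

lemma H_sa_sub: "H_sa (space Q) \<Delta> \<tau> \<xi> m t \<subseteq> sets Q"
  unfolding H_sa_def by (rule sets.sigma_sets_subset[OF H_gen_sub])

lemma H_sa_infty_sub: "H_sa_infty (space Q) \<Delta> \<tau> \<xi> m \<subseteq> sets Q"
  unfolding H_sa_infty_def by (rule sets.sigma_sets_subset) (use H_sa_sub in blast)

lemma J_sub: "J \<subseteq> sets Q"
  unfolding join_sa_def by (rule sets.sigma_sets_subset) (use H_sa_infty_sub F_infty_sub in blast)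

lemma J_alg: "sigma_algebra (space Q) J"
  unfolding join_sa_def
  by (rule sigma_algebra_sigma_sets) (use H_sa_infty_sub F_infty_sub sets.space_closed[of Q] in blast)

lemmas J_sets = sigma_algebra_sets[OF J_alg]

lemma F_infty_le_J: "F_infty Q F \<subseteq> J"
  by (rule join_sa_upper)

lemma H_sa_le_J: "0 \<le> t \<Longrightarrow> H_sa (space Q) \<Delta> \<tau> \<xi> m t \<subseteq> J"
  unfolding join_sa_def H_sa_infty_def by (auto intro!: sigma_sets.Basic)

lemma H_proc_J:
  assumes "i \<in> {1..m}" "0 \<le> s"
  shows "H_proc \<Delta> \<tau> \<xi> i s \<in> borel_measurable (sigma (space Q) J)"
proof (rule measurableI)
  fix B :: "'e set" assume B: "B \<in> sets borel"
  have "{\<omega>\<in>space Q. H_proc \<Delta> \<tau> \<xi> i s \<omega> \<in> B} \<in> H_sa (space Q) \<Delta> \<tau> \<xi> m s"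
    unfolding H_sa_def by (rule sigma_sets.Basic) (use assms B in blast)
  then have "{\<omega>\<in>space Q. H_proc \<Delta> \<tau> \<xi> i s \<omega> \<in> B} \<in> J" using H_sa_le_J[OF assms(2)] by blast
  then show "H_proc \<Delta> \<tau> \<xi> i s -` B \<inter> space (sigma (space Q) J) \<in> sets (sigma (space Q) J)"
    unfolding J_sets by (simp add: vimage_def Int_def conj_commute)
qed simp

text \<open>The process \<open>H_i\<close> has left \<open>\<Delta>\<close> at time \<open>r\<close>
  exactly if \<open>\<tau> i\<close> is at most \<open>r\<close>, because the mark is never
  \<open>\<Delta>\<close>. The time is thus observed through the process.\<close>

lemma \<tau>_J:
  assumes i: "i \<in> {1..m}" shows "\<tau> i \<in> borel_measurable (sigma (space Q) J)"
proof (rule borel_measurableI_le)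
  fix a
  show "{\<omega> \<in> space (sigma (space Q) J). \<tau> i \<omega> \<le> a} \<in> sets (sigma (space Q) J)"
  proof (cases "a = \<infinity>")
    case True then show ?thesis by simp
  next
    case False
    define r where "r = enn2real a"
    have a: "a = ennreal r" and r: "0 \<le> r" using False by (auto simp: r_def less_top)
    have "- {\<Delta>} \<in> sets borel" by simp
    from measurable_sets[OF H_proc_J[OF i r] this]
    have "H_proc \<Delta> \<tau> \<xi> i r -` (- {\<Delta>}) \<inter> space (sigma (space Q) J) \<in> sets (sigma (space Q) J)" .
    also have "H_proc \<Delta> \<tau> \<xi> i r -` (- {\<Delta>}) \<inter> space (sigma (space Q) J) = {\<omega> \<in> space (sigma (space Q) J). \<tau> i \<omega> \<le> a}"
      using \<xi>_ne[OF i] unfolding J_sets a by (auto simp: H_proc_def H_at_def not_less split: if_splits)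
    finally show ?thesis .
  qed
qed

text \<open>The mark \<open>\<xi> i\<close> is not observable on \<open>{\<tau> i = \<infinity>}\<close>, where the stopped paths do not depend on it either.\<close>
definition \<xi>' :: "nat \<Rightarrow> 'a \<Rightarrow> 'e" where "\<xi>' i \<omega> = (if \<tau> i \<omega> = \<infinity> then \<Delta> else \<xi> i \<omega>)"

text \<open>\<open>\<xi>' i\<close> is the limit of \<open>H_i\<close> along the integers: the
  sequence is eventually constant if the jump time is finite and always \<open>\<Delta>\<close>
  otherwise.\<close>

lemma \<xi>'_J:
  assumes i: "i \<in> {1..m}" shows "\<xi>' i \<in> borel_measurable (sigma (space Q) J)"
proof (rule borel_measurable_LIMSEQ_metric)
  show "H_proc \<Delta> \<tau> \<xi> i (real n) \<in> borel_measurable (sigma (space Q) J)" for n by (rule H_proc_J[OF i]) simp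
  fix \<omega>
  show "(\<lambda>n. H_proc \<Delta> \<tau> \<xi> i (real n) \<omega>) \<longlonglongrightarrow> \<xi>' i \<omega>"
  proof (cases "\<tau> i \<omega> = \<infinity>")
    case True then show ?thesis by (simp add: \<xi>'_def H_proc_def H_at_def)
  next
    case False
    obtain k :: nat where k: "enn2real (\<tau> i \<omega>) \<le> real k" using real_arch_simple by blast
    have "H_proc \<Delta> \<tau> \<xi> i (real n) \<omega> = \<xi>' i \<omega>" if "n \<ge> k" for n
    proof -
      have "\<tau> i \<omega> = ennreal (enn2real (\<tau> i \<omega>))" using False by (simp add: less_top)
      also have "\<dots> \<le> ennreal (real n)" using k that by (intro ennreal_leI) simp
      finally have "\<not> ennreal (real n) < \<tau> i \<omega>" by (simp add: not_less)
      then show ?thesis using False by (simp add: H_proc_def H_at_def \<xi>'_def)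
    qed
    then have "eventually (\<lambda>n. H_proc \<Delta> \<tau> \<xi> i (real n) \<omega> = \<xi>' i \<omega>) sequentially"
      unfolding eventually_sequentially by blast
    then show ?thesis by (rule tendsto_eventually)
  qed
qed

lemma Hs_J: "(\<lambda>\<omega>. Hs i \<omega>) \<in> sigma (space Q) J \<rightarrow>\<^sub>M DD"
proof -
  have "(\<lambda>\<omega>. H_vec \<Delta> \<tau> \<xi>' m (os i \<omega>) \<omega>) \<in> sigma (space Q) J \<rightarrow>\<^sub>M DD"
    by (rule measurable_H_vec[OF \<tau>_J \<xi>'_J measurable_order_stat[OF \<tau>_J]])
  moreover have "H_vec \<Delta> \<tau> \<xi>' m (os i \<omega>) \<omega> = Hs i \<omega>" for \<omega>
    unfolding H_vec_def H_stopped_eq_step_path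
    by (rule restrict_ext) (auto simp: \<xi>'_def step_path_def fun_eq_iff)
  ultimately show ?thesis by simp
qed

lemma pair_J: "(\<lambda>\<omega>. (Hs i \<omega>, \<omega>)) \<in> sigma (space Q) J \<rightarrow>\<^sub>M DD \<Otimes>\<^sub>M QF"
proof (rule measurable_Pair[OF Hs_J])
  show "(\<lambda>\<omega>. \<omega>) \<in> sigma (space Q) J \<rightarrow>\<^sub>M QF"
  proof (rule measurableI)
    fix A assume "A \<in> sets QF"
    then have "A \<in> F_infty Q F" by (simp add: sets_QF)
    then have "A \<in> J" and "A \<subseteq> space Q"
      using F_infty_le_J F_infty_sub sets.sets_into_space[of A Q] by blast+
    then show "(\<lambda>\<omega>. \<omega>) -` A \<inter> space (sigma (space Q) J) \<in> sets (sigma (space Q) J)"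
      unfolding J_sets by (simp add: Int_absorb2)
  qed (simp add: J_sets space_QF)
qed

text \<open>For rational \<open>q\<close>, \<open>{T < q}\<close> is a function \<open>C q\<close> of \<open>\<omega>\<close> and the paths stopped at \<open>q\<close>; these agree with the
  paths stopped at the last order statistic before \<open>q\<close>. Requiring the path to be settled at \<open>q\<close> discards the
  \<open>q\<close> before that order statistic, where \<open>C q\<close> would be evaluated at a wrong path.\<close>
lemma stopping_time_representation:
  assumes T: "stopping_time_wrt (space Q) (Gstar Q F \<Delta> \<tau> \<xi> m) T"
  shows "\<exists>f B. B \<in> J \<and> emeasure Q B = 0 \<and>
    (\<forall>t s. 0 \<le> t \<longrightarrow> t < s \<longrightarrow> {x \<in> space DD \<times> space Q. f x \<le> ennreal t} \<in> sets (DD \<Otimes>\<^sub>M sigma (space Q) (F s))) \<and>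
    (\<forall>\<omega>\<in>space Q - B. \<forall>t\<ge>0. \<forall>i\<le>m. os i \<omega> \<le> ennreal t \<longrightarrow> ennreal t < os (Suc i) \<omega> \<longrightarrow>
       (T \<omega> \<le> ennreal t \<longleftrightarrow> f (Hs i \<omega>, \<omega>) \<le> ennreal t))"
proof -
  interpret J: sigma_algebra "space Q" J by (rule J_alg)
  let ?R = "\<rat> \<inter> {0::real..}"
  have cR: "countable ?R" by (intro countable_Int1 countable_rat)
  \<comment> \<open>The strict inequality matters: \<open>{T < q}\<close> uses only levels
    \<open>r < q\<close>, and for these the intersection over \<open>s > r\<close> in
    \<open>Gstar\<close> lies in the join at \<open>q\<close> itself.\<close>
  have "\<exists>C B. C \<in> sets (DD \<Otimes>\<^sub>M sigma (space Q) (F q)) \<and> B \<in> J \<and> emeasure Q B = 0 \<and>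
     (\<forall>\<omega>\<in>space Q - B. T \<omega> < ennreal q \<longleftrightarrow> (H_vec \<Delta> \<tau> \<xi> m (ennreal q) \<omega>, \<omega>) \<in> C)" if q: "0 \<le> q" for q
  proof -
    let ?S = "join_sa (space Q) (F q) (H_sa (space Q) \<Delta> \<tau> \<xi> m q)"
    let ?G = "join_sa (space Q) (Nstar Q F \<Delta> \<tau> \<xi> m) ?S"
    have S_sub: "?S \<subseteq> sets Q" unfolding join_sa_def
      by (rule sets.sigma_sets_subset) (use F_sub[OF q] H_sa_sub in blast)
    have S_alg: "sigma_algebra (space Q) ?S" unfolding join_sa_def
      by (rule sigma_algebra_sigma_sets) (use F_sub[OF q] H_sa_sub sets.space_closed[of Q] in blast)
    have N_Pow: "Nstar Q F \<Delta> \<tau> \<xi> m \<subseteq> Pow (space Q)" unfolding Nstar_def null_sa_def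
    proof
      fix x assume "x \<in> sigma_sets (space Q) {N. \<exists>B. B \<in> J \<and> B \<in> sets Q \<and> emeasure Q B = 0 \<and> N \<subseteq> B}"
      moreover have "{N. \<exists>B. B \<in> J \<and> B \<in> sets Q \<and> emeasure Q B = 0 \<and> N \<subseteq> B} \<subseteq> Pow (space Q)"
        using sets.sets_into_space by blast
      ultimately show "x \<in> Pow (space Q)" using sigma_sets_into_sp by blast
    qed
    have G_alg: "sigma_algebra (space Q) ?G"
      by (subst join_sa_def, rule sigma_algebra_sigma_sets) (use N_Pow S_sub sets.space_closed[of Q] in blast)
    interpret G: sigma_algebra "space Q" ?G by (rule G_alg)
    have le: "{\<omega> \<in> space Q. T \<omega> \<le> ennreal r} \<in> ?G" if r: "0 \<le> r" "r < q" for r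
    proof -
      have "{\<omega> \<in> space Q. T \<omega> \<le> ennreal r} \<in> Gstar Q F \<Delta> \<tau> \<xi> m r"
        using T r(1) unfolding stopping_time_wrt_def by blast
      moreover have "Gstar Q F \<Delta> \<tau> \<xi> m r \<subseteq> ?G"
        unfolding Gstar_def
      proof (subst (1) join_sa_def, rule G.sigma_sets_subset)
        have "(\<Inter>s\<in>{r<..}. join_sa (space Q) (F s) (H_sa (space Q) \<Delta> \<tau> \<xi> m s)) \<subseteq> ?S" using r(2) by blast
        moreover have "?S \<subseteq> ?G" "Nstar Q F \<Delta> \<tau> \<xi> m \<subseteq> ?G"
          by (rule join_sa_upper)+
        ultimately show "Nstar Q F \<Delta> \<tau> \<xi> m \<union> (\<Inter>s\<in>{r<..}. join_sa (space Q) (F s) (H_sa (space Q) \<Delta> \<tau> \<xi> m s)) \<subseteq> ?G"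
          by blast
      qed
      ultimately show ?thesis by blast
    qed
    have "{\<omega> \<in> space Q. T \<omega> < ennreal q} = (\<Union>r\<in>?R \<inter> {..<q}. {\<omega> \<in> space Q. T \<omega> \<le> ennreal r})"
    proof (intro equalityI subsetI)
      fix \<omega> assume "\<omega> \<in> {\<omega> \<in> space Q. T \<omega> < ennreal q}"
      then have \<omega>: "\<omega> \<in> space Q" "T \<omega> < ennreal q" by auto
      have fin: "T \<omega> < top" using \<omega>(2) by (rule less_le_trans) simp
      have "ennreal (enn2real (T \<omega>)) < ennreal q" using \<omega>(2) fin by simp
      then obtain r where r: "r \<in> \<rat>" "enn2real (T \<omega>) < r" "ennreal r < ennreal q"
        by (rule ennreal_rat_between) auto
      have r0: "0 \<le> r" using r(2) enn2real_nonneg[of "T \<omega>"] by linarith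
      have "T \<omega> = ennreal (enn2real (T \<omega>))" using fin by simp
      also have "\<dots> \<le> ennreal r" using r(2) by (intro ennreal_leI) simp
      finally have "T \<omega> \<le> ennreal r" .
      moreover have "r < q" using r(3) r0 by (simp add: ennreal_less_iff)
      ultimately show "\<omega> \<in> (\<Union>r\<in>?R \<inter> {..<q}. {\<omega> \<in> space Q. T \<omega> \<le> ennreal r})" using \<omega>(1) r(1) r0 by auto
    next
      fix \<omega> assume "\<omega> \<in> (\<Union>r\<in>?R \<inter> {..<q}. {\<omega> \<in> space Q. T \<omega> \<le> ennreal r})"
      then obtain r where r: "0 \<le> r" "r < q" "\<omega> \<in> space Q" "T \<omega> \<le> ennreal r" by auto
      have "ennreal r < ennreal q" using r by (simp add: ennreal_less_iff)
      then show "\<omega> \<in> {\<omega> \<in> space Q. T \<omega> < ennreal q}" using r by auto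
    qed
    also have "\<dots> \<in> ?G" by (rule G.countable_UN'') (use cR le in auto)
    finally have "{\<omega> \<in> space Q. T \<omega> < ennreal q} \<in> join_sa (space Q) (null_sa Q J) ?S" unfolding Nstar_def .
    from completion_representative[OF this S_alg J_alg J_sub]
    obtain A' B where A': "A' \<in> ?S" and B: "B \<in> J" "emeasure Q B = 0"
      "\<forall>\<omega>\<in>space Q - B. \<omega> \<in> {\<omega> \<in> space Q. T \<omega> < ennreal q} \<longleftrightarrow> \<omega> \<in> A'" by blast
    from join_filtration_representation[OF F_alg[OF q] q A']
    obtain C where C: "C \<in> sets (DD \<Otimes>\<^sub>M sigma (space Q) (F q))"
      "A' = {\<omega> \<in> space Q. (H_vec \<Delta> \<tau> \<xi> m (ennreal q) \<omega>, \<omega>) \<in> C}" by blast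
    have "\<forall>\<omega>\<in>space Q - B. T \<omega> < ennreal q \<longleftrightarrow> (H_vec \<Delta> \<tau> \<xi> m (ennreal q) \<omega>, \<omega>) \<in> C"
      using B(3) unfolding C(2) by blast
    then show ?thesis using B(1,2) C(1) by blast
  qed
  then have "\<forall>q. \<exists>C. \<exists>B. 0 \<le> q \<longrightarrow> C \<in> sets (DD \<Otimes>\<^sub>M sigma (space Q) (F q)) \<and> B \<in> J \<and> emeasure Q B = 0 \<and>
     (\<forall>\<omega>\<in>space Q - B. T \<omega> < ennreal q \<longleftrightarrow> (H_vec \<Delta> \<tau> \<xi> m (ennreal q) \<omega>, \<omega>) \<in> C)" by blast
  from choice[OF this] obtain C where "\<forall>q. \<exists>B. 0 \<le> q \<longrightarrow> C q \<in> sets (DD \<Otimes>\<^sub>M sigma (space Q) (F q)) \<and> B \<in> J \<and> emeasure Q B = 0 \<and>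
     (\<forall>\<omega>\<in>space Q - B. T \<omega> < ennreal q \<longleftrightarrow> (H_vec \<Delta> \<tau> \<xi> m (ennreal q) \<omega>, \<omega>) \<in> C q)" ..
  from choice[OF this] obtain B where CB: "\<forall>q. 0 \<le> q \<longrightarrow> C q \<in> sets (DD \<Otimes>\<^sub>M sigma (space Q) (F q)) \<and> B q \<in> J \<and> emeasure Q (B q) = 0 \<and>
     (\<forall>\<omega>\<in>space Q - B q. T \<omega> < ennreal q \<longleftrightarrow> (H_vec \<Delta> \<tau> \<xi> m (ennreal q) \<omega>, \<omega>) \<in> C q)" ..
  let ?B = "\<Union>q\<in>?R. B q"
  have B_J: "?B \<in> J" by (rule J.countable_UN''[OF cR]) (use CB in auto)
  have B_null: "emeasure Q ?B = 0"
  proof -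
    have "?B \<in> null_sets Q" by (rule null_sets_UN'[OF cR]) (use CB J_sub in \<open>auto simp: null_sets_def\<close>)
    then show ?thesis by auto
  qed
  \<comment> \<open>The passage time is the earliest rational time at which the representing set is
    entered by a path that is already settled.\<close>
  define f where "f x = (INF q\<in>{q \<in> ?R. x \<in> C q \<and> fst x \<in> settled m q}. ennreal q)" for x
  have f_less: "f x < ennreal r \<longleftrightarrow> (\<exists>q\<in>?R \<inter> {..<r}. x \<in> C q \<and> fst x \<in> settled m q)" for x r
    unfolding f_def INF_less_iff by (auto simp: ennreal_less_iff)
  have f_le: "f x \<le> ennreal q" if "q \<in> ?R" "x \<in> C q" "fst x \<in> settled m q" for x q
    unfolding f_def by (rule INF_lower) (use that in simp)
  have f_meas: "{x \<in> space DD \<times> space Q. f x \<le> ennreal t} \<in> sets (DD \<Otimes>\<^sub>M sigma (space Q) (F s))" if t: "0 \<le> t" "t < s" for t s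
  proof -
    have s0: "0 \<le> s" using t by simp
    let ?P = "DD \<Otimes>\<^sub>M sigma (space Q) (F s)"
    have spP: "space ?P = space DD \<times> space Q" by (simp add: space_pair_measure F_sets[OF s0])
    \<comment> \<open>Comparing \<open>f\<close> only with rational levels in
      \<open>{t<..<s}\<close> involves only sets \<open>C q\<close> with \<open>q < s\<close>, hence
      measurability for \<open>F s\<close>. The limit \<open>s = t\<close> cannot be taken
      here.\<close>
    have "{x \<in> space DD \<times> space Q. f x \<le> ennreal t} = {x \<in> space ?P. \<forall>r\<in>\<rat> \<inter> {t<..<s}. \<exists>q\<in>?R \<inter> {..<r}. x \<in> C q \<and> fst x \<in> settled m q}"
      unfolding spP f_less[symmetric]
    proof (intro Collect_cong conj_cong refl iffI ballI)
      fix x r assume "f x \<le> ennreal t" "r \<in> \<rat> \<inter> {t<..<s}"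
      then show "f x < ennreal r" using t by (auto simp: ennreal_less_iff intro: le_less_trans)
    next
      fix x assume all: "\<forall>r\<in>\<rat> \<inter> {t<..<s}. f x < ennreal r"
      show "f x \<le> ennreal t"
      proof (rule ccontr)
        assume "\<not> ?thesis"
        then have "ennreal t < min (f x) (ennreal s)" using t by (simp add: ennreal_less_iff)
        then obtain r where r: "r \<in> \<rat>" "t < r" "ennreal r < min (f x) (ennreal s)" using t(1) by (rule ennreal_rat_between)
        then have "r < s" using t by (simp add: ennreal_less_iff)
        then have "f x < ennreal r" using all r by simp
        moreover have "ennreal r < f x" using r(3) by simp
        ultimately show False by (rule less_asym)
      qed
    qed
    also have "\<dots> \<in> sets ?P"
    proof (rule sets.sets_Collect_countable_All')
      show "countable (\<rat> \<inter> {t<..<s})" by (intro countable_Int1 countable_rat)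
      fix r assume r: "r \<in> \<rat> \<inter> {t<..<s}"
      show "{x \<in> space ?P. \<exists>q\<in>?R \<inter> {..<r}. x \<in> C q \<and> fst x \<in> settled m q} \<in> sets ?P"
      proof (rule sets.sets_Collect_countable_Ex')
        show "countable (?R \<inter> {..<r})" by (intro countable_Int1 countable_rat)
        fix q assume q: "q \<in> ?R \<inter> {..<r}"
        then have q0: "0 \<le> q" and qs: "q \<le> s" using r by auto
        have "C q \<in> sets (DD \<Otimes>\<^sub>M sigma (space Q) (F q))" using CB q0 by blast
        moreover have "F q \<subseteq> sets (sigma (space Q) (F s))" using F_mono[OF q0 qs] F_sets[OF s0] by simp
        ultimately have "C q \<in> sets ?P"
          using sets_pair_sigma_mono[of "F q" "sigma (space Q) (F s)" "space Q" DD] F_sets(2)[OF s0] by blast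
        moreover have "settled m q \<times> space Q \<in> sets ?P"
          by (rule pair_measureI[OF sets_settled[OF q0]]) (use sets.top[of "sigma (space Q) (F s)"] F_sets[OF s0] in simp)
        ultimately have "C q \<inter> (settled m q \<times> space Q) \<in> sets ?P" by blast
        moreover have "{x \<in> space ?P. x \<in> C q \<and> fst x \<in> settled m q} = C q \<inter> (settled m q \<times> space Q)"
          using sets.sets_into_space[OF \<open>C q \<in> sets ?P\<close>] unfolding spP by auto
        ultimately show "{x \<in> space ?P. x \<in> C q \<and> fst x \<in> settled m q} \<in> sets ?P" by simp
      qed
    qed
    finally show ?thesis .
  qed
  have "T \<omega> \<le> ennreal t \<longleftrightarrow> f (Hs i \<omega>, \<omega>) \<le> ennreal t"
    if \<omega>: "\<omega> \<in> space Q - ?B" and t: "0 \<le> t" and i: "i \<le> m" and lo: "os i \<omega> \<le> ennreal t" and hi: "ennreal t < os (Suc i) \<omega>" for \<omega> t i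
  proof -
    have fin: "os i \<omega> < \<infinity>" using lo by (rule le_less_trans) simp
    have settled: "Hs i \<omega> \<in> settled m q \<longleftrightarrow> os i \<omega> \<le> ennreal q" if "q \<in> ?R" for q
      by (rule H_vec_settled_iff[OF i fin]) (use that \<xi>_ne \<omega> in auto)
    \<comment> \<open>Valid only while stopping at \<open>q\<close> gives the same paths as stopping
      at the order statistic \<open>i\<close>. Smaller \<open>q\<close> are ruled out by
      \<open>settled\<close>; larger ones are avoided below by working under a level less than
      \<open>os (Suc i) \<omega>\<close>.\<close>
    have C_iff: "(Hs i \<omega>, \<omega>) \<in> C q \<longleftrightarrow> T \<omega> < ennreal q" if q: "q \<in> ?R" and "os i \<omega> \<le> ennreal q" "ennreal q < os (Suc i) \<omega>" for q
    proof -
      have "T \<omega> < ennreal q \<longleftrightarrow> (H_vec \<Delta> \<tau> \<xi> m (ennreal q) \<omega>, \<omega>) \<in> C q" using CB q \<omega> by auto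
      then show ?thesis unfolding H_vec_order_stat[OF that(2,3), of \<Delta> \<xi>] by (rule sym)
    qed
    show ?thesis
    proof
      assume Tt: "T \<omega> \<le> ennreal t"
      show "f (Hs i \<omega>, \<omega>) \<le> ennreal t"
      proof (rule ccontr)
        assume "\<not> ?thesis"
        then have "ennreal t < min (f (Hs i \<omega>, \<omega>)) (os (Suc i) \<omega>)" using hi by simp
        then obtain q where q: "q \<in> \<rat>" "t < q" "ennreal q < min (f (Hs i \<omega>, \<omega>)) (os (Suc i) \<omega>)"
          using t by (rule ennreal_rat_between)
        have tq: "ennreal t < ennreal q" using q(2) t by (simp add: ennreal_less_iff)
        have qR: "q \<in> ?R" using q t by simp
        have loq: "os i \<omega> \<le> ennreal q" using lo tq by simp
        have "(Hs i \<omega>, \<omega>) \<in> C q" using C_iff[OF qR loq] q(3) Tt tq by simp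
        then have "f (Hs i \<omega>, \<omega>) \<le> ennreal q" using settled[OF qR] loq by (intro f_le[OF qR]) simp_all
        moreover have "ennreal q < f (Hs i \<omega>, \<omega>)" using q(3) by simp
        ultimately show False using leD by blast
      qed
    next
      assume ft: "f (Hs i \<omega>, \<omega>) \<le> ennreal t"
      show "T \<omega> \<le> ennreal t"
      proof (rule ccontr)
        assume "\<not> ?thesis"
        then have "ennreal t < min (T \<omega>) (os (Suc i) \<omega>)" using hi by simp
        then obtain r where r: "r \<in> \<rat>" "t < r" "ennreal r < min (T \<omega>) (os (Suc i) \<omega>)"
          using t by (rule ennreal_rat_between)
        have "ennreal t < ennreal r" using r(2) t by (simp add: ennreal_less_iff)
        then have "f (Hs i \<omega>, \<omega>) < ennreal r" using ft by simp
        then obtain q where q: "q \<in> ?R" "q < r" "(Hs i \<omega>, \<omega>) \<in> C q" "Hs i \<omega> \<in> settled m q"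
          unfolding f_less by auto
        have qr: "ennreal q < ennreal r" using q(1,2) by (simp add: ennreal_less_iff)
        have "T \<omega> < ennreal q"
          using C_iff[OF q(1)] settled[OF q(1)] q(3,4) qr r(3) by auto
        then show False using qr r(3) by auto
      qed
    qed
  qed
  then show ?thesis using B_J B_null f_meas by (intro exI[of _ f] exI[of _ ?B]) blast
qed

end

section \<open>The splitting formula\<close>

text \<open>Recovers a real number from its rational lower cut, with \<open>- \<infinity>\<close> as
  the neutral value for rationals outside it. It turns the splitting of the superlevel sets of a
  process into a splitting of the process.\<close>

lemma SUP_rat_below: "(SUP q::rat. if real_of_rat q < y then ereal (real_of_rat q) else - \<infinity>) = ereal y"
proof (rule antisym)
  show "(SUP q::rat. if real_of_rat q < y then ereal (real_of_rat q) else - \<infinity>) \<le> ereal y"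
    by (rule SUP_least) simp
  show "ereal y \<le> (SUP q::rat. if real_of_rat q < y then ereal (real_of_rat q) else - \<infinity>)" (is "_ \<le> ?S")
  proof (rule ccontr)
    assume "\<not> ?thesis"
    then have "?S < ereal y" by simp
    then obtain r :: rat where r: "?S < ereal (real_of_rat r)" "ereal (real_of_rat r) < ereal y"
      using ereal_dense3 by blast
    have "ereal (real_of_rat r) \<le> ?S" by (rule SUP_upper2[of r]) (use r in auto)
    then show False using r(1) by simp
  qed
qed

section \<open>Reference law of the stopped paths, and splitting of sets and processes\<close>

locale marked_times_density = marked_times Q F \<Delta> m \<tau> \<xi>
  for Q :: "'a measure" and F and \<Delta> :: "'e::polish_space" and m \<tau> \<xi> +
  fixes \<nu> :: "('e \<times> ennreal) measure" and \<gamma> :: "(nat \<Rightarrow> 'e \<times> ennreal) \<times> 'a \<Rightarrow> ennreal"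
  assumes p\<nu>: "prob_space \<nu>" and sets_\<nu>: "sets \<nu> = sets (borel \<Otimes>\<^sub>M borel)"
    and \<gamma>_meas: "\<gamma> \<in> borel_measurable ((\<Pi>\<^sub>M j\<in>{1..m}. \<nu>) \<Otimes>\<^sub>M sigma (space Q) (F_infty Q F))"
    and density: "\<And>A. A \<in> sets (\<Pi>\<^sub>M j\<in>{1..m}. \<nu>) \<Longrightarrow>
           AE \<omega> in Q.
             nn_cond_exp Q (sigma (space Q) (F_infty Q F))
               (indicator {\<omega>'\<in>space Q. (\<lambda>j\<in>{1..m}. (\<xi> j \<omega>', \<tau> j \<omega>')) \<in> A}) \<omega>
             = (\<integral>\<^sup>+ x. \<gamma> (x, \<omega>) * indicator A x \<partial>(\<Pi>\<^sub>M j\<in>{1..m}. \<nu>))"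
begin

abbreviation "V \<equiv> \<Pi>\<^sub>M j\<in>{1..m}. \<nu>"
abbreviation "Z \<omega> \<equiv> \<lambda>j\<in>{1..m}. (\<xi> j \<omega>, \<tau> j \<omega>)"

text \<open>The stopped paths as a function on the space of marks and times, with the coordinates in
  place of the random variables. Its image measure under \<open>V\<close> is the reference law of
  the paths, and composed with \<open>Z\<close> it gives back \<open>Hs i\<close>.\<close>

definition Hz :: "nat \<Rightarrow> (nat \<Rightarrow> 'e \<times> ennreal) \<Rightarrow> nat \<Rightarrow> real \<Rightarrow> 'e" where
  "Hz i z = H_vec \<Delta> (\<lambda>j z. snd (z j)) (\<lambda>j z. fst (z j)) m (order_stat (\<lambda>j z. snd (z j)) m i z) z"

lemma Z_meas: "Z \<in> Q \<rightarrow>\<^sub>M V"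
proof (rule measurable_restrict)
  fix j assume "j \<in> {1..m}"
  then have "(\<lambda>\<omega>. (\<xi> j \<omega>, \<tau> j \<omega>)) \<in> Q \<rightarrow>\<^sub>M borel \<Otimes>\<^sub>M borel"
    using \<xi>_meas \<tau>_meas by (intro measurable_Pair) auto
  then show "(\<lambda>\<omega>. (\<xi> j \<omega>, \<tau> j \<omega>)) \<in> Q \<rightarrow>\<^sub>M \<nu>" using measurable_cong_sets[OF refl sets_\<nu>] by blast
qed

lemma prob_V: "prob_space V" by (rule prob_space_PiM) (rule p\<nu>)

lemma Hz_meas: "Hz i \<in> V \<rightarrow>\<^sub>M DD"
proof -
  have fst: "(\<lambda>z. fst (z j)) \<in> borel_measurable V" and snd: "(\<lambda>z. snd (z j)) \<in> borel_measurable V" if j: "j \<in> {1..m}" for j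
  proof -
    have c: "(\<lambda>z. z j) \<in> V \<rightarrow>\<^sub>M borel \<Otimes>\<^sub>M borel"
      using measurable_component_singleton[OF j, of "\<lambda>_. \<nu>"] measurable_cong_sets[OF refl sets_\<nu>] by blast
    show "(\<lambda>z. fst (z j)) \<in> borel_measurable V" by (rule measurable_compose[OF c measurable_fst])
    show "(\<lambda>z. snd (z j)) \<in> borel_measurable V" by (rule measurable_compose[OF c measurable_snd])
  qed
  show ?thesis unfolding Hz_def
    by (rule measurable_H_vec[OF snd fst measurable_order_stat[OF snd]])
qed

lemma Hz_Z: "Hz i (Z \<omega>) = Hs i \<omega>"
proof -
  have "order_stat (\<lambda>j z. snd (z j)) m i (Z \<omega>) = os i \<omega>" by (rule order_stat_cong) simp
  then show ?thesis unfolding Hz_def H_vec_def H_stopped_eq_step_path by (intro restrict_ext) simp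
qed

text \<open>\<open>null_joint_law\<close> speaks of marks and times, so \<open>\<Gamma>\<close> is
  pulled back along \<open>Hz i\<close>, which preserves its measure since the path law is an image
  measure. Membership of the event in \<open>J\<close> comes from the measurability of the true
  stopped paths.\<close>

lemma path_law_null:
  assumes \<Gamma>: "\<Gamma> \<in> sets (DD \<Otimes>\<^sub>M QF)" and null: "emeasure (distr V DD (Hz i) \<Otimes>\<^sub>M QF) \<Gamma> = 0"
  shows "{\<omega> \<in> space Q. (Hs i \<omega>, \<omega>) \<in> \<Gamma>} \<in> J" "emeasure Q {\<omega> \<in> space Q. (Hs i \<omega>, \<omega>) \<in> \<Gamma>} = 0"
proof -
  have "(\<lambda>\<omega>. (Hs i \<omega>, \<omega>)) -` \<Gamma> \<inter> space (sigma (space Q) J) \<in> sets (sigma (space Q) J)"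
    by (rule measurable_sets[OF pair_J \<Gamma>])
  then show "{\<omega> \<in> space Q. (Hs i \<omega>, \<omega>) \<in> \<Gamma>} \<in> J"
    unfolding J_sets by (simp add: vimage_def Int_def conj_commute)
  interpret V: prob_space V by (rule prob_V)
  interpret N: prob_space QF by (rule prob_QF)
  interpret L: prob_space "distr V DD (Hz i)" by (rule V.prob_space_distr[OF Hz_meas])
  interpret VN: pair_prob_space V QF ..
  interpret LN: pair_prob_space "distr V DD (Hz i)" QF ..
  let ?\<Gamma> = "(\<lambda>x. (Hz i (fst x), snd x)) -` \<Gamma> \<inter> space (V \<Otimes>\<^sub>M QF)"
  have m: "(\<lambda>x. (Hz i (fst x), snd x)) \<in> V \<Otimes>\<^sub>M QF \<rightarrow>\<^sub>M DD \<Otimes>\<^sub>M QF"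
    by (rule measurable_Pair[OF measurable_compose[OF measurable_fst Hz_meas] measurable_snd])
  have \<Gamma>': "?\<Gamma> \<in> sets (V \<Otimes>\<^sub>M QF)" by (rule measurable_sets[OF m \<Gamma>])
  have sL: "sets (distr V DD (Hz i) \<Otimes>\<^sub>M QF) = sets (DD \<Otimes>\<^sub>M QF)" by (rule sets_pair_measure_cong) auto
  have "emeasure (V \<Otimes>\<^sub>M QF) ?\<Gamma> = (\<integral>\<^sup>+\<omega>. emeasure V ((\<lambda>z. (z, \<omega>)) -` ?\<Gamma>) \<partial>QF)"
    by (rule VN.emeasure_pair_measure_alt2[OF \<Gamma>'])
  also have "\<dots> = (\<integral>\<^sup>+\<omega>. emeasure (distr V DD (Hz i)) ((\<lambda>p. (p, \<omega>)) -` \<Gamma>) \<partial>QF)"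
  proof (rule nn_integral_cong)
    fix \<omega> assume \<omega>: "\<omega> \<in> space QF"
    have "emeasure (distr V DD (Hz i)) ((\<lambda>p. (p, \<omega>)) -` \<Gamma>) = emeasure V (Hz i -` ((\<lambda>p. (p, \<omega>)) -` \<Gamma>) \<inter> space V)"
      by (rule emeasure_distr[OF Hz_meas sets_Pair2[OF \<Gamma>]])
    also have "Hz i -` ((\<lambda>p. (p, \<omega>)) -` \<Gamma>) \<inter> space V = (\<lambda>z. (z, \<omega>)) -` ?\<Gamma>"
      using \<omega> by (auto simp: space_pair_measure)
    finally show "emeasure V ((\<lambda>z. (z, \<omega>)) -` ?\<Gamma>) = emeasure (distr V DD (Hz i)) ((\<lambda>p. (p, \<omega>)) -` \<Gamma>)" by simp
  qed
  also have "\<dots> = emeasure (distr V DD (Hz i) \<Otimes>\<^sub>M QF) \<Gamma>"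
    by (rule LN.emeasure_pair_measure_alt2[symmetric]) (use \<Gamma> sL in simp)
  finally have z: "emeasure (V \<Otimes>\<^sub>M QF) ?\<Gamma> = 0" using null by simp
  have "emeasure Q {\<omega> \<in> space Q. (Z \<omega>, \<omega>) \<in> ?\<Gamma>} = 0"
    by (rule null_joint_law[OF pQ prob_V subalg Z_meas \<gamma>_meas density \<Gamma>' z])
  also have "{\<omega> \<in> space Q. (Z \<omega>, \<omega>) \<in> ?\<Gamma>} = {\<omega> \<in> space Q. (Hs i \<omega>, \<omega>) \<in> \<Gamma>}"
  proof -
    have "(Z \<omega>, \<omega>) \<in> ?\<Gamma> \<longleftrightarrow> (Hs i \<omega>, \<omega>) \<in> \<Gamma>" if "\<omega> \<in> space Q" for \<omega>
      using measurable_space[OF Z_meas that] that Hz_Z[of i \<omega>] by (simp add: space_pair_measure space_QF)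
    then show ?thesis by blast
  qed
  finally show "emeasure Q {\<omega> \<in> space Q. (Hs i \<omega>, \<omega>) \<in> \<Gamma>} = 0" .
qed

abbreviation "Opt \<equiv> optional_sa (space Q) F"

text \<open>The set version of the formula. One exceptional event covers all \<open>t\<close> and
  all \<open>i\<close>, and it lies in \<open>J\<close> so that it will be a member of
  \<open>Nstar\<close>.\<close>

definition splits :: "(real \<times> 'a) set \<Rightarrow> bool" where
  "splits A \<longleftrightarrow> (\<exists>C B. (\<forall>i. C i \<in> sets (DD \<Otimes>\<^sub>M Opt)) \<and> B \<in> J \<and> emeasure Q B = 0 \<and>
     (\<forall>\<omega>\<in>space Q - B. \<forall>t\<ge>0. \<forall>i\<le>m. os i \<omega> \<le> ennreal t \<longrightarrow> ennreal t < os (Suc i) \<omega> \<longrightarrow>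
        ((t, \<omega>) \<in> A \<longleftrightarrow> (Hs i \<omega>, (t, \<omega>)) \<in> C i)))"

text \<open>The passage time \<open>f\<close> is common to all indices, but the law of the stopped
  paths depends on \<open>i\<close>. The optional version and its null set are therefore chosen for
  each \<open>i\<close>, and the null events are united.\<close>

lemma splits_stochastic_interval:
  assumes T: "stopping_time_wrt (space Q) (Gstar Q F \<Delta> \<tau> \<xi> m) T"
  shows "splits {(t,\<omega>) \<in> {0..} \<times> space Q. T \<omega> \<le> ennreal t}"
proof -
  interpret V: prob_space V by (rule prob_V)
  from stopping_time_representation[OF T] obtain f B where B: "B \<in> J" "emeasure Q B = 0"
    and f: "\<forall>t s. 0 \<le> t \<longrightarrow> t < s \<longrightarrow> {x \<in> space DD \<times> space Q. f x \<le> ennreal t} \<in> sets (DD \<Otimes>\<^sub>M sigma (space Q) (F s))"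
    and Tf: "\<forall>\<omega>\<in>space Q - B. \<forall>t\<ge>0. \<forall>i\<le>m. os i \<omega> \<le> ennreal t \<longrightarrow> ennreal t < os (Suc i) \<omega> \<longrightarrow>
       (T \<omega> \<le> ennreal t \<longleftrightarrow> f (Hs i \<omega>, \<omega>) \<le> ennreal t)" by (elim exE conjE)
  have "\<forall>i. \<exists>C. \<exists>\<Gamma>. C \<in> sets (DD \<Otimes>\<^sub>M Opt) \<and> \<Gamma> \<in> sets (DD \<Otimes>\<^sub>M QF) \<and> emeasure (distr V DD (Hz i) \<Otimes>\<^sub>M QF) \<Gamma> = 0 \<and>
     (\<forall>x\<in>space DD \<times> space Q - \<Gamma>. \<forall>t\<ge>0. (fst x, (t, snd x)) \<in> C \<longleftrightarrow> f x \<le> ennreal t)"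
  proof
    fix i
    let ?L = "distr V DD (Hz i)"
    have pL: "prob_space ?L" by (rule V.prob_space_distr[OF Hz_meas])
    have sL: "sets (?L \<Otimes>\<^sub>M X) = sets (DD \<Otimes>\<^sub>M X)" for X :: "'x measure" by (rule sets_pair_measure_cong) auto
    have "\<exists>C\<in>sets (?L \<Otimes>\<^sub>M optional_sa (space QF) F). AE x in ?L \<Otimes>\<^sub>M QF. \<forall>t\<ge>0. (fst x, (t, snd x)) \<in> C \<longleftrightarrow> f x \<le> ennreal t"
      by (rule parametrized_graph_optional[OF pL prob_QF filt_QF rc]) (use f in \<open>simp add: sL space_QF\<close>)
    then obtain C where C: "C \<in> sets (DD \<Otimes>\<^sub>M Opt)"
      and AE: "AE x in ?L \<Otimes>\<^sub>M QF. \<forall>t\<ge>0. (fst x, (t, snd x)) \<in> C \<longleftrightarrow> f x \<le> ennreal t"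
      unfolding sL space_QF by blast
    from AE obtain \<Gamma> where \<Gamma>: "{x \<in> space (?L \<Otimes>\<^sub>M QF). \<not> (\<forall>t\<ge>0. (fst x, (t, snd x)) \<in> C \<longleftrightarrow> f x \<le> ennreal t)} \<subseteq> \<Gamma>"
      "emeasure (?L \<Otimes>\<^sub>M QF) \<Gamma> = 0" "\<Gamma> \<in> sets (?L \<Otimes>\<^sub>M QF)" by (rule AE_E)
    have sp: "space (?L \<Otimes>\<^sub>M QF) = space DD \<times> space Q" by (simp add: space_pair_measure space_QF)
    have "\<forall>x\<in>space DD \<times> space Q - \<Gamma>. \<forall>t\<ge>0. (fst x, (t, snd x)) \<in> C \<longleftrightarrow> f x \<le> ennreal t"
      using \<Gamma>(1) unfolding sp by blast
    then show "\<exists>C. \<exists>\<Gamma>. C \<in> sets (DD \<Otimes>\<^sub>M Opt) \<and> \<Gamma> \<in> sets (DD \<Otimes>\<^sub>M QF) \<and> emeasure (?L \<Otimes>\<^sub>M QF) \<Gamma> = 0 \<and>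
       (\<forall>x\<in>space DD \<times> space Q - \<Gamma>. \<forall>t\<ge>0. (fst x, (t, snd x)) \<in> C \<longleftrightarrow> f x \<le> ennreal t)"
      using C \<Gamma>(2,3) unfolding sL by blast
  qed
  from choice[OF this] obtain C where "\<forall>i. \<exists>\<Gamma>. C i \<in> sets (DD \<Otimes>\<^sub>M Opt) \<and> \<Gamma> \<in> sets (DD \<Otimes>\<^sub>M QF) \<and> emeasure (distr V DD (Hz i) \<Otimes>\<^sub>M QF) \<Gamma> = 0 \<and>
     (\<forall>x\<in>space DD \<times> space Q - \<Gamma>. \<forall>t\<ge>0. (fst x, (t, snd x)) \<in> C i \<longleftrightarrow> f x \<le> ennreal t)" ..
  from choice[OF this] obtain \<Gamma> where C\<Gamma>: "\<forall>i. C i \<in> sets (DD \<Otimes>\<^sub>M Opt) \<and> \<Gamma> i \<in> sets (DD \<Otimes>\<^sub>M QF) \<and> emeasure (distr V DD (Hz i) \<Otimes>\<^sub>M QF) (\<Gamma> i) = 0 \<and>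
     (\<forall>x\<in>space DD \<times> space Q - \<Gamma> i. \<forall>t\<ge>0. (fst x, (t, snd x)) \<in> C i \<longleftrightarrow> f x \<le> ennreal t)" ..
  define B' where "B' i = {\<omega> \<in> space Q. (Hs i \<omega>, \<omega>) \<in> \<Gamma> i}" for i
  have B': "B' i \<in> J" "emeasure Q (B' i) = 0" for i
    unfolding B'_def using C\<Gamma> path_law_null by blast+
  interpret J: sigma_algebra "space Q" J by (rule J_alg)
  let ?B = "B \<union> (\<Union>i. B' i)"
  have BJ: "?B \<in> J" using B(1) B'(1) by (intro J.Un J.countable_UN) auto
  have "?B \<in> null_sets Q"
    using B B' J_sub by (intro null_sets.Un null_sets_UN) (auto simp: null_sets_def)
  then have "emeasure Q ?B = 0" by auto
  moreover have "(t, \<omega>) \<in> {(t,\<omega>) \<in> {0..} \<times> space Q. T \<omega> \<le> ennreal t} \<longleftrightarrow> (Hs i \<omega>, (t, \<omega>)) \<in> C i"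
    if "\<omega> \<in> space Q - ?B" "0 \<le> t" "i \<le> m" "os i \<omega> \<le> ennreal t" "ennreal t < os (Suc i) \<omega>" for \<omega> t i
  proof -
    have "(Hs i \<omega>, \<omega>) \<in> space DD \<times> space Q - \<Gamma> i" using that(1) H_vec_space by (auto simp: B'_def)
    then have "(Hs i \<omega>, (t, \<omega>)) \<in> C i \<longleftrightarrow> f (Hs i \<omega>, \<omega>) \<le> ennreal t"
      using bspec[OF C\<Gamma>[THEN spec, of i, THEN conjunct2, THEN conjunct2, THEN conjunct2]] that(2) by fastforce
    moreover have "T \<omega> \<le> ennreal t \<longleftrightarrow> f (Hs i \<omega>, \<omega>) \<le> ennreal t" using Tf that by blast
    ultimately show ?thesis using that(1,2) by simp
  qed
  ultimately show ?thesis unfolding splits_def using C\<Gamma> BJ by (intro exI[of _ C] exI[of _ ?B]) blast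
qed

text \<open>The condition is pointwise within each interval between order statistics, so complements
  and countable unions can be taken in every \<open>C i\<close> separately.\<close>

lemma splits_optional:
  assumes "A \<in> sets (optional_sa (space Q) (Gstar Q F \<Delta> \<tau> \<xi> m))"
  shows "splits A"
  using assms unfolding sets_optional_sa
proof (induction rule: sigma_sets.induct)
  case (Basic a) then show ?case using splits_stochastic_interval by blast
next
  case Empty
  show ?case unfolding splits_def
    by (intro exI[of _ "\<lambda>_. {}"] exI[of _ "{}"]) (use sets.empty_sets[of "sigma (space Q) J"] in \<open>simp add: J_sets\<close>)
next
  case (Compl a)
  then obtain C B where CB: "\<forall>i. C i \<in> sets (DD \<Otimes>\<^sub>M Opt)" "B \<in> J" "emeasure Q B = 0"
    "\<forall>\<omega>\<in>space Q - B. \<forall>t\<ge>0. \<forall>i\<le>m. os i \<omega> \<le> ennreal t \<longrightarrow> ennreal t < os (Suc i) \<omega> \<longrightarrow>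
        ((t, \<omega>) \<in> a \<longleftrightarrow> (Hs i \<omega>, (t, \<omega>)) \<in> C i)" unfolding splits_def by (elim exE conjE)
  let ?C = "\<lambda>i. space (DD \<Otimes>\<^sub>M Opt) - C i"
  have "(Hs i \<omega>, (t, \<omega>)) \<in> space (DD \<Otimes>\<^sub>M Opt)" if "\<omega> \<in> space Q" "0 \<le> t" for i \<omega> t
    using H_vec_space that by (simp add: space_pair_measure space_optional_sa)
  then have "\<forall>\<omega>\<in>space Q - B. \<forall>t\<ge>0. \<forall>i\<le>m. os i \<omega> \<le> ennreal t \<longrightarrow> ennreal t < os (Suc i) \<omega> \<longrightarrow>
        ((t, \<omega>) \<in> {0..} \<times> space Q - a \<longleftrightarrow> (Hs i \<omega>, (t, \<omega>)) \<in> ?C i)"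
    using CB(4) by simp
  moreover have "\<forall>i. ?C i \<in> sets (DD \<Otimes>\<^sub>M Opt)" using CB(1) by blast
  ultimately show ?case unfolding splits_def using CB(2,3)
    by (intro exI[of _ ?C] exI[of _ B] conjI)
next
  case (Union a)
  have "\<forall>n. \<exists>C. \<exists>B. (\<forall>i. C i \<in> sets (DD \<Otimes>\<^sub>M Opt)) \<and> B \<in> J \<and> emeasure Q B = 0 \<and>
     (\<forall>\<omega>\<in>space Q - B. \<forall>t\<ge>0. \<forall>i\<le>m. os i \<omega> \<le> ennreal t \<longrightarrow> ennreal t < os (Suc i) \<omega> \<longrightarrow>
        ((t, \<omega>) \<in> a n \<longleftrightarrow> (Hs i \<omega>, (t, \<omega>)) \<in> C i))"
    by (rule allI) (rule Union.IH[unfolded splits_def])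
  from choice[OF this] obtain C where "\<forall>n. \<exists>B. (\<forall>i. C n i \<in> sets (DD \<Otimes>\<^sub>M Opt)) \<and> B \<in> J \<and> emeasure Q B = 0 \<and>
     (\<forall>\<omega>\<in>space Q - B. \<forall>t\<ge>0. \<forall>i\<le>m. os i \<omega> \<le> ennreal t \<longrightarrow> ennreal t < os (Suc i) \<omega> \<longrightarrow>
        ((t, \<omega>) \<in> a n \<longleftrightarrow> (Hs i \<omega>, (t, \<omega>)) \<in> C n i))" ..
  from choice[OF this] obtain B where CB: "\<forall>n. (\<forall>i. C n i \<in> sets (DD \<Otimes>\<^sub>M Opt)) \<and> B n \<in> J \<and> emeasure Q (B n) = 0 \<and>
     (\<forall>\<omega>\<in>space Q - B n. \<forall>t\<ge>0. \<forall>i\<le>m. os i \<omega> \<le> ennreal t \<longrightarrow> ennreal t < os (Suc i) \<omega> \<longrightarrow>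
        ((t, \<omega>) \<in> a n \<longleftrightarrow> (Hs i \<omega>, (t, \<omega>)) \<in> C n i))" ..
  interpret J: sigma_algebra "space Q" J by (rule J_alg)
  have "(\<Union>n. B n) \<in> J" using CB by (intro J.countable_UN) auto
  moreover have "emeasure Q (\<Union>n. B n) = 0" by (rule emeasure_UN_eq_0) (use CB J_sub in auto)
  moreover have "\<forall>i. (\<Union>n. C n i) \<in> sets (DD \<Otimes>\<^sub>M Opt)" using CB by (intro allI sets.countable_UN) auto
  moreover have "\<forall>\<omega>\<in>space Q - (\<Union>n. B n). \<forall>t\<ge>0. \<forall>i\<le>m. os i \<omega> \<le> ennreal t \<longrightarrow> ennreal t < os (Suc i) \<omega> \<longrightarrow>
        ((t, \<omega>) \<in> (\<Union>n. a n) \<longleftrightarrow> (Hs i \<omega>, (t, \<omega>)) \<in> (\<Union>n. C n i))"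
  proof (intro ballI allI impI)
    fix \<omega> t i assume *: "\<omega> \<in> space Q - (\<Union>n. B n)" "0 \<le> t" "i \<le> m" "os i \<omega> \<le> ennreal t" "ennreal t < os (Suc i) \<omega>"
    have "(t, \<omega>) \<in> a n \<longleftrightarrow> (Hs i \<omega>, (t, \<omega>)) \<in> C n i" for n using CB * by blast
    then show "(t, \<omega>) \<in> (\<Union>n. a n) \<longleftrightarrow> (Hs i \<omega>, (t, \<omega>)) \<in> (\<Union>n. C n i)" by blast
  qed
  ultimately show ?case unfolding splits_def by (intro exI[of _ "\<lambda>i. \<Union>n. C n i"] exI[of _ "\<Union>n. B n"] conjI)
qed

lemma splitting_formula: "optional_splitting_formula Q F \<Delta> \<tau> \<xi> m"
  unfolding optional_splitting_formula_def
proof (intro allI impI)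
  fix Y :: "real \<times> 'a \<Rightarrow> real"
  let ?G = "optional_sa (space Q) (Gstar Q F \<Delta> \<tau> \<xi> m)"
  assume Y: "Y \<in> borel_measurable ?G"
  have sp: "splits {x \<in> space ?G. real_of_rat q < Y x}" for q
    by (rule splits_optional) (use Y in measurable)
  have "\<forall>q. \<exists>C. \<exists>B. (\<forall>i. C i \<in> sets (DD \<Otimes>\<^sub>M Opt)) \<and> B \<in> J \<and> emeasure Q B = 0 \<and>
     (\<forall>\<omega>\<in>space Q - B. \<forall>t\<ge>0. \<forall>i\<le>m. os i \<omega> \<le> ennreal t \<longrightarrow> ennreal t < os (Suc i) \<omega> \<longrightarrow>
        ((t, \<omega>) \<in> {x \<in> space ?G. real_of_rat q < Y x} \<longleftrightarrow> (Hs i \<omega>, (t, \<omega>)) \<in> C i))"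
    by (rule allI) (rule sp[unfolded splits_def])
  from choice[OF this] obtain C where "\<forall>q. \<exists>B. (\<forall>i. C q i \<in> sets (DD \<Otimes>\<^sub>M Opt)) \<and> B \<in> J \<and> emeasure Q B = 0 \<and>
     (\<forall>\<omega>\<in>space Q - B. \<forall>t\<ge>0. \<forall>i\<le>m. os i \<omega> \<le> ennreal t \<longrightarrow> ennreal t < os (Suc i) \<omega> \<longrightarrow>
        ((t, \<omega>) \<in> {x \<in> space ?G. real_of_rat q < Y x} \<longleftrightarrow> (Hs i \<omega>, (t, \<omega>)) \<in> C q i))" ..
  from choice[OF this] obtain B where CB: "\<forall>q. (\<forall>i. C q i \<in> sets (DD \<Otimes>\<^sub>M Opt)) \<and> B q \<in> J \<and> emeasure Q (B q) = 0 \<and>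
     (\<forall>\<omega>\<in>space Q - B q. \<forall>t\<ge>0. \<forall>i\<le>m. os i \<omega> \<le> ennreal t \<longrightarrow> ennreal t < os (Suc i) \<omega> \<longrightarrow>
        ((t, \<omega>) \<in> {x \<in> space ?G. real_of_rat q < Y x} \<longleftrightarrow> (Hs i \<omega>, (t, \<omega>)) \<in> C q i))" ..
  interpret J: sigma_algebra "space Q" J by (rule J_alg)
  let ?B = "\<Union>q. B q"
  have BJ: "?B \<in> J" using CB by (intro J.countable_UN''[OF countableI_type]) auto
  have "?B \<in> null_sets Q" using CB J_sub by (intro null_sets_UN) (auto simp: null_sets_def)
  then have B0: "emeasure Q ?B = 0" "?B \<in> sets Q" by auto
  have BN: "?B \<in> Nstar Q F \<Delta> \<tau> \<xi> m"
    unfolding Nstar_def null_sa_def by (rule sigma_sets.Basic) (use BJ B0 in blast)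
  \<comment> \<open>Off the exceptional event the rationals \<open>q\<close> with \<open>x\<close>
    in \<open>C q i\<close> form the lower cut of the value of \<open>Y\<close>. Elsewhere the
    supremum may be infinite, and \<open>real_of_ereal\<close> then returns 0, so
    \<open>Ys i\<close> is real and measurable everywhere.\<close>
  define Ys where "Ys i x = real_of_ereal (SUP q. if x \<in> C q i then ereal (real_of_rat q) else - \<infinity>)" for i x
  have Ys_meas: "Ys i \<in> borel_measurable (DD \<Otimes>\<^sub>M Opt)" for i
  proof -
    have [measurable]: "C q i \<in> sets (DD \<Otimes>\<^sub>M Opt)" for q using CB by blast
    show ?thesis unfolding Ys_def by measurable
  qed
  have Ys_eq: "Ys i (Hs i \<omega>, (t, \<omega>)) = Y (t, \<omega>)"
    if "\<omega> \<in> space Q - ?B" "0 \<le> t" "i \<le> m" "os i \<omega> \<le> ennreal t" "ennreal t < os (Suc i) \<omega>" for \<omega> t i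
  proof -
    have mem: "(Hs i \<omega>, (t, \<omega>)) \<in> C q i \<longleftrightarrow> real_of_rat q < Y (t, \<omega>)" for q
    proof -
      have "(t, \<omega>) \<in> {x \<in> space ?G. real_of_rat q < Y x} \<longleftrightarrow> (Hs i \<omega>, (t, \<omega>)) \<in> C q i" using CB that by blast
      then show ?thesis using that by (simp add: space_optional_sa)
    qed
    show ?thesis unfolding Ys_def mem SUP_rat_below by simp
  qed
  have sum: "Y (t, \<omega>) = (\<Sum>i=0..m. Ys i (\<lambda>j\<in>{1..m}. H_stopped \<Delta> \<tau> \<xi> j (os i \<omega>) \<omega>, (t, \<omega>))
        * indicator {(s, \<omega>'). os i \<omega>' \<le> ennreal s \<and> ennreal s < os (Suc i) \<omega>'} (t, \<omega>))"
    if \<omega>: "\<omega> \<in> space Q - ?B" and t: "0 \<le> t" for \<omega> t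
  proof -
    \<comment> \<open>Exactly one indicator in the sum is nonzero, because the half-open intervals
      between order statistics partition the time axis.\<close>
    have "\<exists>!i. i \<le> m \<and> os i \<omega> \<le> ennreal t \<and> ennreal t < os (Suc i) \<omega>" by (rule order_stat_ex1) simp
    then obtain k where k0: "k \<le> m \<and> os k \<omega> \<le> ennreal t \<and> ennreal t < os (Suc k) \<omega>"
      and uniq: "\<forall>i. i \<le> m \<and> os i \<omega> \<le> ennreal t \<and> ennreal t < os (Suc i) \<omega> \<longrightarrow> i = k" by (rule ex1E)
    have k: "k \<le> m" "os k \<omega> \<le> ennreal t" "ennreal t < os (Suc k) \<omega>" using k0 by simp_all
    let ?f = "\<lambda>i. Ys i (Hs i \<omega>, (t, \<omega>)) * indicator {(s, \<omega>'). os i \<omega>' \<le> ennreal s \<and> ennreal s < os (Suc i) \<omega>'} (t, \<omega>)"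
    have "(\<Sum>i=0..m. ?f i) = ?f k + (\<Sum>i\<in>{0..m} - {k}. ?f i)" using k(1) by (intro sum.remove) auto
    also have "(\<Sum>i\<in>{0..m} - {k}. ?f i) = 0"
    proof (rule sum.neutral, rule ballI)
      fix i assume "i \<in> {0..m} - {k}"
      then have "\<not> (os i \<omega> \<le> ennreal t \<and> ennreal t < os (Suc i) \<omega>)" using uniq by auto
      then show "?f i = 0" by simp
    qed
    also have "?f k = Ys k (Hs k \<omega>, (t, \<omega>))" using k by simp
    also have "\<dots> = Y (t, \<omega>)" by (rule Ys_eq[OF \<omega> t k])
    finally have "(\<Sum>i=0..m. ?f i) = Y (t, \<omega>) + 0" .
    from this[symmetric] show ?thesis unfolding H_vec_def add_0_right .
  qed
  show "\<exists>Ys. (\<forall>i\<in>{0..m}. Ys i \<in> borel_measurable (DD \<Otimes>\<^sub>M Opt)) \<and>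
     (\<exists>N. N \<in> Nstar Q F \<Delta> \<tau> \<xi> m \<and> (\<exists>B\<in>sets Q. N \<subseteq> B \<and> emeasure Q B = 0) \<and>
        (\<forall>\<omega>\<in>space Q - N. \<forall>t\<ge>0. Y (t, \<omega>) =
           (\<Sum>i=0..m. Ys i (\<lambda>j\<in>{1..m}. H_stopped \<Delta> \<tau> \<xi> j (os i \<omega>) \<omega>, (t, \<omega>))
              * indicator {(s, \<omega>'). os i \<omega>' \<le> ennreal s \<and> ennreal s < os (Suc i) \<omega>'} (t, \<omega>))))"
  proof (intro exI[of _ Ys] conjI exI[of _ ?B] ballI allI impI)
    show "Ys i \<in> borel_measurable (DD \<Otimes>\<^sub>M Opt)" for i by (rule Ys_meas)
    show "?B \<in> Nstar Q F \<Delta> \<tau> \<xi> m" by (rule BN)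
    show "\<exists>B\<in>sets Q. ?B \<subseteq> B \<and> emeasure Q B = 0" using B0 by blast
  qed (rule sum)
qed

end

theorem mainTheorem19:
  fixes Q :: "'a measure"
    and F :: "real \<Rightarrow> 'a set set"
    and \<Delta> :: "'e::polish_space"
    and m :: nat
    and \<tau> :: "nat \<Rightarrow> 'a \<Rightarrow> ennreal"
    and \<xi> :: "nat \<Rightarrow> 'a \<Rightarrow> 'e"
    and \<nu> :: "('e \<times> ennreal) measure"
    and \<gamma> :: "(nat \<Rightarrow> 'e \<times> ennreal) \<times> 'a \<Rightarrow> ennreal"
  assumes "prob_space Q"
    and "is_filtration Q F"
    and "right_continuous_filtration F"
    and "null_sa Q (F_infty Q F) \<subseteq> F 0"
    and "\<And>i. i \<in> {1..m} \<Longrightarrow> \<tau> i \<in> borel_measurable Q"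
    and "\<And>i. i \<in> {1..m} \<Longrightarrow> \<xi> i \<in> borel_measurable Q"
    and "\<And>i \<omega>. i \<in> {1..m} \<Longrightarrow> \<omega> \<in> space Q \<Longrightarrow> \<xi> i \<omega> \<noteq> \<Delta>"
    and "prob_space \<nu>"
    and "sets \<nu> = sets (borel \<Otimes>\<^sub>M borel)"
    and "\<gamma> \<in> borel_measurable ((\<Pi>\<^sub>M j\<in>{1..m}. \<nu>) \<Otimes>\<^sub>M sigma (space Q) (F_infty Q F))"
    and "\<And>A. A \<in> sets (\<Pi>\<^sub>M j\<in>{1..m}. \<nu>) \<Longrightarrow>
           AE \<omega> in Q.
             nn_cond_exp Q (sigma (space Q) (F_infty Q F))
               (indicator {\<omega>'\<in>space Q. (\<lambda>j\<in>{1..m}. (\<xi> j \<omega>', \<tau> j \<omega>')) \<in> A}) \<omega>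
             = (\<integral>\<^sup>+ x. \<gamma> (x, \<omega>) * indicator A x \<partial>(\<Pi>\<^sub>M j\<in>{1..m}. \<nu>))"
  shows "optional_splitting_formula Q F \<Delta> \<tau> \<xi> m"
proof -
  interpret marked_times_density Q F \<Delta> m \<tau> \<xi> \<nu> \<gamma>
    by (intro marked_times_density.intro marked_times.intro marked_times_density_axioms.intro) (fact assms)+
  show ?thesis by (rule splitting_formula)
qed

end
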